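(* Let $\phi$ (with potential $\Phi$), $F$ and $j$ satisfy the standing assumptions stated in the context, and let $$\lambda_1=\lambda_1(a,j):=\inf\left\{\frac{\|v'\|_{L^2}^2}{\|v\|_{L^2}^2}\,:\,v\in D(\Psi+J),\ v\not\equiv 0\right\}.$$ If $\lambda_1>0$, then the following are true: (i) for any $v\in D(\Psi+J)$ one has $|v(t)|\le a\left(\frac{1}{\sqrt{\lambda_1}}+T\right)$ for all $t\in[0,T]$; (ii) $\mathcal{E}$ satisfies the (PS)-condition; (iii) $\mathcal{E}$ is bounded from below and attains its infimum at some $u\in D(\Psi+J)$, which is a critical point of $\mathcal{E}$ and hence a solution of the boundary value problem $$-[\phi(u')]'=\nabla_uF(t,u)\ \text{ in }[0,T],\qquad \big(\phi(u')(0),-\phi(u')(T)\big)\in\partial j(u(0),u(T)).$$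
   Context: $N\ge 1$ is an integer, $T>0$, $0<a<\infty$; $\langle\cdot|\cdot\rangle$ and $|\cdot|$ are the Euclidean inner product and norm on $\mathbb{R}^N$; $B_a$ is the open ball of radius $a$ centered at $0$. Standing assumptions. (1) $\phi$ is a homeomorphism from $B_a$ onto $\mathbb{R}^N$ with $\phi(0)=0$ and $\phi=\nabla\Phi$ on $B_a$, where $\Phi:\overline{B}_a\to(-\infty,0]$ is of class $C^1$ on $B_a$, and continuous and strictly convex on $\overline{B}_a$. (2) $F=F(t,u):[0,T]\times\mathbb{R}^N\to\mathbb{R}$ is continuous, $\nabla_uF$ exists and is continuous on $[0,T]\times\mathbb{R}^N$, and $F(\cdot,0)=0$. (3) $j:\mathbb{R}^N\times\mathbb{R}^N\to(-\infty,+\infty]$ is proper, convex, lower semicontinuous, $j(0)=0$ and $0\in\partial j(0)$, where $\partial j$ is the subdifferential of convex analysis. A solution of the boundary value problem is a function $u\in C^1([0,T];\mathbb{R}^N)$ with $|u'(t)|<a$ for all $t\in[0,T]$, $\phi(u')\in C^1([0,T];\mathbb{R}^N)$, $(u(0),u(T))\in D(\partial j)=\{z:\partial j(z)\ne\emptyset\}$, satisfying the system and the boundary condition; $\phi(u')(t)=\phi(u'(t))$. $C:=C([0,T];\mathbb{R}^N)$ with the uniform norm $\|\cdot\|_\infty$; $W^{1,\infty}:=W^{1,\infty}([0,T];\mathbb{R}^N)$; $\mathcal{K}:=\{v\in W^{1,\infty}:\|v'\|_{L^\infty}\le a\}$. $\Psi:C\to(-\infty,+\infty]$ is $\Psi(v)=\int_0^T[\Phi(v')-\Phi(0)]\,dt$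 if $v\in\mathcal{K}$ and $\Psi(v)=+\infty$ otherwise; $J(v)=j(v(0),v(T))$; $\mathcal{F}(v)=-\int_0^TF(t,v(t))\,dt$ for $v\in C$, which is of class $C^1$ with $\langle\mathcal{F}'(u),v\rangle=-\int_0^T\langle\nabla_uF(t,u)|v\rangle dt$. The energy functional is $\mathcal{E}:=\Psi+J+\mathcal{F}:C\to(-\infty,+\infty]$. $D(\Psi+J)=\{v\in\mathcal{K}:j(v(0),v(T))<+\infty\}$. An element $u\in D(\Psi+J)$ is a critical point of $\mathcal{E}$ if $(\Psi+J)(v)-(\Psi+J)(u)+\langle\mathcal{F}'(u),v-u\rangle\ge 0$ for all $v\in D(\Psi+J)$. A (PS)-sequence is a sequence $\{u_n\}\subset D(\Psi+J)$ such that $\mathcal{E}(u_n)\to c\in\mathbb{R}$ and $$\int_0^T[\Phi(v')-\Phi(u_n')]\,dt+J(v)-J(u_n)+\langle\mathcal{F}'(u_n),v-u_n\rangle\ge-\varepsilon_n\|v-u_n\|_\infty\quad\text{for all }v\in D(\Psi+J),$$ where $\varepsilon_n\to0$. $\mathcal{E}$ satisfies the (PS)-condition if every (PS)-sequence has a convergent subsequence in $C$. *)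

theory Defs
  imports "HOL-Analysis.Analysis" "HOL-Probability.Essential_Supremum"
begin

text \<open>
  A function on \<open>[0, T]\<close> is represented by a function on all of \<open>real\<close>; its values outside
  \<open>{0..T}\<close> are irrelevant to every notion below (as long as \<open>T > 0\<close>).
\<close>

section \<open>Convex analysis\<close>

definition strictly_convex_on :: "'a::real_vector set \<Rightarrow> ('a \<Rightarrow> real) \<Rightarrow> bool" where
  "strictly_convex_on S f \<longleftrightarrow> convex S \<and>
     (\<forall>x\<in>S. \<forall>y\<in>S. \<forall>s. x \<noteq> y \<and> 0 < s \<and> s < 1 \<longrightarrow>
        f ((1 - s) *\<^sub>R x + s *\<^sub>R y) < (1 - s) * f x + s * f y)"

definition proper_fun :: "('a \<Rightarrow> ereal) \<Rightarrow> bool" where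
  "proper_fun f \<longleftrightarrow> (\<forall>z. f z \<noteq> -\<infinity>) \<and> (\<exists>z. f z \<noteq> \<infinity>)"

definition convex_fun :: "('a::real_vector \<Rightarrow> ereal) \<Rightarrow> bool" where
  "convex_fun f \<longleftrightarrow> (\<forall>x y s. 0 < s \<and> s < 1 \<longrightarrow>
     f ((1 - s) *\<^sub>R x + s *\<^sub>R y) \<le> ereal (1 - s) * f x + ereal s * f y)"

definition lsc_fun :: "('a::topological_space \<Rightarrow> ereal) \<Rightarrow> bool" where
  "lsc_fun f \<longleftrightarrow> (\<forall>x. f x \<le> Liminf (nhds x) f)"

text \<open>For proper \<open>f\<close> this set is empty wherever \<open>f\<close> is infinite.\<close>

definition subdiff :: "('a::real_inner \<Rightarrow> ereal) \<Rightarrow> 'a \<Rightarrow> 'a set" where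
  "subdiff f z = {w. \<forall>y. f z + ereal (w \<bullet> (y - z)) \<le> f y}"

definition dom_subdiff :: "('a::real_inner \<Rightarrow> ereal) \<Rightarrow> 'a set" where
  "dom_subdiff f = {z. subdiff f z \<noteq> {}}"


section \<open>Function spaces on the interval\<close>

definition C_space :: "real \<Rightarrow> (real \<Rightarrow> 'a::euclidean_space) set" where
  "C_space T = {v. continuous_on {0..T} v}"

definition sup_norm :: "real \<Rightarrow> (real \<Rightarrow> 'a::euclidean_space) \<Rightarrow> real" where
  "sup_norm T v = (SUP t\<in>{0..T}. norm (v t))"

text \<open>The library's \<open>esssup\<close> is \<open>\<infinity>\<close> on non-measurable functions, but only the norm is passed
  to it here, so measurability of \<open>g\<close> itself is demanded separately in \<open>Linf_space\<close>.\<close>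

definition Linf_norm :: "real \<Rightarrow> (real \<Rightarrow> 'a::euclidean_space) \<Rightarrow> ereal" where
  "Linf_norm T g = esssup (lebesgue_on {0..T}) (\<lambda>t. ereal (norm (g t)))"

definition Linf_space :: "real \<Rightarrow> (real \<Rightarrow> 'a::euclidean_space) set" where
  "Linf_space T = {g \<in> borel_measurable (lebesgue_on {0..T}). Linf_norm T g < \<infinity>}"

definition L2_norm_on :: "real \<Rightarrow> (real \<Rightarrow> 'a::euclidean_space) \<Rightarrow> real" where
  "L2_norm_on T g = sqrt (LINT t|lebesgue_on {0..T}. (norm (g t))\<^sup>2)"

text \<open>Continuously differentiable functions with compact support in the open interval.\<close>

definition test_fun :: "real \<Rightarrow> (real \<Rightarrow> real) \<Rightarrow> bool" where
  "test_fun T \<eta> \<longleftrightarrow> \<eta> C1_differentiable_on UNIV \<and> closure {t. \<eta> t \<noteq> 0} \<subseteq> {0<..<T}"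

definition weak_deriv_of :: "real \<Rightarrow> (real \<Rightarrow> 'a::euclidean_space) \<Rightarrow> (real \<Rightarrow> 'a) \<Rightarrow> bool" where
  "weak_deriv_of T v g \<longleftrightarrow> (\<forall>\<eta>. test_fun T \<eta> \<longrightarrow>
     (LINT t|lebesgue_on {0..T}. deriv \<eta> t *\<^sub>R v t) = - (LINT t|lebesgue_on {0..T}. \<eta> t *\<^sub>R g t))"

text \<open>Elements of the Sobolev space are identified with their continuous representatives.\<close>

definition W1inf :: "real \<Rightarrow> (real \<Rightarrow> 'a::euclidean_space) set" where
  "W1inf T = {v \<in> C_space T. \<exists>g\<in>Linf_space T. weak_deriv_of T v g}"

text \<open>A representative of the weak derivative, which is determined only up to a null set.\<close>

definition wderiv :: "real \<Rightarrow> (real \<Rightarrow> 'a::euclidean_space) \<Rightarrow> real \<Rightarrow> 'a" where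
  "wderiv T v = (SOME g. g \<in> Linf_space T \<and> weak_deriv_of T v g)"

text \<open>\<open>u\<close> is continuously differentiable on \<open>[0, T]\<close> (one-sided at the endpoints) with
  derivative \<open>u'\<close>.\<close>

definition C1_with_deriv :: "real \<Rightarrow> (real \<Rightarrow> 'a::euclidean_space) \<Rightarrow> (real \<Rightarrow> 'a) \<Rightarrow> bool" where
  "C1_with_deriv T u u' \<longleftrightarrow> continuous_on {0..T} u' \<and>
     (\<forall>t\<in>{0..T}. (u has_vector_derivative u' t) (at t within {0..T}))"


section \<open>The energy functional\<close>

definition K_set :: "real \<Rightarrow> real \<Rightarrow> (real \<Rightarrow> 'a::euclidean_space) set" where
  "K_set T a = {v \<in> W1inf T. Linf_norm T (wderiv T v) \<le> ereal a}"

definition Psi :: "real \<Rightarrow> real \<Rightarrow> ('a::euclidean_space \<Rightarrow> real) \<Rightarrow> (real \<Rightarrow> 'a) \<Rightarrow> ereal" where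
  "Psi T a \<Phi> v = (if v \<in> K_set T a
     then ereal (LINT t|lebesgue_on {0..T}. \<Phi> (wderiv T v t) - \<Phi> 0) else \<infinity>)"

definition Jfun :: "real \<Rightarrow> ('a \<times> 'a::euclidean_space \<Rightarrow> ereal) \<Rightarrow> (real \<Rightarrow> 'a) \<Rightarrow> ereal" where
  "Jfun T j v = j (v 0, v T)"

definition Ffun :: "real \<Rightarrow> (real \<Rightarrow> 'a::euclidean_space \<Rightarrow> real) \<Rightarrow> (real \<Rightarrow> 'a) \<Rightarrow> real" where
  "Ffun T F v = - (LINT t|lebesgue_on {0..T}. F t (v t))"

text \<open>The derivative of \<open>Ffun T F\<close> at \<open>u\<close> in direction \<open>v\<close>; \<open>gradF t\<close> is the gradient of \<open>F t\<close>.\<close>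

definition Ffun_deriv ::
  "real \<Rightarrow> (real \<Rightarrow> 'a::euclidean_space \<Rightarrow> 'a) \<Rightarrow> (real \<Rightarrow> 'a) \<Rightarrow> (real \<Rightarrow> 'a) \<Rightarrow> real" where
  "Ffun_deriv T gradF u v = - (LINT t|lebesgue_on {0..T}. gradF t (u t) \<bullet> v t)"

definition energy :: "real \<Rightarrow> real \<Rightarrow> ('a::euclidean_space \<Rightarrow> real) \<Rightarrow> ('a \<times> 'a \<Rightarrow> ereal) \<Rightarrow>
    (real \<Rightarrow> 'a \<Rightarrow> real) \<Rightarrow> (real \<Rightarrow> 'a) \<Rightarrow> ereal" where
  "energy T a \<Phi> j F v = Psi T a \<Phi> v + Jfun T j v + ereal (Ffun T F v)"

definition dom_PsiJ :: "real \<Rightarrow> real \<Rightarrow> ('a \<times> 'a::euclidean_space \<Rightarrow> ereal) \<Rightarrow> (real \<Rightarrow> 'a) set" where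
  "dom_PsiJ T a j = {v \<in> K_set T a. j (v 0, v T) < \<infinity>}"

definition critical_point :: "real \<Rightarrow> real \<Rightarrow> ('a::euclidean_space \<Rightarrow> real) \<Rightarrow>
    ('a \<times> 'a \<Rightarrow> ereal) \<Rightarrow> (real \<Rightarrow> 'a \<Rightarrow> 'a) \<Rightarrow> (real \<Rightarrow> 'a) \<Rightarrow> bool" where
  "critical_point T a \<Phi> j gradF u \<longleftrightarrow> u \<in> dom_PsiJ T a j \<and>
     (\<forall>v\<in>dom_PsiJ T a j.
        (Psi T a \<Phi> v + Jfun T j v) - (Psi T a \<Phi> u + Jfun T j u)
          + ereal (Ffun_deriv T gradF u (\<lambda>t. v t - u t)) \<ge> 0)"

definition PS_sequence :: "real \<Rightarrow> real \<Rightarrow> ('a::euclidean_space \<Rightarrow> real) \<Rightarrow>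
    ('a \<times> 'a \<Rightarrow> ereal) \<Rightarrow> (real \<Rightarrow> 'a \<Rightarrow> real) \<Rightarrow> (real \<Rightarrow> 'a \<Rightarrow> 'a) \<Rightarrow> (nat \<Rightarrow> real \<Rightarrow> 'a) \<Rightarrow> bool" where
  "PS_sequence T a \<Phi> j F gradF u \<longleftrightarrow>
     (\<forall>n. u n \<in> dom_PsiJ T a j) \<and>
     (\<exists>c::real. (\<lambda>n. energy T a \<Phi> j F (u n)) \<longlonglongrightarrow> ereal c) \<and>
     (\<exists>\<epsilon>::nat \<Rightarrow> real. \<epsilon> \<longlonglongrightarrow> 0 \<and>
        (\<forall>n. \<forall>v\<in>dom_PsiJ T a j.
           ereal (LINT t|lebesgue_on {0..T}. \<Phi> (wderiv T v t) - \<Phi> (wderiv T (u n) t))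
             + Jfun T j v - Jfun T j (u n)
             + ereal (Ffun_deriv T gradF (u n) (\<lambda>t. v t - u n t))
           \<ge> ereal (- \<epsilon> n * sup_norm T (\<lambda>t. v t - u n t))))"

definition PS_condition :: "real \<Rightarrow> real \<Rightarrow> ('a::euclidean_space \<Rightarrow> real) \<Rightarrow>
    ('a \<times> 'a \<Rightarrow> ereal) \<Rightarrow> (real \<Rightarrow> 'a \<Rightarrow> real) \<Rightarrow> (real \<Rightarrow> 'a \<Rightarrow> 'a) \<Rightarrow> bool" where
  "PS_condition T a \<Phi> j F gradF \<longleftrightarrow>
     (\<forall>u. PS_sequence T a \<Phi> j F gradF u \<longrightarrow>
        (\<exists>r w. strict_mono r \<and> w \<in> C_space T \<and>
           (\<lambda>n::nat. sup_norm T (\<lambda>t. u (r n) t - w t)) \<longlonglongrightarrow> 0))"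

text \<open>The set is nonempty whenever \<open>a, T > 0\<close> and \<open>j 0 = 0\<close> (it contains the quotients of small
  bumps supported in \<open>(0, T)\<close>), and it is bounded below by 0, so the real infimum is genuine.\<close>

definition lambda1 :: "real \<Rightarrow> real \<Rightarrow> ('a \<times> 'a::euclidean_space \<Rightarrow> ereal) \<Rightarrow> real" where
  "lambda1 T a j = Inf {(L2_norm_on T (wderiv T v))\<^sup>2 / (L2_norm_on T v)\<^sup>2 | v.
     v \<in> dom_PsiJ T a j \<and> (\<exists>t\<in>{0..T}. v t \<noteq> 0)}"


section \<open>The boundary value problem\<close>

text \<open>\<open>w\<close> is the derivative of \<open>\<phi>(u')\<close>.\<close>

definition bvp_solution :: "real \<Rightarrow> real \<Rightarrow> ('a::euclidean_space \<Rightarrow> 'a) \<Rightarrow>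
    ('a \<times> 'a \<Rightarrow> ereal) \<Rightarrow> (real \<Rightarrow> 'a \<Rightarrow> 'a) \<Rightarrow> (real \<Rightarrow> 'a) \<Rightarrow> bool" where
  "bvp_solution T a \<phi> j gradF u \<longleftrightarrow>
     (\<exists>u' w. C1_with_deriv T u u' \<and>
        (\<forall>t\<in>{0..T}. norm (u' t) < a) \<and>
        C1_with_deriv T (\<lambda>t. \<phi> (u' t)) w \<and>
        (u 0, u T) \<in> dom_subdiff j \<and>
        (\<forall>t\<in>{0..T}. - w t = gradF t (u t)) \<and>
        (\<phi> (u' 0), - \<phi> (u' T)) \<in> subdiff j (u 0, u T))"

end

(* Elements of K are the primitives of measurable functions bounded by a, so everything takes place at
   the level of derivatives.  A function in the domain is at some point no larger than a / sqrt lambda_1,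
   by the definition of lambda_1, and is a-Lipschitz; hence the a priori bound, and by Arzela-Ascoli the
   compactness behind the (PS)-condition.  For the existence of a minimiser, lower semicontinuity of Psi
   replaces weak compactness: near-minimisers of the L^2 norm among approximating derivatives converge
   almost everywhere.

   A minimiser u is regular by duality.  Write P for the primitive of gradF(., u).  With the endpoints of u
   fixed, u' minimises the integral of Phi(h) + <P, h> under the constraint int h = u(T) - u(0).  The dual
   problem is finite-dimensional and coercive, and yields l such that psi(l - P), with psi the inverse of
   phi, satisfies the constraint; by strict convexity u' = psi(l - P).  This takes values in the open ball
   and phi(u') = l - P is C^1.  Affine variations of u then give the boundary condition. *)

theory Submission
  imports Defs "HOL-Complex_Analysis.Great_Picard"
begin

section \<open>Primitives of bounded measurable functions\<close>

text \<open>The obstacle is that an admissible derivative may a priori touch the sphere |x| = a on a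
  set of positive measure. There no gradient of \<Phi> is available, \<phi> is unbounded nearby, and
  variations may leave the constraint, so the Euler equation cannot be read off by differentiating
  along arbitrary variations. The conjugate of \<Phi> has none of these defects: it is finite
  everywhere, a-Lipschitz, has the bounded map \<psi> as gradient, and grows at least like a |y|
  because \<Phi> \<le> 0 on the sphere. The dual functional then grows at rate a T - |u(T) - u(0)|,
  so its coercivity rests on a strict bound for the increment of u. In the extremal case u' would be
  a constant vector of length a; this is excluded first, using that the radial part of \<phi> is
  unbounded along every ray. Since \<open>wderiv\<close> is a choice determined only up to a null
  set, every function is accompanied by an explicit derivative that is bounded by a
  everywhere.\<close>

abbreviation leb :: "real \<Rightarrow> real measure" where
  "leb T \<equiv> lebesgue_on {0..T}"

text \<open>The bound is imposed at every real t and not almost everywhere, so that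
  \<open>\<Phi> (g t)\<close> is always an evaluation on the closed ball, where \<Phi> is continuous
  and convex, and no exceptional set has to be carried along.\<close>

definition bdd_meas :: "real \<Rightarrow> real \<Rightarrow> (real \<Rightarrow> 'a::euclidean_space) set" where
  "bdd_meas T a = {g \<in> borel_measurable (leb T). \<forall>t. norm (g t) \<le> a}"

text \<open>Integrating an indicator against the fixed measure, instead of integrating over {0..t},
  lets one measure space serve Fubini, dominated convergence and differences of primitives.\<close>

definition primitive :: "real \<Rightarrow> (real \<Rightarrow> 'a::euclidean_space) \<Rightarrow> real \<Rightarrow> 'a" where
  "primitive T g t = (LINT s|leb T. indicator {0..t} s *\<^sub>R g s)"

lemma compact_continuous_bounded:
  assumes "compact S" "continuous_on S f"
  obtains B where "0 \<le> B" "\<And>x. x \<in> S \<Longrightarrow> norm (f x) \<le> B"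
proof -
  obtain B where B: "\<forall>y\<in>f ` S. norm y \<le> B"
    using compact_imp_bounded[OF compact_continuous_image[OF assms(2,1)]] bounded_iff by blast
  show ?thesis by (rule that[of "max 0 B"]) (use B in fastforce)+
qed

lemma finite_measure_leb: "finite_measure (leb T)"
  by (simp add: finite_measure_lebesgue_on)

lemma integrable_leb_bounded:
  fixes f :: "real \<Rightarrow> 'a::euclidean_space"
  assumes "f \<in> borel_measurable (leb T)" "\<And>t. t \<in> {0..T} \<Longrightarrow> norm (f t) \<le> B"
  shows "integrable (leb T) f"
  using assms by (intro finite_measure.integrable_const_bound[OF finite_measure_leb, of _ B] AE_I2) auto

lemma measurable_leb_continuous:
  fixes f :: "real \<Rightarrow> 'a::euclidean_space"
  shows "continuous_on {0..T} f \<Longrightarrow> f \<in> borel_measurable (leb T)"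
  by (simp add: continuous_imp_measurable_on_sets_lebesgue)

lemma integrable_leb_continuous:
  fixes f :: "real \<Rightarrow> 'a::euclidean_space"
  shows "continuous_on {0..T} f \<Longrightarrow> integrable (leb T) f"
  using continuous_imp_integrable[of 0 T f] by simp

lemma LINT_leb_continuous:
  fixes f :: "real \<Rightarrow> 'a::euclidean_space"
  assumes "continuous_on {0..T} f"
  shows "(LINT t|leb T. f t) = integral {0..T} f"
  using integrable_leb_continuous[OF assms] by (intro lebesgue_integral_eq_integral) auto

lemma measure_leb: "0 \<le> T \<Longrightarrow> measure (leb T) (space (leb T)) = T"
  by (simp add: measure_restrict_space)

lemma LINT_leb_const: "0 \<le> T \<Longrightarrow> (LINT t|leb T. c) = T *\<^sub>R (c::'a::euclidean_space)"
  using measure_leb[of T] by simp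

lemma bdd_measD:
  assumes "g \<in> bdd_meas T a"
  shows "g \<in> borel_measurable (leb T)" "norm (g t) \<le> a" "integrable (leb T) g"
  using assms by (auto simp: bdd_meas_def intro: integrable_leb_bounded)

lemma measurable_indicator_leb:
  fixes g :: "real \<Rightarrow> 'a::euclidean_space"
  assumes "g \<in> borel_measurable (leb T)" "A \<in> sets borel"
  shows "(\<lambda>s. indicator A s *\<^sub>R g s) \<in> borel_measurable (leb T)"
proof -
  have "indicator A \<in> borel_measurable (leb T)"
    using assms(2) by (intro measurable_restrict_space1 borel_measurable_indicator) auto
  with assms show ?thesis by measurable
qed

lemma integrable_indicator_leb:
  fixes g :: "real \<Rightarrow> 'a::euclidean_space"
  assumes "integrable (leb T) g" "A \<in> sets borel"
  shows "integrable (leb T) (\<lambda>s. indicator A s *\<^sub>R g s)"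
  by (rule Bochner_Integration.integrable_bound[OF assms(1)])
     (use assms in \<open>auto intro!: measurable_indicator_leb split: split_indicator\<close>)

text \<open>The indicator form is the shape of the inner integral once the order of integration has
  been exchanged in \<open>integration_by_parts_primitive\<close>.\<close>

lemma LINT_leb_FTC:
  fixes f :: "real \<Rightarrow> 'a::euclidean_space"
  assumes f: "continuous_on {0..T} f"
    and P: "\<And>t. t \<in> {0..T} \<Longrightarrow> (P has_vector_derivative f t) (at t within {0..T})"
    and cd: "0 \<le> c" "c \<le> d" "d \<le> T"
  shows "(LINT t|leb T. indicator {c..d} t *\<^sub>R f t) = P d - P c"
proof -
  have sub: "{c..d} \<subseteq> {0..T}" using cd by auto
  have "(LINT t|leb T. indicator {c..d} t *\<^sub>R f t) = (LINT t|lebesgue_on {c..d}. f t)"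
  proof -
    have "(LINT t|leb T. indicator {c..d} t *\<^sub>R f t) = (LINT t|leb T. (if t \<in> {c..d} then f t else 0))"
      by (rule Bochner_Integration.integral_cong) auto
    also have "\<dots> = (LINT t|lebesgue_on {c..d}. f t)"
      using sub by (subst integral_restrict) auto
    finally show ?thesis .
  qed
  also have "\<dots> = integral {c..d} f"
    using continuous_imp_integrable[of c d f] continuous_on_subset[OF f sub]
    by (intro lebesgue_integral_eq_integral) auto
  also have "\<dots> = P d - P c"
  proof (rule integral_unique, rule fundamental_theorem_of_calculus[OF cd(2)])
    fix t assume "t \<in> {c..d}"
    then show "(P has_vector_derivative f t) (at t within {c..d})"
      using P[of t] sub has_vector_derivative_within_subset by blast
  qed
  finally show ?thesis .
qed

lemma primitive_diff:
  assumes g: "integrable (leb T) g" and st: "s \<le> t" "0 \<le> s"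
  shows "primitive T g t - primitive T g s = (LINT x|leb T. indicator {s<..t} x *\<^sub>R g x)"
  unfolding primitive_def
  by (subst Bochner_Integration.integral_diff[symmetric])
     (use st in \<open>auto intro!: integrable_indicator_leb g Bochner_Integration.integral_cong split: split_indicator\<close>)

lemma primitive_T: "primitive T g T = (LINT s|leb T. g s)"
  unfolding primitive_def by (rule Bochner_Integration.integral_cong) auto

lemma primitive_diff_norm_le:
  assumes g: "g \<in> bdd_meas T a" and st: "0 \<le> s" "s \<le> t" "t \<le> T"
  shows "norm (primitive T g t - primitive T g s) \<le> a * (t - s)"
proof -
  have meas: "measure (leb T) {s<..t} = t - s"
    using st by (subst measure_restrict_space) (auto simp: )
  have sets: "{s<..t} \<in> sets (leb T)"
    using st by (auto simp: sets_restrict_space intro!: image_eqI[of _ _ "{s<..t}"])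
  have fin: "emeasure (leb T) {s<..t} < \<infinity>"
    using finite_measure.emeasure_finite[OF finite_measure_leb] by (simp add: top.not_eq_extremum)
  have int: "integrable (leb T) (\<lambda>x. a * indicator {s<..t} x)"
    using sets fin by (intro integrable_mult_right integrable_real_indicator) auto
  have "norm (primitive T g t - primitive T g s) \<le> (LINT x|leb T. a * indicator {s<..t} x)"
    unfolding primitive_diff[OF bdd_measD(3)[OF g] st(2,1)]
    by (rule Bochner_Integration.integral_norm_bound_integral)
       (use int bdd_measD(2)[OF g] in \<open>auto split: split_indicator intro!: integrable_indicator_leb bdd_measD(3)[OF g]\<close>)
  also have "\<dots> = a * (t - s)"
    using sets fin meas st by (simp add: Int_absorb2 subset_iff)
  finally show ?thesis .
qed

lemma AE_leb_neq: "AE t in leb T. t \<noteq> c"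
proof (rule AE_I')
  show "{c} \<inter> {0..T} \<in> null_sets (leb T)"
    by (cases "c \<in> {0..T}") (auto simp: null_sets_restrict_space)
qed auto

lemma primitive_0 [simp]: "primitive T g 0 = 0"
proof -
  have "AE s in leb T. indicator {0..0} s *\<^sub>R g s = 0"
    using AE_leb_neq[of 0 T] by eventually_elim auto
  then show ?thesis
    unfolding primitive_def by (rule integral_eq_zero_AE)
qed

lemma primitive_lipschitz:
  assumes g: "g \<in> bdd_meas T a" and st: "s \<in> {0..T}" "t \<in> {0..T}"
  shows "norm (primitive T g t - primitive T g s) \<le> a * \<bar>t - s\<bar>"
  using primitive_diff_norm_le[OF g, of s t] primitive_diff_norm_le[OF g, of t s] st
  by (cases "s \<le> t") (auto simp: norm_minus_commute)

lemma continuous_primitive: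
  assumes g: "g \<in> bdd_meas T a"
  shows "continuous_on {0..T} (primitive T g)"
proof -
  have "0 \<le> a" using bdd_measD(2)[OF g, of 0] norm_ge_zero order_trans by blast
  then have "a-lipschitz_on {0..T} (primitive T g)"
    using primitive_lipschitz[OF g]
    by (auto simp: lipschitz_on_def dist_norm dist_real_def norm_minus_commute abs_minus_commute)
  then show ?thesis by (rule lipschitz_on_continuous_on)
qed

text \<open>The primitive of a merely measurable \<open>g\<close> need not be differentiable
  everywhere, so no product rule is used: the left side is an integral over the triangle s \<le> t,
  and Fubini exchanges the order. The product is kept general because scaling is used for weak
  derivatives and the inner product for the force term.\<close>

lemma integration_by_parts_primitive:
  fixes f :: "real \<Rightarrow> 'b::euclidean_space" and g :: "real \<Rightarrow> 'c::euclidean_space"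
    and prod :: "'b \<Rightarrow> 'c \<Rightarrow> 'd::euclidean_space" (infixl "\<odot>" 70)
  assumes bil: "bounded_bilinear prod"
    and g: "g \<in> bdd_meas T a"
    and f: "continuous_on {0..T} f"
    and P: "\<And>t. t \<in> {0..T} \<Longrightarrow> (P has_vector_derivative f t) (at t within {0..T})"
  shows "(LINT t|leb T. f t \<odot> primitive T g t)
    = P T \<odot> primitive T g T - (LINT t|leb T. P t \<odot> g t)"
proof -
  interpret bounded_bilinear "(\<odot>)" by fact
  have gm [measurable]: "g \<in> borel_measurable (leb T)" and gi: "integrable (leb T) g"
    and gb: "norm (g t) \<le> a" for t
    using bdd_measD[OF g] by auto
  have fm [measurable]: "f \<in> borel_measurable (leb T)" and fi: "integrable (leb T) f"
    using f by (auto intro: measurable_leb_continuous integrable_leb_continuous)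
  have id [measurable]: "(\<lambda>x. x) \<in> borel_measurable (leb T)"
    by (intro measurable_leb_continuous continuous_intros)
  obtain B where B: "\<And>t. t \<in> {0..T} \<Longrightarrow> norm (f t) \<le> B"
    using compact_continuous_bounded[OF compact_Icc f] by blast
  obtain K where K: "\<And>x y. norm (x \<odot> y) \<le> norm x * norm y * K" and "K \<ge> 0"
    using nonneg_bounded by blast
  interpret F: finite_measure "leb T" by (rule finite_measure_leb)
  interpret pair_sigma_finite "leb T" "leb T" ..
  interpret FP: finite_measure "leb T \<Otimes>\<^sub>M leb T"
    by (intro finite_measure_pair_measure finite_measure_leb)
  define h where "h t s = (if s \<le> t then f t \<odot> g s else 0)" for t s
  have meas: "case_prod h \<in> borel_measurable (leb T \<Otimes>\<^sub>M leb T)"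
    unfolding h_def split_beta
    by (intro measurable_If borel_measurable_continuous_Pair[where H = "(\<odot>)"])
       (use id in \<open>auto intro!: continuous_on fm gm continuous_intros\<close>)
  have int: "integrable (leb T \<Otimes>\<^sub>M leb T) (case_prod h)"
  proof (rule FP.integrable_const_bound[OF AE_I2 meas])
    fix x assume "x \<in> space (leb T \<Otimes>\<^sub>M leb T)"
    then obtain t s where x: "x = (t, s)" "t \<in> {0..T}" by (auto simp: space_pair_measure)
    have "norm (f t \<odot> g s) \<le> B * a * K"
      using K[of "f t" "g s"] mult_mono[OF B[OF x(2)] gb[of s]] \<open>K \<ge> 0\<close> B[OF x(2)]
      by (smt (verit) mult_right_mono norm_ge_zero)
    moreover have "0 \<le> B * a * K"
      using calculation norm_ge_zero order_trans by blast
    ultimately show "norm (case_prod h x) \<le> B * a * K"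
      by (simp add: x h_def)
  qed
  have "(LINT t|leb T. f t \<odot> primitive T g t) = (LINT t|leb T. LINT s|leb T. h t s)"
  proof (rule Bochner_Integration.integral_cong[OF refl])
    fix t assume "t \<in> space (leb T)"
    have "(LINT s|leb T. h t s) = (LINT s|leb T. f t \<odot> (indicator {0..t} s *\<^sub>R g s))"
      by (rule Bochner_Integration.integral_cong) (auto simp: h_def zero_right)
    also have "\<dots> = f t \<odot> primitive T g t"
      unfolding primitive_def
      by (rule integral_bounded_linear[OF bounded_linear_right]) (simp add: integrable_indicator_leb gi)
    finally show "f t \<odot> primitive T g t = (LINT s|leb T. h t s)" ..
  qed
  also have "\<dots> = (LINT s|leb T. LINT t|leb T. h t s)"
    by (rule Fubini_integral[OF int, symmetric])
  also have "\<dots> = (LINT s|leb T. P T \<odot> g s - P s \<odot> g s)"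
  proof (rule Bochner_Integration.integral_cong[OF refl])
    fix s assume s: "s \<in> space (leb T)"
    have "(LINT t|leb T. h t s) = (LINT t|leb T. (indicator {s..T} t *\<^sub>R f t) \<odot> g s)"
      by (rule Bochner_Integration.integral_cong) (auto simp: h_def zero_left)
    also have "\<dots> = (LINT t|leb T. indicator {s..T} t *\<^sub>R f t) \<odot> g s"
      by (rule integral_bounded_linear[OF bounded_linear_left]) (simp add: integrable_indicator_leb fi)
    also have "\<dots> = P T \<odot> g s - P s \<odot> g s"
      using s by (subst LINT_leb_FTC[OF f P]) (auto simp: diff_left)
    finally show "(LINT t|leb T. h t s) = P T \<odot> g s - P s \<odot> g s" .
  qed
  also have "\<dots> = (LINT s|leb T. P T \<odot> g s) - (LINT s|leb T. P s \<odot> g s)"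
  proof (rule Bochner_Integration.integral_diff)
    show "integrable (leb T) (\<lambda>s. P T \<odot> g s)"
      by (rule integrable_bounded_linear[OF bounded_linear_right gi])
    have cP: "continuous_on {0..T} P"
      unfolding continuous_on_eq_continuous_within
      using P has_vector_derivative_continuous by blast
    have Pm [measurable]: "P \<in> borel_measurable (leb T)"
      by (rule measurable_leb_continuous[OF cP])
    obtain C where C: "\<And>t. t \<in> {0..T} \<Longrightarrow> norm (P t) \<le> C"
      using compact_continuous_bounded[OF compact_Icc cP] by blast
    show "integrable (leb T) (\<lambda>s. P s \<odot> g s)"
    proof (rule integrable_leb_bounded)
      show "(\<lambda>s. P s \<odot> g s) \<in> borel_measurable (leb T)"
        by (intro borel_measurable_continuous_Pair[where H = "(\<odot>)"])
           (auto intro!: continuous_on gm Pm continuous_intros)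
      show "norm (P t \<odot> g t) \<le> C * a * K" if "t \<in> {0..T}" for t
        using K[of "P t" "g t"] mult_mono[OF C[OF that] gb[of t]] \<open>K \<ge> 0\<close> C[OF that]
        by (smt (verit) mult_right_mono norm_ge_zero)
    qed
  qed
  also have "(LINT s|leb T. P T \<odot> g s) = P T \<odot> primitive T g T"
    unfolding primitive_T by (rule integral_bounded_linear[OF bounded_linear_right gi])
  finally show ?thesis .
qed

text \<open>The primitive gives the integrals over half-lines, an intersection-stable generator;
  hence the integral over every Borel set vanishes, and a function with this property is zero almost
  everywhere.\<close>

lemma primitive_eq_0_imp_AE_eq_0:
  fixes g :: "real \<Rightarrow> 'a::euclidean_space"
  assumes g: "integrable (leb T) g"
    and 0: "\<And>t. t \<in> {0..T} \<Longrightarrow> primitive T g t = 0"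
  shows "AE t in leb T. g t = 0"
proof (cases "0 \<le> T")
  case False
  then show ?thesis by (intro AE_I2) auto
next
  case T: True
  have borel: "(LINT s|leb T. indicator A s *\<^sub>R g s) = 0" if "A \<in> sets borel" for A
  proof -
    have "Int_stable (range (atMost :: real \<Rightarrow> real set))"
      by (auto simp: Int_stable_def)
    moreover have "range (atMost :: real \<Rightarrow> real set) \<subseteq> Pow UNIV" by simp
    moreover have "A \<in> sigma_sets UNIV (range (atMost :: real \<Rightarrow> real set))"
      using that by (simp add: borel_eq_atMost)
    ultimately show ?thesis
    proof (induct rule: sigma_sets_induct_disjoint)
      case (basic B)
      then obtain t where B: "B = {..t}" by auto
      \<comment> \<open>Only the part of the half-line inside {0..T} counts: it contributes nothing,
        \<open>primitive T g t\<close>, or the full integral.\<close>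
      consider "t < 0" | "t \<in> {0..T}" | "T < t" by fastforce
      then show ?case
      proof cases
        case 1
        then have "(LINT s|leb T. indicator B s *\<^sub>R g s) = (LINT s|leb T. 0)"
          by (intro Bochner_Integration.integral_cong) (auto simp: B)
        then show ?thesis by simp
      next
        case 2
        then have "(LINT s|leb T. indicator B s *\<^sub>R g s) = primitive T g t"
          unfolding primitive_def
          by (intro Bochner_Integration.integral_cong) (auto simp: B split: split_indicator)
        with 0 2 show ?thesis by simp
      next
        case 3
        then have "(LINT s|leb T. indicator B s *\<^sub>R g s) = primitive T g T"
          unfolding primitive_def
          by (intro Bochner_Integration.integral_cong) (auto simp: B split: split_indicator)
        with 0 T show ?thesis by simp
      qed
    next
      case empty
      then show ?case by simp
    next
      case (compl B)
      then have B: "B \<in> sets borel" by (simp add: borel_eq_atMost)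
      have "(LINT s|leb T. indicator (UNIV - B) s *\<^sub>R g s)
        = (LINT s|leb T. g s - indicator B s *\<^sub>R g s)"
        by (intro Bochner_Integration.integral_cong) (auto split: split_indicator)
      also have "\<dots> = primitive T g T - 0"
        using compl integrable_indicator_leb[OF g B] g
        by (subst Bochner_Integration.integral_diff) (auto simp: primitive_T)
      finally show ?case using 0 T by simp
    next
      case (union B)
      then have B: "B i \<in> sets borel" for i by (auto simp: borel_eq_atMost)
      have "(LINT s|leb T. indicator (\<Union>i. B i) s *\<^sub>R g s)
        = (\<Sum>i. LINT s|leb T. indicator (B i) s *\<^sub>R g s)"
      proof -
        have "set_integrable (leb T) (\<Union>i. B i \<inter> {0..T}) g"
          unfolding set_integrable_def
          by (rule Bochner_Integration.integrable_cong[THEN iffD1, OF refl _ integrable_indicator_leb[OF g, of "\<Union>i. B i"]])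
             (use B in \<open>auto split: split_indicator\<close>)
        moreover have "B i \<inter> {0..T} \<in> sets (leb T)" for i
          using B by (auto simp: sets_restrict_space)
        ultimately have "(LINT s:(\<Union>i. B i \<inter> {0..T})|leb T. g s) = (\<Sum>i. LINT s:(B i \<inter> {0..T})|leb T. g s)"
          using union(1)
          by (intro lebesgue_integral_countable_add) (auto simp: disjoint_family_on_def)
        moreover have "(LINT s:(\<Union>i. B i \<inter> {0..T})|leb T. g s) = (LINT s|leb T. indicator (\<Union>i. B i) s *\<^sub>R g s)"
          unfolding set_lebesgue_integral_def
          by (intro Bochner_Integration.integral_cong) (auto split: split_indicator)
        moreover have "(LINT s:(B i \<inter> {0..T})|leb T. g s) = (LINT s|leb T. indicator (B i) s *\<^sub>R g s)" for i
          unfolding set_lebesgue_integral_def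
          by (intro Bochner_Integration.integral_cong) (auto split: split_indicator)
        ultimately show ?thesis by simp
      qed
      with union show ?case by simp
    qed
  qed
  show ?thesis
  proof (rule sigma_finite_measure.density_zero[OF _ g])
    show "sigma_finite_measure (leb T)"
      using finite_measure_leb finite_measure.axioms(1) by blast
    fix A assume "A \<in> sets (leb T)"
    then have "A \<in> sets lebesgue" and "A \<subseteq> {0..T}"
      by (auto simp: sets_restrict_space)
    \<comment> \<open>Sets of \<open>leb T\<close> are Lebesgue measurable, whereas the induction
      above reaches Borel sets; the two differ by part of a null set.\<close>
    then obtain C N N' where A: "A = C \<union> N" "N \<subseteq> N'" "N' \<in> null_sets lborel" "C \<in> sets borel"
      by (auto elim!: sets_completionE)
    have N': "N' \<in> null_sets lebesgue" using A by (simp add: null_sets_completionI)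
    have "AE s in leb T. s \<notin> N'"
      using AE_not_in[OF N'] by (auto simp: AE_restrict_space_iff elim: eventually_mono)
    then have "AE s in leb T. indicator A s *\<^sub>R g s = indicator C s *\<^sub>R g s"
      using A(2) by (auto simp: A(1) elim!: eventually_mono split: split_indicator)
    moreover have "(\<lambda>s. indicator A s *\<^sub>R g s) \<in> borel_measurable (leb T)"
      using \<open>A \<in> sets (leb T)\<close> g by (intro borel_measurable_scaleR borel_measurable_indicator) auto
    ultimately have "(LINT s|leb T. indicator A s *\<^sub>R g s) = (LINT s|leb T. indicator C s *\<^sub>R g s)"
      using A(4) g measurable_indicator_leb[of g T C] by (intro integral_cong_AE) auto
    with borel[OF A(4)] show "set_lebesgue_integral (leb T) A g = 0"
      by (simp add: set_lebesgue_integral_def)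
  qed
qed

section \<open>Weak derivatives\<close>

lemma LINT_leb_nonneg_continuous_eq_0:
  fixes f :: "real \<Rightarrow> real"
  assumes f: "continuous_on {0..T} f" and nonneg: "\<And>t. t \<in> {0..T} \<Longrightarrow> 0 \<le> f t"
    and 0: "(LINT t|leb T. f t) = 0" and t: "t \<in> {0..T}" and T: "0 < T"
  shows "f t = 0"
proof -
  have "(f has_integral 0) (cbox 0 T)"
    using 0 LINT_leb_continuous[OF f] integrable_integral[OF integrable_continuous_interval[OF f]]
    by simp
  then show ?thesis
    using has_integral_0_cbox_imp_0[of 0 T f t] f nonneg t T by auto
qed

lemma test_funI:
  assumes cont: "continuous_on UNIV D"
    and D: "\<And>t. (\<eta> has_vector_derivative D t) (at t)"
    and supp: "\<And>t. \<eta> t \<noteq> 0 \<Longrightarrow> t \<in> {c..d}" and cd: "0 < c" "d < T"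
  shows "test_fun T \<eta>" "deriv \<eta> t = D t"
proof -
  have "closure {t. \<eta> t \<noteq> 0} \<subseteq> {c..d}"
    by (rule closure_minimal) (use supp in auto)
  with cont D cd show "test_fun T \<eta>"
    unfolding test_fun_def C1_differentiable_on_def by force
  show "deriv \<eta> t = D t"
    using D[of t] by (intro DERIV_imp_deriv) (simp add: has_real_derivative_iff_has_vector_derivative)
qed

lemma test_funD:
  assumes "test_fun T \<eta>"
  shows "(\<eta> has_vector_derivative deriv \<eta> t) (at t within S)" "continuous_on S (deriv \<eta>)"
    "t \<notin> {0<..<T} \<Longrightarrow> \<eta> t = 0"
proof -
  obtain D where D: "\<And>t. (\<eta> has_vector_derivative D t) (at t)" "continuous_on UNIV D"
    using assms by (auto simp: test_fun_def C1_differentiable_on_def)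
  then have eq: "deriv \<eta> = D"
    by (auto intro!: DERIV_imp_deriv simp: has_real_derivative_iff_has_vector_derivative)
  show "(\<eta> has_vector_derivative deriv \<eta> t) (at t within S)"
    using D(1) has_vector_derivative_at_within unfolding eq by blast
  show "continuous_on S (deriv \<eta>)"
    using D(2) continuous_on_subset unfolding eq by blast
  show "t \<notin> {0<..<T} \<Longrightarrow> \<eta> t = 0"
    using assms closure_subset[of "{t. \<eta> t \<noteq> 0}"] by (auto simp: test_fun_def)
qed

text \<open>The test function is a primitive of \<open>\<beta> (w - m)\<close>, where \<open>\<beta>\<close> is a bump on \<open>(c, d)\<close> and
  \<open>m\<close> is the \<open>\<beta>\<close>-weighted mean of \<open>w\<close>: then \<open>\<integral> \<beta> (w - m)\<^sup>2 = 0\<close>.\<close>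

lemma du_Bois_Reymond_inner:
  fixes w :: "real \<Rightarrow> real"
  assumes w: "continuous_on {0..T} w" and cd: "0 < c" "c < d" "d < T"
    and test: "\<And>\<eta>. test_fun T \<eta> \<Longrightarrow> (LINT t|leb T. deriv \<eta> t * w t) = 0"
  shows "\<exists>m. \<forall>t\<in>{c<..<d}. w t = m"
proof -
  have T: "0 < T" using cd by simp
  \<comment> \<open>A test function must be continuously differentiable on the whole line, but
    \<open>w\<close> is continuous only on {0..T}; clamping the argument extends it
    continuously.\<close>
  define clampT where "clampT t = max 0 (min T t)" for t
  define W where "W t = w (clampT t)" for t
  define \<beta> where "\<beta> t = max 0 ((t - c) * (d - t))" for t
  have W: "continuous_on S W" for S
    unfolding W_def clampT_def using T
    by (intro continuous_on_compose2[OF w] continuous_intros) auto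
  have \<beta>: "continuous_on S \<beta>" for S
    unfolding \<beta>_def by (intro continuous_intros)
  have \<beta>0: "\<beta> t = 0" if "t \<notin> {c<..<d}" for t
    using that mult_nonpos_nonneg[of "t - c" "d - t"] mult_nonneg_nonpos[of "t - c" "d - t"] cd
    unfolding \<beta>_def by (cases "t \<le> c") auto
  have \<beta>pos: "\<beta> t > 0" if "t \<in> {c<..<d}" for t
    using that by (auto simp: \<beta>_def less_max_iff_disj)
  have \<beta>nn: "\<beta> t \<ge> 0" for t by (simp add: \<beta>_def)
  define C where "C = integral {0..T} \<beta>"
  have C: "C \<noteq> 0"
  proof
    assume "C = 0"
    then have "\<beta> ((c + d) / 2) = 0"
      using cd by (intro LINT_leb_nonneg_continuous_eq_0[where T = T, OF \<beta> \<beta>nn])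
        (auto simp: C_def LINT_leb_continuous[OF \<beta>])
    with \<beta>pos[of "(c + d) / 2"] cd show False by auto
  qed
  define m where "m = integral {0..T} (\<lambda>t. \<beta> t * W t) / C"
  define D where "D t = \<beta> t * (W t - m)" for t
  have D: "continuous_on S D" for S
    unfolding D_def by (intro continuous_intros \<beta> W)
  \<comment> \<open>For t < 0 the interval is empty and the integral is 0 by default, which is the
    correct value because \<open>D\<close> vanishes to the left of c > 0.\<close>
  define \<eta> where "\<eta> t = integral {0..t} D" for t
  have D0: "D t = 0" if "t \<notin> {c<..<d}" for t using \<beta>0[OF that] by (simp add: D_def)
  have zero_int: "integral {p..q} D = 0" if "q \<le> c \<or> d \<le> p" for p q
    by (rule integral_unique, rule has_integral_is_0) (use that D0 in auto)
  have comb: "integral {p..q} D + integral {q..r} D = integral {p..r} D" if "p \<le> q" "q \<le> r" for p q r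
    using that integrable_continuous_interval[OF D]
    by (rule Henstock_Kurzweil_Integration.integral_combine)
  have der: "(\<eta> has_vector_derivative D t) (at t)" for t
  proof (cases "0 < t")
    case True
    have "((\<lambda>u. integral {0..u} D) has_vector_derivative D t) (at t within {0..t+1})"
      by (rule integral_has_vector_derivative[OF D]) (use True in auto)
    moreover have "at t within {0..t+1} = at t"
      by (rule at_within_interior) (use True in \<open>simp add: interior_atLeastAtMost_real\<close>)
    ultimately show ?thesis by (simp add: \<eta>_def[abs_def])
  next
    case False
    have "((\<lambda>_. 0) has_vector_derivative 0) (at t)" by simp
    then have "(\<eta> has_vector_derivative 0) (at t)"
    proof (rule has_vector_derivative_transform_within_open[where S = "{..<c}"])
      show "0 = \<eta> u" if "u \<in> {..<c}" for u
        using zero_int[of u 0] that by (simp add: \<eta>_def)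
    qed (use False cd in auto)
    then show ?thesis using D0[of t] False cd by simp
  qed
  have mean: "integral {0..T} D = 0"
  proof -
    have "integral {0..T} D = integral {0..T} (\<lambda>t. \<beta> t * W t - m * \<beta> t)"
      by (rule integral_cong) (simp add: D_def algebra_simps)
    also have "\<dots> = integral {0..T} (\<lambda>t. \<beta> t * W t) - m * integral {0..T} \<beta>"
      by (subst Henstock_Kurzweil_Integration.integral_diff)
         (auto intro!: integrable_continuous_interval continuous_intros \<beta> W)
    also have "\<dots> = 0" using C by (simp add: m_def C_def)
    finally show ?thesis .
  qed
  have supp: "\<eta> t = 0" if "t \<notin> {c..d}" for t
  proof (cases "t < c")
    case True
    then show ?thesis using zero_int[of t 0] by (simp add: \<eta>_def)
  next
    case False
    then have t: "t > d" using that by auto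
    then have "integral {0..t} D = integral {0..d} D" "integral {0..T} D = integral {0..d} D"
      using comb[of 0 d t] comb[of 0 d T] zero_int[of t d] zero_int[of T d] cd by auto
    with mean show ?thesis by (simp add: \<eta>_def)
  qed
  have "test_fun T \<eta>" and "deriv \<eta> t = D t" for t
    using test_funI[OF D[of UNIV] der, of c d T] supp cd by blast+
  then have Dw: "(LINT t|leb T. D t * w t) = 0"
    using test[of \<eta>] by simp
  \<comment> \<open>The weighted square expands to \<open>D t * w t - m * D t\<close>. The first
    term integrates to zero by the hypothesis on test functions, the second because \<open>m\<close>
    is the weighted mean.\<close>
  have "(LINT t|leb T. \<beta> t * (W t - m)\<^sup>2) = (LINT t|leb T. D t * w t - m * D t)"
  proof (rule Bochner_Integration.integral_cong[OF refl])
    fix t assume "t \<in> space (leb T)"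
    then have "W t = w t" by (simp add: W_def clampT_def)
    then show "\<beta> t * (W t - m)\<^sup>2 = D t * w t - m * D t"
      by (simp add: D_def power2_eq_square algebra_simps)
  qed
  also have "\<dots> = (LINT t|leb T. D t * w t) - (LINT t|leb T. m * D t)"
    by (rule Bochner_Integration.integral_diff)
       (intro integrable_leb_continuous continuous_on_mult D w continuous_on_const)+
  also have "(LINT t|leb T. m * D t) = m * integral {0..T} D"
    by (simp add: LINT_leb_continuous[OF D])
  finally have "(LINT t|leb T. \<beta> t * (W t - m)\<^sup>2) = 0"
    by (simp add: Dw mean)
  then have zero: "\<beta> t * (W t - m)\<^sup>2 = 0" if "t \<in> {c<..<d}" for t
    using that cd T \<beta>nn
    by (intro LINT_leb_nonneg_continuous_eq_0[where T = T and f = "\<lambda>t. \<beta> t * (W t - m)\<^sup>2"])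
       (auto intro!: continuous_intros \<beta> W)
  have "w t = m" if "t \<in> {c<..<d}" for t
  proof -
    have "W t = m" using zero[OF that] \<beta>pos[OF that] by simp
    moreover have "clampT t = t" using that cd by (auto simp: clampT_def)
    ultimately show ?thesis by (simp add: W_def)
  qed
  then show ?thesis by (intro exI[of _ m] ballI)
qed

text \<open>Every interior point lies together with T/2 in an interval whose closure is inside (0,
  T), so the constants of the local version agree; continuity carries the value to the
  endpoints.\<close>

lemma du_Bois_Reymond_real:
  fixes w :: "real \<Rightarrow> real"
  assumes w: "continuous_on {0..T} w" and T: "0 < T"
    and test: "\<And>\<eta>. test_fun T \<eta> \<Longrightarrow> (LINT t|leb T. deriv \<eta> t * w t) = 0"
    and t: "t \<in> {0..T}"
  shows "w t = w 0"
proof -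
  have mid: "w s = w (T/2)" if s: "s \<in> {0<..<T}" for s
  proof -
    define c d where "c = min s (T/2) / 2" and "d = (max s (T/2) + T) / 2"
    have cd: "0 < c" "c < d" "d < T" "s \<in> {c<..<d}" "T/2 \<in> {c<..<d}"
      using s T by (auto simp: c_def d_def)
    have "\<exists>m. \<forall>u\<in>{c<..<d}. w u = m"
      by (rule du_Bois_Reymond_inner[OF w cd(1-3) test])
    then show ?thesis using cd(4,5) by force
  qed
  define K where "K = w (T/2)"
  have "w u = K" if "u \<in> {0..T}" for u
  proof (rule continuous_constant_on_closure[where S = "{0<..<T}" and f = w])
    show "continuous_on (closure {0<..<T}) w" "u \<in> closure {0<..<T}"
      using w T that by (auto simp: closure_greaterThanLessThan)
    show "w s = K" if "s \<in> {0<..<T}" for s using mid[OF that] by (simp add: K_def)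
  qed
  with t T show ?thesis by simp
qed

lemma du_Bois_Reymond:
  fixes w :: "real \<Rightarrow> 'a::euclidean_space"
  assumes w: "continuous_on {0..T} w" and T: "0 < T"
    and test: "\<And>\<eta>. test_fun T \<eta> \<Longrightarrow> (LINT t|leb T. deriv \<eta> t *\<^sub>R w t) = 0"
    and t: "t \<in> {0..T}"
  shows "w t = w 0"
proof (rule euclidean_eqI)
  fix b :: 'a assume "b \<in> Basis"
  show "w t \<bullet> b = w 0 \<bullet> b"
  proof (rule du_Bois_Reymond_real[OF _ T _ t])
    show "continuous_on {0..T} (\<lambda>t. w t \<bullet> b)" by (intro continuous_intros w)
    fix \<eta> assume \<eta>: "test_fun T \<eta>"
    have "(LINT t|leb T. deriv \<eta> t * (w t \<bullet> b)) = (LINT t|leb T. (deriv \<eta> t *\<^sub>R w t) \<bullet> b)"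
      by simp
    also have "\<dots> = (LINT t|leb T. deriv \<eta> t *\<^sub>R w t) \<bullet> b"
      by (rule integral_bounded_linear[OF bounded_linear_inner_left])
         (intro integrable_leb_continuous continuous_intros w test_funD(2)[OF \<eta>])
    finally show "(LINT t|leb T. deriv \<eta> t * (w t \<bullet> b)) = 0" by (simp add: test[OF \<eta>])
  qed
qed

text \<open>In the integration by parts the boundary term vanishes with the test function at T, and
  the constant \<open>c\<close> drops out because the derivative of a test function integrates to
  zero.\<close>

lemma weak_deriv_of_primitive:
  assumes g: "g \<in> bdd_meas T b" and v: "\<And>t. t \<in> {0..T} \<Longrightarrow> v t = c + primitive T g t"
  shows "weak_deriv_of T v g"
  unfolding weak_deriv_of_def
proof (intro allI impI)
  fix \<eta> assume \<eta>: "test_fun T \<eta>"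
  have "(LINT t|leb T. deriv \<eta> t *\<^sub>R v t)
    = (LINT t|leb T. deriv \<eta> t *\<^sub>R c + deriv \<eta> t *\<^sub>R primitive T g t)"
    by (rule Bochner_Integration.integral_cong) (auto simp: v scaleR_add_right)
  also have "\<dots> = (LINT t|leb T. deriv \<eta> t *\<^sub>R c) + (LINT t|leb T. deriv \<eta> t *\<^sub>R primitive T g t)"
    by (rule Bochner_Integration.integral_add)
       (intro integrable_leb_continuous continuous_intros test_funD(2)[OF \<eta>] continuous_primitive[OF g])+
  also have "(LINT t|leb T. deriv \<eta> t *\<^sub>R c) = (LINT t|leb T. deriv \<eta> t) *\<^sub>R c"
    by (rule integral_bounded_linear[OF bounded_linear_scaleR_left])
       (intro integrable_leb_continuous test_funD(2)[OF \<eta>])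
  also have "(LINT t|leb T. deriv \<eta> t) = 0"
  proof (cases "0 \<le> T")
    case True
    have "(LINT t|leb T. deriv \<eta> t) = (LINT t|leb T. indicator {0..T} t *\<^sub>R deriv \<eta> t)"
      by (rule Bochner_Integration.integral_cong) auto
    also have "\<dots> = \<eta> T - \<eta> 0"
      by (rule LINT_leb_FTC) (use True test_funD[OF \<eta>] in auto)
    finally show ?thesis using test_funD(3)[OF \<eta>] by simp
  qed auto
  also have "(LINT t|leb T. deriv \<eta> t *\<^sub>R primitive T g t)
    = \<eta> T *\<^sub>R primitive T g T - (LINT t|leb T. \<eta> t *\<^sub>R g t)"
    by (rule integration_by_parts_primitive[OF bounded_bilinear_scaleR g test_funD(2,1)[OF \<eta>]])
  finally show "(LINT t|leb T. deriv \<eta> t *\<^sub>R v t) = - (LINT t|leb T. \<eta> t *\<^sub>R g t)"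
    using test_funD(3)[OF \<eta>] by simp
qed

text \<open>The difference of \<open>v\<close> and the primitive has weak derivative zero, so du
  Bois-Reymond makes it constant.\<close>

lemma weak_deriv_imp_primitive:
  assumes T: "0 < T" and v: "continuous_on {0..T} v"
    and g: "g \<in> bdd_meas T b" and weak: "weak_deriv_of T v g" and t: "t \<in> {0..T}"
  shows "v t = v 0 + primitive T g t"
proof -
  have "v t - primitive T g t = v 0 - primitive T g 0"
  proof (rule du_Bois_Reymond[OF _ T _ t, where w = "\<lambda>t. v t - primitive T g t"])
    show "continuous_on {0..T} (\<lambda>t. v t - primitive T g t)"
      by (intro continuous_intros v continuous_primitive[OF g])
    fix \<eta> assume \<eta>: "test_fun T \<eta>"
    have "weak_deriv_of T (primitive T g) g"
      by (rule weak_deriv_of_primitive[OF g, of _ 0]) simp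
    then show "(LINT t|leb T. deriv \<eta> t *\<^sub>R (v t - primitive T g t)) = 0"
      using weak \<eta> unfolding weak_deriv_of_def scaleR_diff_right
      by (subst Bochner_Integration.integral_diff)
         (auto intro!: integrable_leb_continuous continuous_intros v continuous_primitive[OF g] test_funD(2)[OF \<eta>])
  qed
  then show ?thesis by (simp add: algebra_simps)
qed

section \<open>Elements of \<open>K_set\<close> as primitives\<close>

lemma weak_deriv_of_cong_AE:
  assumes "AE t in leb T. g t = h t" "g \<in> borel_measurable (leb T)" "h \<in> borel_measurable (leb T)"
  shows "weak_deriv_of T v g \<longleftrightarrow> weak_deriv_of T v h"
proof -
  have "(LINT t|leb T. \<eta> t *\<^sub>R g t) = (LINT t|leb T. \<eta> t *\<^sub>R h t)" if \<eta>: "test_fun T \<eta>" for \<eta>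
  proof (rule integral_cong_AE)
    have "continuous_on {0..T} \<eta>"
      using test_funD(1)[OF \<eta>] has_vector_derivative_continuous
      by (metis continuous_on_eq_continuous_within)
    then have "\<eta> \<in> borel_measurable (leb T)" by (rule measurable_leb_continuous)
    with assms show "(\<lambda>t. \<eta> t *\<^sub>R g t) \<in> borel_measurable (leb T)"
      "(\<lambda>t. \<eta> t *\<^sub>R h t) \<in> borel_measurable (leb T)" by auto
    show "AE t in leb T. \<eta> t *\<^sub>R g t = \<eta> t *\<^sub>R h t"
      using assms(1) by eventually_elim simp
  qed
  then show ?thesis by (auto simp: weak_deriv_of_def)
qed

text \<open>Turns the almost everywhere bound of an essential supremum into the pointwise bound of
  \<open>bdd_meas\<close>; the bad values are replaced by 0.\<close>

lemma bdd_meas_truncate: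
  assumes "g \<in> borel_measurable (leb T)" "AE t in leb T. norm (g t) \<le> b" "0 \<le> b"
  obtains h where "h \<in> bdd_meas T b" "AE t in leb T. g t = h t"
proof
  show "(\<lambda>t. if norm (g t) \<le> b then g t else 0) \<in> bdd_meas T b"
    using assms by (auto simp: bdd_meas_def)
  show "AE t in leb T. g t = (if norm (g t) \<le> b then g t else 0)"
    using assms(2) by eventually_elim simp
qed

lemma bdd_meas_imp_Linf:
  assumes "g \<in> bdd_meas T b"
  shows "g \<in> Linf_space T" "Linf_norm T g \<le> ereal b"
proof -
  show 1: "Linf_norm T g \<le> ereal b"
    unfolding Linf_norm_def using bdd_measD[OF assms] by (intro esssup_I) auto
  show "g \<in> Linf_space T"
    unfolding Linf_space_def using bdd_measD[OF assms] 1 by (auto intro: le_less_trans)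
qed

lemma Linf_AE_bounded:
  assumes "Linf_norm T g \<le> ereal b"
  shows "AE t in leb T. norm (g t) \<le> b"
proof -
  have "AE t in leb T. ereal (norm (g t)) \<le> Linf_norm T g"
    unfolding Linf_norm_def by (rule esssup_AE)
  then show ?thesis
    by eventually_elim (use assms order_trans in fastforce)
qed

lemma W1inf_wderiv:
  assumes "v \<in> W1inf T"
  shows "wderiv T v \<in> Linf_space T" "weak_deriv_of T v (wderiv T v)"
proof -
  have "\<exists>g. g \<in> Linf_space T \<and> weak_deriv_of T v g" using assms by (auto simp: W1inf_def)
  from someI_ex[OF this] show "wderiv T v \<in> Linf_space T" "weak_deriv_of T v (wderiv T v)"
    by (auto simp: wderiv_def)
qed

lemma K_set_imp_primitive:
  assumes T: "0 < T" and a: "0 \<le> a" and v: "v \<in> K_set T a"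
  obtains g where "g \<in> bdd_meas T a" "\<And>t. t \<in> {0..T} \<Longrightarrow> v t = v 0 + primitive T g t"
    "AE t in leb T. wderiv T v t = g t"
proof -
  have W: "v \<in> W1inf T" and n: "Linf_norm T (wderiv T v) \<le> ereal a"
    using v by (auto simp: K_set_def)
  have m: "wderiv T v \<in> borel_measurable (leb T)"
    using W1inf_wderiv(1)[OF W] by (simp add: Linf_space_def)
  obtain g where g: "g \<in> bdd_meas T a" "AE t in leb T. wderiv T v t = g t"
    using bdd_meas_truncate[OF m Linf_AE_bounded[OF n] a] by blast
  have "weak_deriv_of T v g"
    using W1inf_wderiv(2)[OF W] weak_deriv_of_cong_AE[OF g(2) m bdd_measD(1)[OF g(1)]] by simp
  then have "v t = v 0 + primitive T g t" if "t \<in> {0..T}" for t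
    using that W by (intro weak_deriv_imp_primitive[OF T _ g(1)]) (auto simp: W1inf_def C_space_def)
  with g that show ?thesis by blast
qed

text \<open>The representative chosen by \<open>wderiv\<close> comes only with some finite bound
  \<open>b\<close>, possibly different from \<open>a\<close>. It makes \<open>v\<close> a primitive
  a second time, and uniqueness of the integrand identifies it with \<open>g\<close> almost
  everywhere, which transfers the bound \<open>a\<close>.\<close>

lemma primitive_imp_K_set:
  assumes T: "0 < T" and a: "0 \<le> a" and g: "g \<in> bdd_meas T a"
    and v: "\<And>t. t \<in> {0..T} \<Longrightarrow> v t = v 0 + primitive T g t"
  shows "v \<in> K_set T a" "AE t in leb T. wderiv T v t = g t"
proof -
  have cont: "continuous_on {0..T} v"
    using v by (subst continuous_on_cong[OF refl v]) (auto intro!: continuous_intros continuous_primitive[OF g])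
  have W: "v \<in> W1inf T"
    using cont bdd_meas_imp_Linf[OF g] weak_deriv_of_primitive[OF g v]
    by (auto simp: W1inf_def C_space_def)
  have m: "wderiv T v \<in> borel_measurable (leb T)" and fin: "Linf_norm T (wderiv T v) < \<infinity>"
    using W1inf_wderiv(1)[OF W] by (auto simp: Linf_space_def)
  obtain b where b: "Linf_norm T (wderiv T v) \<le> ereal b" "0 \<le> b"
  proof (cases "Linf_norm T (wderiv T v)")
    case (real r)
    then show ?thesis by (intro that[of "max r 0"]) auto
  qed (use fin that[of 0] in auto)
  obtain h where h: "h \<in> bdd_meas T b" "AE t in leb T. wderiv T v t = h t"
    using bdd_meas_truncate[OF m Linf_AE_bounded[OF b(1)] b(2)] by blast
  have "weak_deriv_of T v h"
    using W1inf_wderiv(2)[OF W] weak_deriv_of_cong_AE[OF h(2) m bdd_measD(1)[OF h(1)]] by simp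
  then have vh: "v t = v 0 + primitive T h t" if "t \<in> {0..T}" for t
    using that cont by (intro weak_deriv_imp_primitive[OF T _ h(1)])
  have "AE t in leb T. g t - h t = 0"
  proof (rule primitive_eq_0_imp_AE_eq_0)
    show "integrable (leb T) (\<lambda>t. g t - h t)"
      using bdd_measD(3)[OF g] bdd_measD(3)[OF h(1)] by simp
    fix t assume "t \<in> {0..T}"
    then have "primitive T g t = primitive T h t" using v vh by (metis add_left_cancel)
    then show "primitive T (\<lambda>t. g t - h t) t = 0"
      unfolding primitive_def scaleR_diff_right
      using bdd_measD(3)[OF g] bdd_measD(3)[OF h(1)]
      by (subst Bochner_Integration.integral_diff) (auto intro!: integrable_indicator_leb)
  qed
  with h(2) show ae: "AE t in leb T. wderiv T v t = g t"
    by eventually_elim simp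
  have "Linf_norm T (wderiv T v) \<le> ereal a"
    unfolding Linf_norm_def
  proof (rule esssup_I)
    show "(\<lambda>t. ereal (norm (wderiv T v t))) \<in> borel_measurable (leb T)" using m by measurable
    show "AE t in leb T. ereal (norm (wderiv T v t)) \<le> ereal a"
      using ae by eventually_elim (use bdd_measD(2)[OF g] in auto)
  qed
  with W show "v \<in> K_set T a" by (simp add: K_set_def)
qed

section \<open>Compactness\<close>

lemma integrable_norm_square_bdd_meas:
  assumes "g \<in> bdd_meas T a"
  shows "integrable (leb T) (\<lambda>t. (norm (g t))\<^sup>2)"
  using bdd_measD[OF assms]
  by (intro integrable_leb_bounded[where B = "a\<^sup>2"]) (auto intro!: power_mono)

lemma bdd_meas_diff_integrable:
  assumes "g \<in> bdd_meas T a" "h \<in> bdd_meas T a"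
  shows "integrable (leb T) (\<lambda>t. (norm (g t - h t))\<^sup>2)"
proof (rule integrable_leb_bounded[where B = "(2 * a)\<^sup>2"])
  show "(\<lambda>t. (norm (g t - h t))\<^sup>2) \<in> borel_measurable (leb T)"
    using assms[THEN bdd_measD(1)] by measurable
  fix t
  have "norm (g t - h t) \<le> 2 * a"
    using norm_triangle_ineq4[of "g t" "h t"] bdd_measD(2)[OF assms(1), of t] bdd_measD(2)[OF assms(2), of t]
    by linarith
  then have "(norm (g t - h t))\<^sup>2 \<le> (2 * a)\<^sup>2" by (intro power_mono) auto
  then show "norm ((norm (g t - h t))\<^sup>2) \<le> (2 * a)\<^sup>2" by simp
qed

text \<open>Pointwise x \<le> \<delta> + x^2 / \<delta>, by the cases x \<le> \<delta> and x >
  \<delta>. It turns smallness in L^2 into smallness in L^1, the form from which an almost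
  everywhere Cauchy subsequence is extracted.\<close>

lemma LINT_norm_le_L2:
  assumes "integrable (leb T) (\<lambda>t. (norm (f t))\<^sup>2)" "f \<in> borel_measurable (leb T)"
    and "0 < \<delta>" "0 \<le> T"
  shows "(LINT t|leb T. norm (f t)) \<le> \<delta> * T + (LINT t|leb T. (norm (f t))\<^sup>2) / \<delta>"
proof -
  have le: "norm (f t) \<le> \<delta> + (norm (f t))\<^sup>2 / \<delta>" for t
  proof (cases "norm (f t) \<le> \<delta>")
    case True then show ?thesis using \<open>0 < \<delta>\<close> by (simp add: add_increasing2)
  next
    case False
    then have "norm (f t) * \<delta> \<le> (norm (f t))\<^sup>2"
      using \<open>0 < \<delta>\<close> by (simp add: power2_eq_square mult_left_mono)
    then have "norm (f t) \<le> (norm (f t))\<^sup>2 / \<delta>" using \<open>0 < \<delta>\<close> by (simp add: pos_le_divide_eq)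
    then show ?thesis using \<open>0 < \<delta>\<close> by simp
  qed
  have i: "integrable (leb T) (\<lambda>t. \<delta>)" "integrable (leb T) (\<lambda>t. (norm (f t))\<^sup>2 / \<delta>)"
    using assms(1) by (auto intro: integrable_leb_continuous)
  have "(LINT t|leb T. norm (f t)) \<le> (LINT t|leb T. \<delta> + (norm (f t))\<^sup>2 / \<delta>)"
  proof (rule Bochner_Integration.integral_mono)
    show "integrable (leb T) (\<lambda>t. \<delta> + (norm (f t))\<^sup>2 / \<delta>)" using i by simp
    then show "integrable (leb T) (\<lambda>t. norm (f t))"
      using assms(2) le \<open>0 < \<delta>\<close> by (rule_tac Bochner_Integration.integrable_bound) (auto simp: add_nonneg_nonneg intro!: AE_I2)
  qed (use le in auto)
  also have "\<dots> = \<delta> * T + (LINT t|leb T. (norm (f t))\<^sup>2) / \<delta>"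
    using i \<open>0 \<le> T\<close> LINT_leb_const[of T \<delta>] by (subst Bochner_Integration.integral_add) auto
  finally show ?thesis .
qed

text \<open>A substitute for Mazur's lemma: near-minimisers of the \<open>L\<^sup>2\<close> norm over a decreasing sequence
  of midpoint-convex sets form a Cauchy sequence by the parallelogram law.\<close>

lemma midpoint_convex_AE_limit:
  fixes A :: "nat \<Rightarrow> (real \<Rightarrow> 'a::euclidean_space) set"
  assumes T: "0 \<le> T"
    and sub: "\<And>n. A n \<subseteq> bdd_meas T a" and ne: "\<And>n. A n \<noteq> {}"
    and dec: "\<And>m n. n \<le> m \<Longrightarrow> A m \<subseteq> A n"
    and mid: "\<And>n g h. g \<in> A n \<Longrightarrow> h \<in> A n \<Longrightarrow> (\<lambda>t. (1/2) *\<^sub>R (g t + h t)) \<in> A n"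
  shows "\<exists>w g. (\<forall>n. w n \<in> A n) \<and> g \<in> bdd_meas T a \<and> (AE t in leb T. (\<lambda>n. w n t) \<longlonglongrightarrow> g t)"
proof -
  define Q where "Q g = (LINT t|leb T. (norm (g t))\<^sup>2)" for g :: "real \<Rightarrow> 'a"
  define d where "d n = (INF g\<in>A n. Q g)" for n
  have Qnn: "0 \<le> Q g" for g unfolding Q_def by simp
  have bdd: "bdd_below (Q ` A n)" for n
    using Qnn by (intro bdd_belowI[of _ 0]) auto
  have Qle: "Q g \<le> a\<^sup>2 * T" if "g \<in> bdd_meas T a" for g
  proof -
    have "Q g \<le> (LINT t|leb T. a\<^sup>2)"
      unfolding Q_def
      by (rule Bochner_Integration.integral_mono)
         (use bdd_measD(2)[OF that] in \<open>auto intro!: integrable_norm_square_bdd_meas[OF that] integrable_leb_continuous power_mono\<close>)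
    also have "\<dots> = a\<^sup>2 * T" by (subst LINT_leb_const[OF T]) simp
    finally show ?thesis .
  qed
  \<comment> \<open>The infima increase because the sets shrink, and they are bounded by
    \<open>a\<^sup>2 * T\<close>; hence they form a Cauchy sequence, and the difference in
    \<open>est\<close> becomes small.\<close>
  have dmono: "incseq d"
    unfolding d_def by (intro incseq_SucI cINF_superset_mono ne bdd dec) auto
  have dle: "d n \<le> a\<^sup>2 * T" for n
  proof -
    obtain g where "g \<in> A n" using ne by blast
    then show ?thesis using cINF_lower[OF bdd, of g n] Qle[of g] sub by (force simp: d_def)
  qed
  have "convergent d"
    using dmono dle by (metis incseq_convergent convergent_def)
  then have Cd: "Cauchy d" by (rule convergent_Cauchy)
  have "\<exists>g\<in>A n. Q g < d n + 1 / real (Suc n)" for n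
    using cINF_less_iff[OF ne bdd, of n "d n + 1 / real (Suc n)"] unfolding d_def[symmetric] by simp
  then obtain w where wA: "\<And>n. w n \<in> A n" and wQ: "\<And>n. Q (w n) < d n + 1 / real (Suc n)"
    by metis
  have wB: "w n \<in> bdd_meas T a" for n using wA sub by blast
  have est: "Q (\<lambda>t. w n t - w m t) \<le> 2 * (d m - d n) + 4 / real (Suc n)" if "n \<le> m" for n m
  proof -
    have i: "integrable (leb T) (\<lambda>t. (norm (w n t))\<^sup>2)" "integrable (leb T) (\<lambda>t. (norm (w m t))\<^sup>2)"
      using integrable_norm_square_bdd_meas wB by blast+
    have midA: "(\<lambda>t. (1/2) *\<^sub>R (w n t + w m t)) \<in> A n"
      using mid wA dec[OF that] by blast
    have im: "integrable (leb T) (\<lambda>t. (norm ((1/2) *\<^sub>R (w n t + w m t)))\<^sup>2)"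
      using integrable_norm_square_bdd_meas midA sub by blast
    have "Q (\<lambda>t. w n t - w m t)
      = (LINT t|leb T. 2 * (norm (w n t))\<^sup>2 + 2 * (norm (w m t))\<^sup>2 - 4 * (norm ((1/2) *\<^sub>R (w n t + w m t)))\<^sup>2)"
      unfolding Q_def
      by (rule Bochner_Integration.integral_cong)
         (auto simp: power2_norm_eq_inner inner_simps inner_commute power_mult_distrib algebra_simps)
    also have "\<dots> = 2 * Q (w n) + 2 * Q (w m) - 4 * Q (\<lambda>t. (1/2) *\<^sub>R (w n t + w m t))"
      unfolding Q_def using i im by simp
    \<comment> \<open>Both functions lie in the larger set \<open>A n\<close>, hence so does their
      midpoint, and its square integral is at least \<open>d n\<close>.\<close>
    also have "\<dots> \<le> 2 * (d n + 1 / real (Suc n)) + 2 * (d m + 1 / real (Suc m)) - 4 * d n"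
    proof -
      have "d n \<le> Q (\<lambda>t. (1/2) *\<^sub>R (w n t + w m t))"
        using cINF_lower[OF bdd midA] by (simp add: d_def)
      then show ?thesis by (intro diff_mono add_mono mult_left_mono less_imp_le[OF wQ]) auto
    qed
    also have "\<dots> \<le> 2 * (d m - d n) + 4 / real (Suc n)"
      using that frac_le[of 1 1 "real (Suc n)" "real (Suc m)"] by simp
    finally show ?thesis .
  qed
  have L1: "\<exists>N. \<forall>i\<ge>N. \<forall>j\<ge>N. (LINT t|leb T. norm (w i t - w j t)) < e" if e: "e > 0" for e
  proof -
    \<comment> \<open>\<open>\<delta>\<close> and \<open>\<gamma>\<close> are chosen so that each of
      the two terms of \<open>LINT_norm_le_L2\<close> is below e / 2; the summand 1 keeps the
      quotient meaningful for T = 0.\<close>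
    define \<delta> where "\<delta> = e / (2 * (T + 1))"
    have \<delta>: "\<delta> > 0" "\<delta> * T < e / 2" using e T by (auto simp: \<delta>_def field_simps)
    define \<gamma> where "\<gamma> = \<delta> * e / 2"
    have \<gamma>: "\<gamma> > 0" using \<delta> e by (simp add: \<gamma>_def)
    obtain N1 where N1: "\<And>m n. m \<ge> N1 \<Longrightarrow> n \<ge> N1 \<Longrightarrow> dist (d m) (d n) < \<gamma> / 4"
      using metric_CauchyD[OF Cd, of "\<gamma> / 4"] \<gamma> by auto
    obtain N2 where N2: "4 / real (Suc N2) < \<gamma> / 2"
      using reals_Archimedean[of "\<gamma> / 8"] \<gamma> by (auto simp: field_simps inverse_eq_divide)
    define N where "N = max N1 N2"
    have *: "(LINT t|leb T. norm (w i t - w j t)) < e" if "N \<le> i" "i \<le> j" for i j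
    proof -
      have "4 / real (Suc i) \<le> 4 / real (Suc N2)"
        using that by (intro divide_left_mono) (auto simp: N_def)
      then have n4: "4 / real (Suc i) < \<gamma> / 2" using N2 by (rule le_less_trans)
      have "\<bar>d j - d i\<bar> < \<gamma> / 4" using N1[of j i] that by (auto simp: N_def dist_real_def)
      then have "d j - d i < \<gamma> / 4" by (rule le_less_trans[OF abs_ge_self])
      then have "2 * (d j - d i) < 2 * (\<gamma> / 4)" by (rule mult_strict_left_mono) simp
      then have "2 * (d j - d i) < \<gamma> / 2" by simp
      then have "2 * (d j - d i) + 4 / real (Suc i) < \<gamma> / 2 + \<gamma> / 2" using n4 by (rule add_strict_mono)
      then have "Q (\<lambda>t. w i t - w j t) < \<gamma>" using est[OF that(2)] by simp
      then have "Q (\<lambda>t. w i t - w j t) / \<delta> < e / 2"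
        using \<delta> by (simp add: \<gamma>_def field_simps)
      moreover have "(LINT t|leb T. norm (w i t - w j t)) \<le> \<delta> * T + Q (\<lambda>t. w i t - w j t) / \<delta>"
        unfolding Q_def
        using bdd_meas_diff_integrable[OF wB wB] bdd_measD(1)[OF wB] \<delta>(1) T
        by (intro LINT_norm_le_L2) auto
      ultimately show ?thesis using \<delta>(2) by linarith
    qed
    show ?thesis
    proof (intro exI[of _ N] allI impI)
      fix i j assume "N \<le> i" "N \<le> j"
      then show "(LINT t|leb T. norm (w i t - w j t)) < e"
        using *[of i j] *[of j i] by (cases "i \<le> j") (auto simp: norm_minus_commute)
    qed
  qed
  obtain r where r: "strict_mono r" "AE t in leb T. Cauchy (\<lambda>i. w (r i) t)"
    using cauchy_L1_AE_cauchy_subseq[OF bdd_measD(3)[OF wB] L1] by blast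
  define g where "g t = lim (\<lambda>i. w (r i) t)" for t
  have lim: "AE t in leb T. (\<lambda>i. w (r i) t) \<longlonglongrightarrow> g t"
    using r(2) by eventually_elim (simp add: g_def Cauchy_convergent_iff convergent_LIMSEQ_iff)
  have gm: "g \<in> borel_measurable (leb T)"
    unfolding g_def by (rule borel_measurable_lim_metric) (rule bdd_measD(1)[OF wB])
  have gb: "AE t in leb T. norm (g t) \<le> a"
    using lim
  proof eventually_elim
    case (elim t)
    then show ?case
      by (intro Lim_bounded[OF tendsto_norm[OF elim]]) (use bdd_measD(2)[OF wB] in auto)
  qed
  have "0 \<le> a" using bdd_measD(2)[OF wB[of 0], of 0] norm_ge_zero order_trans by blast
  \<comment> \<open>The limit inherits the bound only almost everywhere, hence the
    truncation.\<close>
  then obtain h where h: "h \<in> bdd_meas T a" "AE t in leb T. g t = h t"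
    using bdd_meas_truncate[OF gm gb] by blast
  show ?thesis
  proof (intro exI[of _ "\<lambda>n. w (r n)"] exI[of _ h] conjI allI)
    show "w (r n) \<in> A n" for n
      using wA[of "r n"] dec[OF seq_suble[OF r(1), of n]] by blast
    show "AE t in leb T. (\<lambda>n. w (r n) t) \<longlonglongrightarrow> h t"
      using lim h(2) by eventually_elim simp
  qed (rule h(1))
qed

section \<open>Integral functionals on bounded derivatives\<close>

lemma measurable_continuous_bdd_meas:
  fixes f :: "'a::euclidean_space \<Rightarrow> real"
  assumes f: "continuous_on (cball 0 a) f" and g: "g \<in> bdd_meas T a"
  shows "(\<lambda>t. f (g t)) \<in> borel_measurable (leb T)"
proof -
  \<comment> \<open>\<open>f\<close> is controlled only on the closed ball. Its extension by 0 is
    Borel, and agrees with \<open>f\<close> at all values of \<open>g\<close>.\<close>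
  have "(\<lambda>x. indicator (cball 0 a) x *\<^sub>R f x) \<in> borel_measurable borel"
    by (rule borel_measurable_continuous_on_indicator[OF _ f]) simp
  then have "(\<lambda>t. indicator (cball 0 a) (g t) *\<^sub>R f (g t)) \<in> borel_measurable (leb T)"
    using bdd_measD(1)[OF g] by (rule measurable_compose[rotated])
  then show ?thesis using bdd_measD(2)[OF g] by simp
qed

lemma integrable_continuous_bdd_meas:
  fixes f :: "'a::euclidean_space \<Rightarrow> real"
  assumes f: "continuous_on (cball 0 a) f" and g: "g \<in> bdd_meas T a"
  shows "integrable (leb T) (\<lambda>t. f (g t))"
proof -
  obtain B where "\<And>x. x \<in> cball 0 a \<Longrightarrow> norm (f x) \<le> B"
    using compact_continuous_bounded[OF compact_cball f] by blast
  then show ?thesis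
    using measurable_continuous_bdd_meas[OF f g] bdd_measD(2)[OF g]
    by (intro integrable_leb_bounded[where B = B]) auto
qed

lemma LINT_continuous_bdd_meas_tendsto:
  fixes f :: "'a::euclidean_space \<Rightarrow> real"
  assumes f: "continuous_on (cball 0 a) f" and g: "g \<in> bdd_meas T a"
    and w: "\<And>n. w n \<in> bdd_meas T a" and lim: "AE t in leb T. (\<lambda>n. w n t) \<longlonglongrightarrow> g t"
  shows "(\<lambda>n. LINT t|leb T. f (w n t)) \<longlonglongrightarrow> (LINT t|leb T. f (g t))"
proof -
  obtain B where B: "\<And>x. x \<in> cball 0 a \<Longrightarrow> norm (f x) \<le> B"
    using compact_continuous_bounded[OF compact_cball f] by blast
  show ?thesis
  proof (rule integral_dominated_convergence[where w = "\<lambda>_. B"])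
    show "AE t in leb T. (\<lambda>n. f (w n t)) \<longlonglongrightarrow> f (g t)"
      using lim
      by eventually_elim
         (use bdd_measD(2)[OF g] bdd_measD(2)[OF w] in \<open>auto intro!: continuous_on_tendsto_compose[OF f]\<close>)
    show "AE t in leb T. norm (f (w n t)) \<le> B" for n
      using B bdd_measD(2)[OF w] by (intro AE_I2) auto
  qed (auto intro!: measurable_continuous_bdd_meas[OF f] g w integrable_leb_continuous)
qed

lemma primitive_tendsto:
  assumes g: "g \<in> bdd_meas T a" and w: "\<And>n. w n \<in> bdd_meas T a"
    and lim: "AE t in leb T. (\<lambda>n. w n t) \<longlonglongrightarrow> g t"
  shows "(\<lambda>n. primitive T (w n) t) \<longlonglongrightarrow> primitive T g t"
  unfolding primitive_def
proof (rule integral_dominated_convergence[where w = "\<lambda>_. a"])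
  show "AE s in leb T. (\<lambda>n. indicator {0..t} s *\<^sub>R w n s) \<longlonglongrightarrow> indicator {0..t} s *\<^sub>R g s"
    using lim by eventually_elim (auto intro!: tendsto_intros)
  have "0 \<le> a" using bdd_measD(2)[OF g, of 0] norm_ge_zero order_trans by blast
  then show "AE s in leb T. norm (indicator {0..t} s *\<^sub>R w n s) \<le> a" for n
    using bdd_measD(2)[OF w] by (intro AE_I2) (auto split: split_indicator)
  show "(\<lambda>s. indicator {0..t} s *\<^sub>R g s) \<in> borel_measurable (leb T)"
    "(\<lambda>s. indicator {0..t} s *\<^sub>R w n s) \<in> borel_measurable (leb T)" for n
    using bdd_measD(1)[OF g] bdd_measD(1)[OF w] by (auto intro: measurable_indicator_leb)
qed (auto intro: integrable_leb_continuous)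

lemma primitive_add_scaleR:
  assumes "integrable (leb T) g" "integrable (leb T) h"
  shows "primitive T (\<lambda>t. c *\<^sub>R g t + d *\<^sub>R h t) t = c *\<^sub>R primitive T g t + d *\<^sub>R primitive T h t"
proof -
  have "primitive T (\<lambda>t. c *\<^sub>R g t + d *\<^sub>R h t) t
    = (LINT s|leb T. c *\<^sub>R (indicator {0..t} s *\<^sub>R g s) + d *\<^sub>R (indicator {0..t} s *\<^sub>R h s))"
    unfolding primitive_def by (rule Bochner_Integration.integral_cong) (auto simp: algebra_simps)
  also have "\<dots> = c *\<^sub>R primitive T g t + d *\<^sub>R primitive T h t"
    unfolding primitive_def
    using integrable_indicator_leb[OF assms(1), of "{0..t}"] integrable_indicator_leb[OF assms(2), of "{0..t}"]
    by (subst Bochner_Integration.integral_add)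
       (auto simp del: scaleR_scaleR intro!: integrable_scaleR_right)
  finally show ?thesis .
qed

lemma bdd_meas_convex_comb:
  assumes g: "g \<in> bdd_meas T a" and h: "h \<in> bdd_meas T a" and s: "0 \<le> s" "s \<le> 1"
  shows "(\<lambda>t. (1 - s) *\<^sub>R g t + s *\<^sub>R h t) \<in> bdd_meas T a"
proof -
  have "norm ((1 - s) *\<^sub>R g t + s *\<^sub>R h t) \<le> a" for t
  proof -
    have "norm ((1 - s) *\<^sub>R g t + s *\<^sub>R h t) \<le> (1 - s) * norm (g t) + s * norm (h t)"
      using norm_triangle_ineq[of "(1 - s) *\<^sub>R g t" "s *\<^sub>R h t"] s by simp
    also have "\<dots> \<le> (1 - s) * a + s * a"
      using s bdd_measD(2)[OF g] bdd_measD(2)[OF h] by (intro add_mono mult_left_mono) auto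
    finally show ?thesis by (simp add: algebra_simps)
  qed
  then show ?thesis
    using bdd_measD(1)[OF g] bdd_measD(1)[OF h] by (auto simp: bdd_meas_def)
qed

lemma LINT_convex_comb_le:
  assumes f: "continuous_on (cball 0 a) f" and cv: "convex_on (cball 0 a) f"
    and g: "g \<in> bdd_meas T a" and h: "h \<in> bdd_meas T a" and s: "0 \<le> s" "s \<le> 1"
  shows "(LINT t|leb T. f ((1 - s) *\<^sub>R g t + s *\<^sub>R h t))
    \<le> (1 - s) * (LINT t|leb T. f (g t)) + s * (LINT t|leb T. f (h t))"
proof -
  note i = integrable_continuous_bdd_meas[OF f]
  have "(LINT t|leb T. f ((1 - s) *\<^sub>R g t + s *\<^sub>R h t)) \<le> (LINT t|leb T. (1 - s) * f (g t) + s * f (h t))"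
  proof (rule Bochner_Integration.integral_mono)
    show "f ((1 - s) *\<^sub>R g t + s *\<^sub>R h t) \<le> (1 - s) * f (g t) + s * f (h t)" for t
      using convex_onD[OF cv, of s "g t" "h t"] s bdd_measD(2)[OF g, of t] bdd_measD(2)[OF h, of t] by auto
  qed (use i[OF bdd_meas_convex_comb[OF g h s]] i[OF g] i[OF h] in auto)
  also have "\<dots> = (1 - s) * (LINT t|leb T. f (g t)) + s * (LINT t|leb T. f (h t))"
    using i[OF g] i[OF h] by simp
  finally show ?thesis .
qed

text \<open>The derivatives \<open>g n\<close> themselves need not converge at any point; only their
  primitives do. The conditions on the primitive and on the integral survive averaging, so averages
  of the \<open>g n\<close> can be selected that converge almost everywhere, and dominated
  convergence passes both conditions to the limit.\<close>

lemma convex_integral_lsc: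
  fixes w :: "real \<Rightarrow> 'a::euclidean_space"
  assumes T: "0 \<le> T"
    and f: "continuous_on (cball 0 a) f" and cv: "convex_on (cball 0 a) f"
    and g: "\<And>n. g n \<in> bdd_meas T a"
    and v: "\<And>n t. t \<in> {0..T} \<Longrightarrow> v n t = v n 0 + primitive T (g n) t"
    and unif: "uniform_limit {0..T} v w sequentially"
    and L: "(\<lambda>n. LINT t|leb T. f (g n t)) \<longlonglongrightarrow> L"
  obtains h where "h \<in> bdd_meas T a" "\<And>t. t \<in> {0..T} \<Longrightarrow> w t = w 0 + primitive T h t"
    "(LINT t|leb T. f (h t)) \<le> L"
proof -
  \<comment> \<open>Admissible derivatives up to the tolerance 1 / (n + 1). The tolerance makes the
    sets decreasing and nonempty, and convexity of both conditions makes them closed under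
    midpoints.\<close>
  define A where "A n = {h \<in> bdd_meas T a. (\<forall>t\<in>{0..T}. norm (primitive T h t - (w t - w 0)) \<le> 1 / real (Suc n))
    \<and> (LINT t|leb T. f (h t)) \<le> L + 1 / real (Suc n)}" for n
  have sub: "A n \<subseteq> bdd_meas T a" for n by (auto simp: A_def)
  have ne: "A n \<noteq> {}" for n
  proof -
    \<comment> \<open>Half the tolerance, because the error enters once at t and once at 0.\<close>
    have pos: "1 / real (Suc n) / 2 > 0" by simp
    have "\<forall>\<^sub>F k in sequentially. \<forall>t\<in>{0..T}. dist (v k t) (w t) < 1 / real (Suc n) / 2"
      using uniform_limitD[OF unif pos] .
    moreover have "\<forall>\<^sub>F k in sequentially. (LINT t|leb T. f (g k t)) < L + 1 / real (Suc n)"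
      by (rule order_tendstoD(2)[OF L]) simp
    ultimately have "\<forall>\<^sub>F k in sequentially. g k \<in> A n"
    proof eventually_elim
      case (elim k)
      have "norm (primitive T (g k) t - (w t - w 0)) \<le> 1 / real (Suc n)" if t: "t \<in> {0..T}" for t
      proof -
        have "primitive T (g k) t - (w t - w 0) = (v k t - w t) - (v k 0 - w 0)"
          using v[OF t, of k] by (simp add: algebra_simps)
        also have "norm \<dots> \<le> norm (v k t - w t) + norm (v k 0 - w 0)"
          by (rule norm_triangle_ineq4)
        also have "\<dots> \<le> 1 / real (Suc n) / 2 + 1 / real (Suc n) / 2"
          using elim(1) t T by (intro add_mono) (auto simp: dist_norm less_imp_le)
        also have "\<dots> = 1 / real (Suc n)" by (simp only: field_sum_of_halves)
        finally show ?thesis .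
      qed
      then show ?case using g elim(2) by (auto simp: A_def)
    qed
    then obtain k where "g k \<in> A n" using eventually_happens by fastforce
    then show ?thesis by blast
  qed
  have dec: "A m \<subseteq> A n" if "n \<le> m" for m n
  proof -
    have "1 / real (Suc m) \<le> 1 / real (Suc n)" using that by (simp add: frac_le)
    then show ?thesis by (force simp: A_def)
  qed
  have mid: "(\<lambda>t. (1/2) *\<^sub>R (g t + h t)) \<in> A n" if gh: "g \<in> A n" "h \<in> A n" for n g h
  proof -
    have B: "g \<in> bdd_meas T a" "h \<in> bdd_meas T a" using gh sub by blast+
    have eq: "(\<lambda>t. (1/2) *\<^sub>R (g t + h t)) = (\<lambda>t. (1 - 1/2) *\<^sub>R g t + (1/2) *\<^sub>R h t)"
      by (simp add: scaleR_add_right)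
    have "norm (primitive T (\<lambda>t. (1 - 1/2) *\<^sub>R g t + (1/2) *\<^sub>R h t) t - (w t - w 0)) \<le> 1 / real (Suc n)"
      if t: "t \<in> {0..T}" for t
    proof -
      have half: "(1 - 1/2) *\<^sub>R x + (1/2) *\<^sub>R y - z = (1/2) *\<^sub>R (x - z) + (1/2) *\<^sub>R (y - z)" for x y z :: 'a
        by (rule euclidean_eqI) (simp add: inner_simps field_simps)
      have "primitive T (\<lambda>t. (1 - 1/2) *\<^sub>R g t + (1/2) *\<^sub>R h t) t - (w t - w 0)
        = (1/2) *\<^sub>R (primitive T g t - (w t - w 0)) + (1/2) *\<^sub>R (primitive T h t - (w t - w 0))"
        unfolding primitive_add_scaleR[OF bdd_measD(3)[OF B(1)] bdd_measD(3)[OF B(2)]]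
        by (rule half)
      also have "norm \<dots> \<le> (1/2) * norm (primitive T g t - (w t - w 0)) + (1/2) * norm (primitive T h t - (w t - w 0))"
        by (rule order_trans[OF norm_triangle_ineq]) simp
      also have "\<dots> \<le> (1/2) * (1 / real (Suc n)) + (1/2) * (1 / real (Suc n))"
        using gh t by (intro add_mono mult_left_mono) (auto simp: A_def)
      also have "\<dots> = 1 / real (Suc n)" by (simp only: mult_2[symmetric] mult.assoc[symmetric])
      finally show ?thesis .
    qed
    moreover have "(LINT t|leb T. f ((1 - 1/2) *\<^sub>R g t + (1/2) *\<^sub>R h t)) \<le> L + 1 / real (Suc n)"
      using LINT_convex_comb_le[OF f cv B, of "1/2"] gh by (simp add: A_def)
    moreover have "(\<lambda>t. (1 - 1/2) *\<^sub>R g t + (1/2) *\<^sub>R h t) \<in> bdd_meas T a"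
      by (rule bdd_meas_convex_comb[OF B]) auto
    ultimately show ?thesis unfolding eq by (simp add: A_def)
  qed
  have "\<exists>u h. (\<forall>n. u n \<in> A n) \<and> h \<in> bdd_meas T a \<and> (AE t in leb T. (\<lambda>n. u n t) \<longlonglongrightarrow> h t)"
    by (rule midpoint_convex_AE_limit[OF T, of A a, OF sub ne dec mid])
  then obtain u h where uA: "\<forall>n. u n \<in> A n" and h: "h \<in> bdd_meas T a"
    and lim: "AE t in leb T. (\<lambda>n. u n t) \<longlonglongrightarrow> h t"
    by (elim exE conjE)
  have u: "u n \<in> A n" for n using uA ..
  have uB: "u n \<in> bdd_meas T a" for n using u sub by blast
  have inv: "(\<lambda>n. 1 / real (Suc n)) \<longlonglongrightarrow> 0" using LIMSEQ_inverse_real_of_nat by (simp add: inverse_eq_divide)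
  show ?thesis
  proof (rule that[OF h])
    fix t assume t: "t \<in> {0..T}"
    have "(\<lambda>n. norm (primitive T (u n) t - (w t - w 0))) \<longlonglongrightarrow> norm (primitive T h t - (w t - w 0))"
      by (intro tendsto_intros primitive_tendsto[OF h uB lim])
    moreover have "norm (primitive T (u n) t - (w t - w 0)) \<le> 1 / real (Suc n)" for n
      using u[of n] t by (auto simp: A_def)
    ultimately have "norm (primitive T h t - (w t - w 0)) \<le> 0"
      by (intro LIMSEQ_le[OF _ inv]) auto
    then show "w t = w 0 + primitive T h t" by (simp add: algebra_simps)
  next
    have "(\<lambda>n. L + 1 / real (Suc n)) \<longlonglongrightarrow> L + 0" by (intro tendsto_intros inv)
    moreover have "(LINT t|leb T. f (u n t)) \<le> L + 1 / real (Suc n)" for n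
      using u[of n] by (auto simp: A_def)
    ultimately show "(LINT t|leb T. f (h t)) \<le> L"
      using LIMSEQ_le[OF LINT_continuous_bdd_meas_tendsto[OF f h uB lim]] by auto
  qed
qed

section \<open>Uniform limits of equi-Lipschitz sequences\<close>

lemma equi_lipschitz_convergent_subseq:
  fixes u :: "nat \<Rightarrow> real \<Rightarrow> 'a::euclidean_space"
  assumes bound: "\<And>n t. t \<in> {0..T} \<Longrightarrow> norm (u n t) \<le> R"
    and lip: "\<And>n s t. s \<in> {0..T} \<Longrightarrow> t \<in> {0..T} \<Longrightarrow> norm (u n t - u n s) \<le> a * \<bar>t - s\<bar>"
    and a: "0 < a"
  obtains w r where "strict_mono r" "continuous_on {0..T} w"
    "uniform_limit {0..T} (\<lambda>n. u (r n)) w sequentially"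
proof -
  have eq: "\<exists>d. 0 < d \<and> (\<forall>n y. y \<in> {0..T} \<and> norm (x - y) < d \<longrightarrow> norm (u n x - u n y) < e)"
    if x: "x \<in> {0..T}" and e: "0 < e" for x e
  proof (intro exI[of _ "e / a"] conjI allI impI)
    show "0 < e / a" using e a by simp
    fix n y assume y: "y \<in> {0..T} \<and> norm (x - y) < e / a"
    have "norm (u n x - u n y) \<le> a * \<bar>x - y\<bar>" using lip x y by blast
    also have "\<dots> < e" using y a by (simp add: field_simps)
    finally show "norm (u n x - u n y) < e" .
  qed
  obtain w r where "continuous_on {0..T} w" "strict_mono (r :: nat \<Rightarrow> nat)"
    and lim: "\<And>e. 0 < e \<Longrightarrow> \<exists>N. \<forall>n x. n \<ge> N \<and> x \<in> {0..T} \<longrightarrow> norm (u (r n) x - w x) < e"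
    using Arzela_Ascoli[of "{0..T}" u R, OF compact_Icc bound eq] by blast
  moreover have "uniform_limit {0..T} (\<lambda>n. u (r n)) w sequentially"
  proof (rule uniform_limitI)
    fix e :: real assume "0 < e"
    then obtain N where "\<forall>n x. n \<ge> N \<and> x \<in> {0..T} \<longrightarrow> norm (u (r n) x - w x) < e" using lim by blast
    then show "\<forall>\<^sub>F n in sequentially. \<forall>x\<in>{0..T}. dist (u (r n) x) (w x) < e"
      unfolding eventually_sequentially dist_norm by (intro exI[of _ N]) blast
  qed
  ultimately show ?thesis using that by blast
qed

lemma sup_norm_tendsto_0:
  fixes u :: "nat \<Rightarrow> real \<Rightarrow> 'a::euclidean_space"
  assumes T: "0 \<le> T" and unif: "uniform_limit {0..T} u w sequentially"
  shows "(\<lambda>n. sup_norm T (\<lambda>t. u n t - w t)) \<longlonglongrightarrow> 0"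
proof (rule metric_LIMSEQ_I)
  fix e :: real assume e: "0 < e"
  then have "e / 2 > 0" by simp
  then obtain N where N: "\<And>n t. n \<ge> N \<Longrightarrow> t \<in> {0..T} \<Longrightarrow> norm (u n t - w t) < e / 2"
    using uniform_limitD[OF unif, of "e / 2"] unfolding eventually_sequentially dist_norm by blast
  show "\<exists>N. \<forall>n\<ge>N. dist (sup_norm T (\<lambda>t. u n t - w t)) 0 < e"
  proof (intro exI[of _ N] allI impI)
    fix n assume n: "N \<le> n"
    have bdd: "bdd_above ((\<lambda>t. norm (u n t - w t)) ` {0..T})"
      using N[OF n] by (intro bdd_aboveI[of _ "e / 2"]) (auto simp: less_imp_le)
    have "sup_norm T (\<lambda>t. u n t - w t) \<le> e / 2"
      unfolding sup_norm_def using T N[OF n] by (intro cSUP_least) (auto simp: less_imp_le)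
    moreover have "norm (u n 0 - w 0) \<le> sup_norm T (\<lambda>t. u n t - w t)"
      unfolding sup_norm_def using T by (intro cSUP_upper bdd) auto
    moreover have "0 \<le> norm (u n 0 - w 0)" by simp
    ultimately have "0 \<le> sup_norm T (\<lambda>t. u n t - w t)" "sup_norm T (\<lambda>t. u n t - w t) < e"
      using e by linarith+
    then show "dist (sup_norm T (\<lambda>t. u n t - w t)) 0 < e"
      by (simp add: dist_real_def)
  qed
qed

section \<open>The singular potential and its conjugate\<close>

lemma GDERIV_directional:
  assumes "GDERIV f (z + s *\<^sub>R d) :> D"
  shows "((\<lambda>s. f (z + s *\<^sub>R d)) has_real_derivative (d \<bullet> D)) (at s)"
proof -
  have "((\<lambda>s. z + s *\<^sub>R d) has_derivative (\<lambda>h. h *\<^sub>R d)) (at s)"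
    by (auto intro!: derivative_eq_intros)
  moreover have "(f has_derivative (\<lambda>h. h \<bullet> D)) (at (z + s *\<^sub>R d))"
    using assms by (simp add: gderiv_def)
  ultimately have "((\<lambda>s. f (z + s *\<^sub>R d)) has_derivative (\<lambda>h. (h *\<^sub>R d) \<bullet> D)) (at s)"
    by (rule has_derivative_compose)
  moreover have "(\<lambda>h. (h *\<^sub>R d) \<bullet> D) = (*) (d \<bullet> D)"
    by (auto simp: fun_eq_iff)
  ultimately show ?thesis
    by (simp add: has_field_derivative_def)
qed

text \<open>The inverse \<open>\<psi>\<close> is a parameter of its own since most arguments use it
  in place of \<open>\<phi>\<close>: it is continuous on the whole space and takes values in the
  open ball, whereas \<open>\<phi>\<close> blows up at the sphere.\<close>

locale singular_potential =
  fixes a :: real and \<phi> \<psi> :: "'a::euclidean_space \<Rightarrow> 'a" and \<Phi> :: "'a \<Rightarrow> real"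
  assumes a_pos: "0 < a"
    and homeo: "homeomorphism (ball 0 a) UNIV \<phi> \<psi>"
    and phi_0: "\<phi> 0 = 0"
    and Phi_deriv: "\<And>x. x \<in> ball 0 a \<Longrightarrow> GDERIV \<Phi> x :> \<phi> x"
    and Phi_cont: "continuous_on (cball 0 a) \<Phi>"
    and Phi_sconvex: "strictly_convex_on (cball 0 a) \<Phi>"
    and Phi_nonpos: "\<And>x. x \<in> cball 0 a \<Longrightarrow> \<Phi> x \<le> 0"
begin

lemma psi_less [simp]: "norm (\<psi> y) < a"
proof -
  have "\<psi> y \<in> ball 0 a" using homeomorphism_image2[OF homeo] by blast
  then show ?thesis by simp
qed

lemma psi_le [simp]: "norm (\<psi> y) \<le> a"
  by (rule less_imp_le[OF psi_less])

lemma phi_psi [simp]: "\<phi> (\<psi> y) = y"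
  using homeomorphism_apply2[OF homeo] by simp

lemma psi_phi: "x \<in> ball 0 a \<Longrightarrow> \<psi> (\<phi> x) = x"
  using homeomorphism_apply1[OF homeo] by simp

lemma psi_cont: "continuous_on S \<psi>"
  using homeomorphism_cont2[OF homeo] continuous_on_subset by blast

lemma phi_cont: "continuous_on (ball 0 a) \<phi>"
  by (rule homeomorphism_cont1[OF homeo])

lemma Phi_convex: "convex_on (cball 0 a) \<Phi>"
proof (rule convex_onI)
  fix t :: real and x y :: 'a
  assume t: "0 < t" "t < 1" and "x \<in> cball 0 a" "y \<in> cball 0 a"
  then show "\<Phi> ((1 - t) *\<^sub>R x + t *\<^sub>R y) \<le> (1 - t) * \<Phi> x + t * \<Phi> y"
  proof (cases "x = y")
    case True
    then have "(1 - t) *\<^sub>R x + t *\<^sub>R y = x" by (simp flip: scaleR_add_left)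
    then show ?thesis using True by (simp add: algebra_simps)
  next
    case False
    then show ?thesis
      using Phi_sconvex t \<open>x \<in> cball 0 a\<close> \<open>y \<in> cball 0 a\<close>
      unfolding strictly_convex_on_def by (meson less_imp_le)
  qed
qed simp

text \<open>Convexity bounds the difference quotients along the segment from \<open>z\<close> to
  \<open>x\<close>, and their limit at 0 is the directional derivative. Only \<open>z\<close> has to
  be interior: \<open>x\<close> may lie on the sphere, where values of a derivative cannot yet be
  excluded.\<close>

lemma Phi_tangent:
  assumes z: "z \<in> ball 0 a" and x: "x \<in> cball 0 a"
  shows "\<Phi> z + \<phi> z \<bullet> (x - z) \<le> \<Phi> x"
proof -
  have "((\<lambda>s. \<Phi> (z + s *\<^sub>R (x - z))) has_real_derivative ((x - z) \<bullet> \<phi> z)) (at 0)"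
    by (rule GDERIV_directional) (simp add: Phi_deriv[OF z])
  then have "((\<lambda>s. (\<Phi> (z + s *\<^sub>R (x - z)) - \<Phi> z) / s) \<longlongrightarrow> (x - z) \<bullet> \<phi> z) (at 0)"
    by (simp add: DERIV_def)
  then have lim: "((\<lambda>s. (\<Phi> (z + s *\<^sub>R (x - z)) - \<Phi> z) / s) \<longlongrightarrow> (x - z) \<bullet> \<phi> z) (at_right 0)"
    by (rule tendsto_within_subset) simp
  have "\<forall>\<^sub>F s in at_right (0::real). s \<in> {0<..<1}"
    by (rule eventually_at_right_real) simp
  then have "\<forall>\<^sub>F s in at_right 0. (\<Phi> (z + s *\<^sub>R (x - z)) - \<Phi> z) / s \<le> \<Phi> x - \<Phi> z"
  proof eventually_elim
    case (elim s)
    have "z + s *\<^sub>R (x - z) = (1 - s) *\<^sub>R z + s *\<^sub>R x" by (simp add: algebra_simps)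
    then have "\<Phi> (z + s *\<^sub>R (x - z)) \<le> (1 - s) * \<Phi> z + s * \<Phi> x"
      using convex_onD[OF Phi_convex, of s z x] elim z x by auto
    then show ?case using elim by (simp add: field_simps)
  qed
  then have "(x - z) \<bullet> \<phi> z \<le> \<Phi> x - \<Phi> z"
    by (rule tendsto_upperbound[OF lim]) simp
  then show ?thesis by (simp add: inner_commute)
qed

text \<open>The tangent inequality is applied at the midpoint of \<open>z\<close> and
  \<open>x\<close>, where strict convexity leaves a gap.\<close>

lemma Phi_tangent_strict:
  assumes z: "z \<in> ball 0 a" and x: "x \<in> cball 0 a" and "x \<noteq> z"
  shows "\<Phi> z + \<phi> z \<bullet> (x - z) < \<Phi> x"
proof -
  define m where "m = (1 - 1/2) *\<^sub>R z + (1/2) *\<^sub>R x"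
  have "\<Phi> m < (1 - 1/2) * \<Phi> z + (1/2) * \<Phi> x"
    unfolding m_def using Phi_sconvex z x \<open>x \<noteq> z\<close>
    unfolding strictly_convex_on_def
    by (elim conjE ballE[of _ _ z] ballE[of _ _ x] allE[of _ "1/2"]) auto
  moreover have "m \<in> cball 0 a"
    unfolding m_def by (rule convexD_alt[OF convex_cball]) (use z x in auto)
  then have "\<Phi> z + \<phi> z \<bullet> (m - z) \<le> \<Phi> m" by (rule Phi_tangent[OF z])
  moreover have "m - z = (1/2) *\<^sub>R (x - z)"
    unfolding m_def by (rule euclidean_eqI) (simp add: inner_simps field_simps)
  ultimately show ?thesis by simp
qed

lemma Phi_ge_Phi_0: "x \<in> cball 0 a \<Longrightarrow> \<Phi> 0 \<le> \<Phi> x"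
  using Phi_tangent[of 0 x] a_pos by (simp add: phi_0)

text \<open>The convex conjugate of \<open>\<Phi>\<close>, the supremum being attained at \<open>\<psi> y\<close>.\<close>

definition Phi_conj :: "'a \<Rightarrow> real" where
  "Phi_conj y = y \<bullet> \<psi> y - \<Phi> (\<psi> y)"

text \<open>The Fenchel-Young inequality: the tangent inequality at \<open>\<psi> y\<close>, where
  the gradient of \<Phi> is \<open>y\<close>.\<close>

lemma Phi_conj_ge: "x \<in> cball 0 a \<Longrightarrow> y \<bullet> x - \<Phi> x \<le> Phi_conj y"
  using Phi_tangent[of "\<psi> y" x] by (simp add: Phi_conj_def inner_diff_right)

text \<open>Fenchel-Young for \<open>y'\<close> at the point \<open>\<psi> y\<close>, which is
  optimal for \<open>y\<close>. Thus \<open>\<psi>\<close> selects a subgradient of the conjugate,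
  and this is all the differentiability of the conjugate that is used.\<close>

lemma Phi_conj_tangent: "Phi_conj y + (y' - y) \<bullet> \<psi> y \<le> Phi_conj y'"
  using Phi_conj_ge[of "\<psi> y" y'] by (simp add: Phi_conj_def inner_diff_left)

text \<open>The Lipschitz constant is the bound on the subgradients \<open>\<psi> y\<close>.\<close>

lemma Phi_conj_lipschitz: "\<bar>Phi_conj y' - Phi_conj y\<bar> \<le> a * norm (y' - y)"
proof -
  have *: "Phi_conj y - Phi_conj y' \<le> a * norm (y' - y)" for y y'
  proof -
    have "Phi_conj y - Phi_conj y' \<le> \<bar>(y' - y) \<bullet> \<psi> y\<bar>"
      using Phi_conj_tangent[of y y'] by linarith
    also have "\<dots> \<le> norm (y' - y) * norm (\<psi> y)" by (rule Cauchy_Schwarz_ineq2)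
    also have "\<dots> \<le> norm (y' - y) * a" using psi_less[of y] by (intro mult_left_mono) auto
    finally show ?thesis by (simp add: mult.commute)
  qed
  show ?thesis using *[of y y'] *[of y' y] by (simp add: norm_minus_commute abs_le_iff)
qed

text \<open>Fenchel-Young is tested at the point of the sphere in direction \<open>y\<close>, where
  \<Phi> \<le> 0.\<close>

lemma Phi_conj_coercive: "a * norm y \<le> Phi_conj y"
proof (cases "y = 0")
  case True
  then show ?thesis using Phi_nonpos[of "\<psi> 0"] by (simp add: Phi_conj_def)
next
  case False
  define x where "x = (a / norm y) *\<^sub>R y"
  have x: "x \<in> cball 0 a" using False a_pos by (simp add: x_def)
  have "y \<bullet> x = a * norm y"
    using False by (simp add: x_def dot_square_norm power2_eq_square)
  then show ?thesis using Phi_conj_ge[OF x, of y] Phi_nonpos[OF x] by simp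
qed

lemma Phi_conj_cont: "continuous_on S Phi_conj"
proof -
  have "a-lipschitz_on UNIV Phi_conj"
    using Phi_conj_lipschitz a_pos by (auto simp: lipschitz_on_def dist_norm dist_real_def)
  then show ?thesis using lipschitz_on_continuous_on continuous_on_subset by blast
qed

text \<open>The multiplier minimises the dual functional \<open>\<mu> \<mapsto> \<integral> \<Phi>\<^sup>*(\<mu> - P) - \<mu> \<bullet> c\<close>, which is coercive
  because \<open>\<Phi>\<^sup>* y \<ge> a |y|\<close>.\<close>

lemma ex_multiplier:
  assumes T: "0 < T" and P: "continuous_on {0..T} P" and c: "norm c < a * T"
  shows "\<exists>l. (LINT t|leb T. \<psi> (l - P t)) = c"
proof -
  have cpsi: "continuous_on {0..T} (\<lambda>t. \<psi> (m - P t))" for m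
    by (rule continuous_on_compose2[OF psi_cont[of UNIV]]) (auto intro!: continuous_intros P)
  have cconj: "continuous_on {0..T} (\<lambda>t. Phi_conj (m - P t))" for m
    by (rule continuous_on_compose2[OF Phi_conj_cont[of UNIV]]) (auto intro!: continuous_intros P)
  note ipsi = integrable_leb_continuous[OF cpsi] and iconj = integrable_leb_continuous[OF cconj]
  define q where "q m = (LINT t|leb T. Phi_conj (m - P t)) - m \<bullet> c" for m
  define Mf where "Mf m = (LINT t|leb T. \<psi> (m - P t))" for m
  \<comment> \<open>The slack in the constraint is the growth rate of the dual functional: a T comes
    from coercivity of the conjugate, \<open>norm c\<close> is lost to the linear term, and
    \<open>K\<close> absorbs the shift by \<open>P\<close>.\<close>
  define \<kappa> where "\<kappa> = a * T - norm c"
  define K where "K = a * (LINT t|leb T. norm (P t))"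
  have \<kappa>: "\<kappa> > 0" using c by (simp add: \<kappa>_def)
  have low: "\<kappa> * norm m - K \<le> q m" for m
  proof -
    have iP: "integrable (leb T) (\<lambda>t. a * norm m - a * norm (P t))"
      by (intro integrable_leb_continuous continuous_intros P)
    have ia: "integrable (leb T) (\<lambda>t. a * norm m)" "integrable (leb T) (\<lambda>t. a * norm (P t))"
      by (intro integrable_leb_continuous continuous_intros P)+
    have "(LINT t|leb T. a * norm m - a * norm (P t)) = T * (a * norm m) - K"
      using ia LINT_leb_const[of T "a * norm m"] T by (subst Bochner_Integration.integral_diff) (auto simp: K_def)
    moreover have "(LINT t|leb T. a * norm m - a * norm (P t)) \<le> (LINT t|leb T. Phi_conj (m - P t))"
    proof (rule Bochner_Integration.integral_mono[OF iP iconj])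
      fix t
      have "a * (norm m - norm (P t)) \<le> a * norm (m - P t)"
        using a_pos norm_triangle_ineq2 by (intro mult_left_mono) auto
      then show "a * norm m - a * norm (P t) \<le> Phi_conj (m - P t)"
        using Phi_conj_coercive[of "m - P t"] by (simp add: right_diff_distrib)
    qed
    moreover have "m \<bullet> c \<le> norm m * norm c" by (rule norm_cauchy_schwarz)
    ultimately show ?thesis by (simp add: q_def \<kappa>_def algebra_simps)
  qed
  \<comment> \<open>\<open>Mf m - c\<close> is a subgradient of \<open>q\<close> at
    \<open>m\<close>, so it remains to show that it vanishes at the minimiser.\<close>
  have qsub: "q m + (m' - m) \<bullet> (Mf m - c) \<le> q m'" for m m'
  proof -
    have i2: "integrable (leb T) (\<lambda>t. (m' - m) \<bullet> \<psi> (m - P t))"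
      by (intro integrable_leb_continuous continuous_on_inner continuous_on_const cpsi)
    have "(LINT t|leb T. Phi_conj (m - P t) + (m' - m) \<bullet> \<psi> (m - P t)) \<le> (LINT t|leb T. Phi_conj (m' - P t))"
    proof (rule Bochner_Integration.integral_mono)
      show "Phi_conj (m - P t) + (m' - m) \<bullet> \<psi> (m - P t) \<le> Phi_conj (m' - P t)" for t
        using Phi_conj_tangent[of "m - P t" "m' - P t"] by simp
    qed (use iconj i2 in auto)
    moreover have "(LINT t|leb T. Phi_conj (m - P t) + (m' - m) \<bullet> \<psi> (m - P t))
      = (LINT t|leb T. Phi_conj (m - P t)) + (LINT t|leb T. (m' - m) \<bullet> \<psi> (m - P t))"
      by (rule Bochner_Integration.integral_add[OF iconj i2])
    moreover have "(LINT t|leb T. (m' - m) \<bullet> \<psi> (m - P t)) = (m' - m) \<bullet> Mf m"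
      unfolding Mf_def by (rule integral_bounded_linear[OF bounded_linear_inner_right ipsi])
    ultimately show ?thesis by (simp add: q_def inner_diff_left inner_diff_right)
  qed
  have Mbound: "norm (Mf m) \<le> a * T" for m
  proof -
    have "norm (Mf m) \<le> (LINT t|leb T. a)"
      unfolding Mf_def using psi_less
      by (intro Bochner_Integration.integral_norm_bound_integral ipsi integrable_leb_continuous)
         (auto intro: less_imp_le)
    also have "\<dots> = a * T" using T by (subst LINT_leb_const) auto
    finally show ?thesis .
  qed
  have qlip: "\<bar>q m' - q m\<bar> \<le> (a * T + norm c) * norm (m' - m)" for m m'
  proof -
    have *: "q m - q m' \<le> (a * T + norm c) * norm (m' - m)" for m m'
    proof -
      have "q m - q m' \<le> \<bar>(m' - m) \<bullet> (Mf m - c)\<bar>" using qsub[of m m'] by linarith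
      also have "\<dots> \<le> norm (m' - m) * norm (Mf m - c)" by (rule Cauchy_Schwarz_ineq2)
      also have "\<dots> \<le> norm (m' - m) * (a * T + norm c)"
        using Mbound[of m] norm_triangle_ineq4[of "Mf m" c] by (intro mult_left_mono) auto
      finally show ?thesis by (simp add: mult.commute)
    qed
    show ?thesis using *[of m m'] *[of m' m] by (simp add: norm_minus_commute abs_le_iff)
  qed
  have "(a * T + norm c)-lipschitz_on UNIV q"
    using qlip a_pos T by (auto simp: lipschitz_on_def dist_norm dist_real_def)
  then have qcont: "continuous_on S q" for S
    using lipschitz_on_continuous_on continuous_on_subset by blast
  \<comment> \<open>Outside this radius the lower bound already exceeds \<open>q 0\<close>, so a
    minimiser over the ball is a global one.\<close>
  define R where "R = (q 0 + K) / \<kappa>"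
  have "R \<ge> 0" using low[of 0] \<kappa> by (simp add: R_def)
  then have "cball (0::'a) R \<noteq> {}" by simp
  then obtain l where l: "l \<in> cball 0 R" and lmin: "\<And>m. m \<in> cball 0 R \<Longrightarrow> q l \<le> q m"
    using continuous_attains_inf[OF compact_cball _ qcont] by blast
  have lmin': "q l \<le> q m" for m
  proof (cases "m \<in> cball 0 R")
    case False
    then have "R < norm m" by simp
    then have "q 0 < \<kappa> * norm m - K" using \<kappa> by (simp add: R_def field_simps)
    then have "q 0 < q m" using low[of m] by linarith
    then show ?thesis using lmin[of 0] \<open>R \<ge> 0\<close> by simp
  qed (rule lmin)
  \<comment> \<open>Differentiability of \<open>q\<close> is avoided: the subgradient inequality
    from l + e / (n + 1) back to the minimiser \<open>l\<close> gives the sign at the shifted point,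
    and \<open>Mf\<close> is continuous along the sequence.\<close>
  have dir: "0 \<le> (Mf l - c) \<bullet> e" for e
  proof -
    have "(\<lambda>n. Mf (l + (1 / real (Suc n)) *\<^sub>R e)) \<longlonglongrightarrow> Mf l"
      unfolding Mf_def
    proof (rule integral_dominated_convergence[where w = "\<lambda>_. a"])
      show "AE t in leb T. (\<lambda>n. \<psi> (l + (1 / real (Suc n)) *\<^sub>R e - P t)) \<longlonglongrightarrow> \<psi> (l - P t)"
      proof (rule AE_I2)
        fix t
        have "(\<lambda>n. l + (1 / real (Suc n)) *\<^sub>R e - P t) \<longlonglongrightarrow> l + 0 *\<^sub>R e - P t"
          using LIMSEQ_inverse_real_of_nat by (intro tendsto_intros) (simp add: inverse_eq_divide)
        then show "(\<lambda>n. \<psi> (l + (1 / real (Suc n)) *\<^sub>R e - P t)) \<longlonglongrightarrow> \<psi> (l - P t)"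
          by (intro continuous_on_tendsto_compose[OF psi_cont[of UNIV]]) auto
      qed
      show "AE t in leb T. norm (\<psi> (l + (1 / real (Suc n)) *\<^sub>R e - P t)) \<le> a" for n
        using psi_less by (intro AE_I2) (auto intro: less_imp_le)
    qed (auto intro!: borel_measurable_integrable[OF ipsi] integrable_leb_continuous)
    then have lim: "(\<lambda>n. (Mf (l + (1 / real (Suc n)) *\<^sub>R e) - c) \<bullet> e) \<longlonglongrightarrow> (Mf l - c) \<bullet> e"
      by (intro tendsto_intros)
    have "0 \<le> (Mf (l + (1 / real (Suc n)) *\<^sub>R e) - c) \<bullet> e" for n
    proof -
      define m where "m = l + (1 / real (Suc n)) *\<^sub>R e"
      have "q m + (l - m) \<bullet> (Mf m - c) \<le> q m" using qsub[of m l] lmin'[of m] by linarith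
      then have "(1 / real (Suc n)) * (e \<bullet> (Mf m - c)) \<ge> 0" by (simp add: m_def)
      then show ?thesis unfolding m_def[symmetric]
        by (simp add: zero_le_mult_iff zero_le_divide_iff inner_commute)
    qed
    then show ?thesis by (intro LIMSEQ_le_const[OF lim]) auto
  qed
  have "(Mf l - c) \<bullet> (Mf l - c) \<le> 0" using dir[of "- (Mf l - c)"] by (simp only: inner_minus_right)
  then have "Mf l = c" using inner_eq_zero_iff[of "Mf l - c"] inner_ge_zero[of "Mf l - c"] by simp
  then show ?thesis by (auto simp: Mf_def)
qed

text \<open>If the radial part of \<open>\<phi>\<close> were bounded on the ray, then
  \<open>\<phi>\<close> itself would be, and the ray would stay in the \<psi>-image of a compact
  ball. This image is closed, so it would contain the endpoint of norm a, but values of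
  \<open>\<psi>\<close> have norm below a.\<close>

lemma phi_steep:
  assumes w: "norm w = 1"
  shows "\<exists>s. 0 < s \<and> s < 1 \<and> C < \<phi> (((1 - s) * a) *\<^sub>R w) \<bullet> w"
proof (rule ccontr)
  assume "\<not> ?thesis"
  then have bound: "\<phi> (((1 - s) * a) *\<^sub>R w) \<bullet> w \<le> C" if "0 < s" "s < 1" for s
    using that by (meson not_less)
  define R where "R = \<bar>C\<bar> + \<bar>\<Phi> 0\<bar> / a"
  have mem: "((1 - s) * a) *\<^sub>R w \<in> \<psi> ` cball 0 R" if s: "0 < s" "s < 1" for s
  proof -
    define r where "r = (1 - s) * a"
    have r: "0 < r" "r < a" using s a_pos by (auto simp: r_def)
    have rb: "r *\<^sub>R w \<in> ball 0 a" using r w by simp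
    define y where "y = \<phi> (r *\<^sub>R w)"
    \<comment> \<open>Since \<open>\<psi> y\<close> is the point on the ray, coercivity of the
      conjugate turns a bound on the radial component of \<open>y\<close> into one on its
      norm.\<close>
    have "a * norm y \<le> y \<bullet> (r *\<^sub>R w) - \<Phi> (r *\<^sub>R w)"
      using Phi_conj_coercive[of y] psi_phi[OF rb] by (simp add: Phi_conj_def y_def)
    also have "\<dots> \<le> r * \<bar>C\<bar> - \<Phi> 0"
    proof -
      have "y \<bullet> w \<le> \<bar>C\<bar>" using bound[OF s] by (simp add: y_def r_def)
      then have "r * (y \<bullet> w) \<le> r * \<bar>C\<bar>" using r by (intro mult_left_mono) auto
      moreover have "\<Phi> 0 \<le> \<Phi> (r *\<^sub>R w)" using rb by (intro Phi_ge_Phi_0) auto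
      ultimately show ?thesis by simp
    qed
    also have "\<dots> \<le> a * \<bar>C\<bar> + \<bar>\<Phi> 0\<bar>"
      using mult_right_mono[of r a "\<bar>C\<bar>"] r by linarith
    also have "\<dots> = a * R" using a_pos by (simp add: R_def field_simps)
    finally have "norm y \<le> R" using a_pos by simp
    moreover have "r *\<^sub>R w = \<psi> y" using psi_phi[OF rb] by (simp add: y_def)
    ultimately show ?thesis unfolding r_def[symmetric] by auto
  qed
  have "closed (\<psi> ` cball 0 R)"
    by (intro compact_imp_closed compact_continuous_image psi_cont compact_cball)
  \<comment> \<open>The double successor keeps s = 1 / (n + 2) strictly below 1, as
    \<open>mem\<close> demands.\<close>
  moreover have "((1 - 1 / real (Suc (Suc n))) * a) *\<^sub>R w \<in> \<psi> ` cball 0 R" for n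
    by (rule mem) auto
  moreover have "(\<lambda>n. ((1 - 1 / real (Suc (Suc n))) * a) *\<^sub>R w) \<longlonglongrightarrow> ((1 - 0) * a) *\<^sub>R w"
    using LIMSEQ_Suc[OF LIMSEQ_inverse_real_of_nat]
    by (intro tendsto_intros) (simp add: inverse_eq_divide)
  ultimately have "((1 - 0) * a) *\<^sub>R w \<in> \<psi> ` cball 0 R"
    by (rule closed_sequentially)
  then obtain y where "a *\<^sub>R w = \<psi> y" by auto
  then have "norm (a *\<^sub>R w) < a" using psi_less[of y] by simp
  then show False using w a_pos by simp
qed

end

section \<open>The energy functional\<close>

text \<open>Lebesgue measure is complete. This is applied to integrands built from
  \<open>wderiv\<close>, whose values may leave the closed ball on a null set, where nothing is
  known about \<Phi>.\<close>

lemma borel_measurable_leb_AE_eq: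
  fixes f h :: "real \<Rightarrow> 'b::euclidean_space"
  assumes f: "f \<in> borel_measurable (leb T)" and ae: "AE t in leb T. f t = h t"
  shows "h \<in> borel_measurable (leb T)"
proof -
  obtain N where N: "N \<in> null_sets (leb T)" and eq: "{t \<in> space (leb T). f t \<noteq> h t} \<subseteq> N"
    using ae by (auto simp: eventually_ae_filter)
  have "f \<in> borel_measurable (lebesgue_on ({0..T} - N))"
    using f borel_measurable_diff_null[OF N, of f] by simp
  moreover have "h \<in> borel_measurable (lebesgue_on ({0..T} - N)) \<longleftrightarrow> f \<in> borel_measurable (lebesgue_on ({0..T} - N))"
    using eq by (intro measurable_cong) auto
  ultimately show ?thesis using borel_measurable_diff_null[OF N, of h] by simp
qed

lemma LINT_leb_cong_AE:
  fixes f h :: "real \<Rightarrow> 'b::euclidean_space"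
  assumes f: "f \<in> borel_measurable (leb T)" and ae: "AE t in leb T. f t = h t"
  shows "(LINT t|leb T. h t) = (LINT t|leb T. f t)"
  using ae by (intro integral_cong_AE borel_measurable_leb_AE_eq[OF f ae] f) (auto elim: eventually_mono)

lemma lsc_fun_tendsto_le:
  assumes lsc: "lsc_fun f" and x: "(x \<longlongrightarrow> z) G" and l: "((\<lambda>n. f (x n)) \<longlongrightarrow> l) G" and "G \<noteq> bot"
  shows "f z \<le> l"
proof (rule ccontr)
  assume "\<not> f z \<le> l"
  then obtain c where c: "l < c" "c < f z" using dense not_le by metis
  then have "c < Liminf (nhds z) f" using lsc by (auto simp: lsc_fun_def intro: less_le_trans)
  then have "\<forall>\<^sub>F y in nhds z. c < f y" by (rule less_LiminfD)
  then have "\<forall>\<^sub>F n in G. c < f (x n)" using x unfolding filterlim_iff by blast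
  then have "\<forall>\<^sub>F n in G. c \<le> f (x n)" by eventually_elim simp
  then have "c \<le> l" by (rule tendsto_lowerbound[OF l _ \<open>G \<noteq> bot\<close>])
  with c show False by simp
qed

text \<open>A relation instead of a function \<open>wderiv\<close>: many \<open>g\<close> serve the
  same \<open>v\<close>, and the regularity proof replaces one by a continuous one.\<close>

definition is_primitive :: "real \<Rightarrow> real \<Rightarrow> (real \<Rightarrow> 'a::euclidean_space) \<Rightarrow> (real \<Rightarrow> 'a) \<Rightarrow> bool" where
  "is_primitive T a v g \<longleftrightarrow> g \<in> bdd_meas T a \<and> (\<forall>t\<in>{0..T}. v t = v 0 + primitive T g t)"

lemma is_primitiveD:
  assumes "is_primitive T a v g"
  shows "g \<in> bdd_meas T a" "t \<in> {0..T} \<Longrightarrow> v t = v 0 + primitive T g t"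
  using assms unfolding is_primitive_def by blast+

lemma is_primitive_continuous:
  assumes "is_primitive T a v g"
  shows "continuous_on {0..T} v"
proof -
  have "continuous_on {0..T} (\<lambda>t. v 0 + primitive T g t)"
    by (intro continuous_intros continuous_primitive[OF is_primitiveD(1)[OF assms]])
  then show ?thesis
    by (rule continuous_on_eq) (simp add: is_primitiveD(2)[OF assms, symmetric])
qed

lemma is_primitive_lipschitz:
  assumes v: "is_primitive T a v g" and "s \<in> {0..T}" "t \<in> {0..T}"
  shows "norm (v t - v s) \<le> a * \<bar>t - s\<bar>"
  using is_primitiveD(2)[OF v assms(2)] is_primitiveD(2)[OF v assms(3)]
    primitive_lipschitz[OF is_primitiveD(1)[OF v] assms(2,3)] by simp

lemma is_primitive_convex_comb:
  assumes v: "is_primitive T a v g" and u: "is_primitive T a u h" and s: "0 \<le> s" "s \<le> 1"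
  shows "is_primitive T a (\<lambda>t. (1 - s) *\<^sub>R v t + s *\<^sub>R u t) (\<lambda>t. (1 - s) *\<^sub>R g t + s *\<^sub>R h t)"
  unfolding is_primitive_def
proof (intro conjI ballI)
  note B = is_primitiveD(1)[OF v] is_primitiveD(1)[OF u]
  show "(\<lambda>t. (1 - s) *\<^sub>R g t + s *\<^sub>R h t) \<in> bdd_meas T a"
    by (rule bdd_meas_convex_comb[OF B s])
  fix t assume t: "t \<in> {0..T}"
  show "(1 - s) *\<^sub>R v t + s *\<^sub>R u t = (1 - s) *\<^sub>R v 0 + s *\<^sub>R u 0
    + primitive T (\<lambda>t. (1 - s) *\<^sub>R g t + s *\<^sub>R h t) t"
    unfolding primitive_add_scaleR[OF B[THEN bdd_measD(3)]]
    by (subst is_primitiveD(2)[OF v t], subst is_primitiveD(2)[OF u t]) (simp add: scaleR_add_right)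
qed

lemma continuous_on_case_prod_compose:
  assumes F: "continuous_on (S \<times> UNIV) (\<lambda>(t, x). F t x)" and v: "continuous_on S v"
  shows "continuous_on S (\<lambda>t. F t (v t))"
proof -
  have "continuous_on S (\<lambda>t. (t, v t))" by (intro continuous_intros v)
  from continuous_on_compose2[OF F this] show ?thesis by auto
qed

locale phi_bvp = singular_potential a \<phi> \<psi> \<Phi>
  for a :: real and \<phi> \<psi> :: "'a::euclidean_space \<Rightarrow> 'a" and \<Phi> :: "'a \<Rightarrow> real" +
  fixes T :: real and F :: "real \<Rightarrow> 'a \<Rightarrow> real" and gradF :: "real \<Rightarrow> 'a \<Rightarrow> 'a"
    and j :: "'a \<times> 'a \<Rightarrow> ereal"
  assumes T_pos: "0 < T"
    and F_cont: "continuous_on ({0..T} \<times> UNIV) (\<lambda>(t, x). F t x)"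
    and F_deriv: "\<And>t x. t \<in> {0..T} \<Longrightarrow> GDERIV (F t) x :> gradF t x"
    and gradF_cont: "continuous_on ({0..T} \<times> UNIV) (\<lambda>(t, x). gradF t x)"
    and j_convex: "convex_fun j" and j_lsc: "lsc_fun j"
    and j_0: "j 0 = 0" and j_subdiff: "0 \<in> subdiff j 0"
    and lambda1_pos: "lambda1 T a j > 0"
begin

abbreviation dom :: "(real \<Rightarrow> 'a) set" where
  "dom \<equiv> dom_PsiJ T a j"

definition PhiI :: "(real \<Rightarrow> 'a) \<Rightarrow> real" where
  "PhiI g = (LINT t|leb T. \<Phi> (g t))"

text \<open>Meaningful on the domain; where \<open>j\<close> is infinite the conversion yields the
  default 0.\<close>

definition jr :: "(real \<Rightarrow> 'a) \<Rightarrow> real" where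
  "jr v = real_of_ereal (j (v 0, v T))"

definition R0 :: real where
  "R0 = a * (1 / sqrt (lambda1 T a j) + T)"

lemma a_nonneg: "0 \<le> a" and T_nonneg: "0 \<le> T"
  using a_pos T_pos by auto

lemma j_nonneg: "0 \<le> j z"
proof -
  have "j 0 + ereal (0 \<bullet> (z - 0)) \<le> j z"
    using j_subdiff unfolding subdiff_def by blast
  then show ?thesis by (simp add: j_0)
qed

lemma j_real: "j z < \<infinity> \<Longrightarrow> j z = ereal (real_of_ereal (j z))"
  using j_nonneg[of z] by (cases "j z") auto

lemma dom_iff: "v \<in> dom \<longleftrightarrow> (\<exists>g. is_primitive T a v g) \<and> j (v 0, v T) < \<infinity>"
proof -
  have "v \<in> K_set T a \<longleftrightarrow> (\<exists>g. is_primitive T a v g)"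
  proof
    assume "v \<in> K_set T a"
    obtain g where "g \<in> bdd_meas T a" "\<And>t. t \<in> {0..T} \<Longrightarrow> v t = v 0 + primitive T g t"
      and "AE t in leb T. wderiv T v t = g t"
      using K_set_imp_primitive[OF T_pos a_nonneg \<open>v \<in> K_set T a\<close>] by blast
    then have "is_primitive T a v g" unfolding is_primitive_def by blast
    then show "\<exists>g. is_primitive T a v g" by blast
  next
    assume "\<exists>g. is_primitive T a v g"
    then obtain g where g: "is_primitive T a v g" ..
    show "v \<in> K_set T a"
      by (rule primitive_imp_K_set(1)[OF T_pos a_nonneg is_primitiveD(1,2)[OF g]])
  qed
  then show ?thesis by (simp add: dom_PsiJ_def)
qed

lemma domE:
  assumes "v \<in> dom"
  obtains g where "is_primitive T a v g"
  using assms dom_iff by blast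

lemma j_dom: "v \<in> dom \<Longrightarrow> j (v 0, v T) = ereal (jr v)"
  unfolding jr_def by (rule j_real) (simp add: dom_iff)

lemma jr_nonneg: "0 \<le> jr v"
  unfolding jr_def using j_nonneg real_of_ereal_pos by blast

lemma wderiv_AE:
  assumes "is_primitive T a v g"
  shows "AE t in leb T. g t = wderiv T v t"
  using primitive_imp_K_set(2)[OF T_pos a_nonneg is_primitiveD(1,2)[OF assms]] by (auto elim: eventually_mono)

lemma Phi_integrable: "g \<in> bdd_meas T a \<Longrightarrow> integrable (leb T) (\<lambda>t. \<Phi> (g t))"
  by (rule integrable_continuous_bdd_meas[OF Phi_cont])

lemma Psi_eq:
  assumes v: "is_primitive T a v g"
  shows "Psi T a \<Phi> v = ereal (PhiI g - T * \<Phi> 0)"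
proof -
  have K: "v \<in> K_set T a"
    using primitive_imp_K_set(1)[OF T_pos a_nonneg is_primitiveD(1,2)[OF v]] .
  have i: "integrable (leb T) (\<lambda>t. \<Phi> (g t))" by (rule Phi_integrable[OF is_primitiveD(1)[OF v]])
  have i0: "integrable (leb T) (\<lambda>t. \<Phi> 0)" by (intro integrable_leb_continuous continuous_intros)
  have "(LINT t|leb T. \<Phi> (wderiv T v t) - \<Phi> 0) = (LINT t|leb T. \<Phi> (g t) - \<Phi> 0)"
  proof (rule LINT_leb_cong_AE)
    show "(\<lambda>t. \<Phi> (g t) - \<Phi> 0) \<in> borel_measurable (leb T)" using i by auto
    show "AE t in leb T. \<Phi> (g t) - \<Phi> 0 = \<Phi> (wderiv T v t) - \<Phi> 0"
      using wderiv_AE[OF v] by eventually_elim simp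
  qed
  also have "\<dots> = PhiI g - (LINT t|leb T. \<Phi> 0)"
    unfolding PhiI_def by (rule Bochner_Integration.integral_diff[OF i i0])
  also have "(LINT t|leb T. \<Phi> 0) = T * \<Phi> 0"
    by (subst LINT_leb_const[OF T_nonneg]) simp
  finally show ?thesis using K by (simp add: Psi_def)
qed

lemma energy_dom:
  assumes "v \<in> dom" "is_primitive T a v g"
  shows "energy T a \<Phi> j F v = ereal (PhiI g - T * \<Phi> 0 + jr v + Ffun T F v)"
  using j_dom[OF assms(1)] Psi_eq[OF assms(2)] by (simp add: energy_def Jfun_def)

lemma energy_not_dom:
  assumes "v \<notin> dom"
  shows "energy T a \<Phi> j F v = \<infinity>"
proof (cases "v \<in> K_set T a")
  case True
  then have "j (v 0, v T) = \<infinity>" using assms by (auto simp: dom_PsiJ_def)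
  then show ?thesis using True by (simp add: energy_def Jfun_def Psi_def)
next
  case False
  then show ?thesis using j_nonneg[of "(v 0, v T)"]
    by (cases "j (v 0, v T)") (auto simp: energy_def Jfun_def Psi_def)
qed

section \<open>A priori bound and the (PS)-condition\<close>

lemma dom_bound:
  assumes v: "v \<in> dom" and t: "t \<in> {0..T}"
  shows "norm (v t) \<le> R0"
proof (cases "\<exists>t\<in>{0..T}. v t \<noteq> 0")
  case False
  moreover have "0 \<le> R0" using a_pos T_pos lambda1_pos by (simp add: R0_def)
  ultimately show ?thesis using t by simp
next
  case True
  obtain g where g: "is_primitive T a v g" using domE[OF v] .
  have cont: "continuous_on {0..T} v" by (rule is_primitive_continuous[OF g])
  have cont2: "continuous_on {0..T} (\<lambda>t. (norm (v t))\<^sup>2)" by (intro continuous_intros cont)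
  define l where "l = lambda1 T a j"
  have l: "l > 0" using lambda1_pos by (simp add: l_def)
  define Q where "Q = (LINT t|leb T. (norm (v t))\<^sup>2)"
  define Q' where "Q' = (LINT t|leb T. (norm (wderiv T v t))\<^sup>2)"
  have Qnn: "0 \<le> Q" unfolding Q_def by simp
  \<comment> \<open>The infimum ranges over functions with one nonzero value; by continuity the
    denominator is then positive, and the quotient is not the default value of a division by
    zero.\<close>
  have "Q \<noteq> 0"
  proof
    assume "Q = 0"
    obtain s where s: "s \<in> {0..T}" "v s \<noteq> 0" using True by blast
    have "(norm (v s))\<^sup>2 = 0"
      by (rule LINT_leb_nonneg_continuous_eq_0[OF cont2 _ _ s(1) T_pos])
         (use \<open>Q = 0\<close> in \<open>simp_all add: Q_def\<close>)
    with s show False by simp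
  qed
  with Qnn have Q: "0 < Q" by simp
  have "l \<le> (L2_norm_on T (wderiv T v))\<^sup>2 / (L2_norm_on T v)\<^sup>2"
    unfolding l_def lambda1_def
  proof (rule cInf_lower)
    show "bdd_below {(L2_norm_on T (wderiv T v))\<^sup>2 / (L2_norm_on T v)\<^sup>2 |v. v \<in> dom \<and> (\<exists>t\<in>{0..T}. v t \<noteq> 0)}"
      by (rule bdd_belowI[of _ 0]) auto
  qed (use v True in auto)
  also have "\<dots> = Q' / Q"
    unfolding L2_norm_on_def Q_def Q'_def by simp
  finally have lQ: "l * Q \<le> Q'" using Q by (simp add: field_simps)
  have "Q' = (LINT t|leb T. (norm (g t))\<^sup>2)"
    unfolding Q'_def using is_primitiveD(1)[OF g] wderiv_AE[OF g]
    by (intro LINT_leb_cong_AE) (auto dest: integrable_norm_square_bdd_meas elim: eventually_mono)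
  also have "\<dots> \<le> (LINT t|leb T. a\<^sup>2)"
    using bdd_measD(2)[OF is_primitiveD(1)[OF g]]
    by (intro Bochner_Integration.integral_mono integrable_norm_square_bdd_meas[OF is_primitiveD(1)[OF g]] integrable_leb_continuous)
       (auto intro!: power_mono)
  also have "\<dots> = T * a\<^sup>2" by (subst LINT_leb_const[OF T_nonneg]) simp
  finally have Q': "Q' \<le> T * a\<^sup>2" .
  \<comment> \<open>At the minimum of |v| the mean bounds the value: T |v(t0)|^2 is at most the
    square of the L^2 norm, hence at most T a^2 / \<open>l\<close>. The factor T cancels.\<close>
  obtain t0 where t0: "t0 \<in> {0..T}" and min: "\<And>s. s \<in> {0..T} \<Longrightarrow> (norm (v t0))\<^sup>2 \<le> (norm (v s))\<^sup>2"
    using continuous_attains_inf[OF compact_Icc _ cont2] T_pos by auto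
  have "T * (norm (v t0))\<^sup>2 = (LINT t|leb T. (norm (v t0))\<^sup>2)"
    by (subst LINT_leb_const[OF T_nonneg]) simp
  also have "\<dots> \<le> Q"
    unfolding Q_def
  proof (rule Bochner_Integration.integral_mono)
    show "(norm (v t0))\<^sup>2 \<le> (norm (v s))\<^sup>2" if "s \<in> space (leb T)" for s
      using that by (intro min) simp
  qed (intro integrable_leb_continuous cont2 continuous_on_const)+
  finally have "T * (norm (v t0))\<^sup>2 * l \<le> T * a\<^sup>2"
  proof -
    assume "T * (norm (v t0))\<^sup>2 \<le> Q"
    then have "T * (norm (v t0))\<^sup>2 * l \<le> Q * l" using l by (intro mult_right_mono) auto
    also have "\<dots> \<le> Q'" using lQ by (simp add: mult.commute)
    also note Q'
    finally show ?thesis .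
  qed
  then have "(norm (v t0))\<^sup>2 \<le> a\<^sup>2 / l" using T_pos l by (simp add: field_simps)
  also have "\<dots> = (a / sqrt l)\<^sup>2" using l by (simp add: power_divide)
  finally have vt0: "norm (v t0) \<le> a / sqrt l"
    by (rule power2_le_imp_le) (use a_pos l in simp)
  have "norm (v t - v t0) \<le> a * \<bar>t - t0\<bar>" by (rule is_primitive_lipschitz[OF g t0 t])
  also have "\<dots> \<le> a * T" using t t0 a_pos by (intro mult_left_mono) auto
  finally have "norm (v t) \<le> a / sqrt l + a * T"
    using vt0 norm_triangle_sub[of "v t" "v t0"] by linarith
  then show ?thesis by (simp add: R0_def l_def algebra_simps)
qed

lemma dom_convergent_subseq:
  fixes u :: "nat \<Rightarrow> real \<Rightarrow> 'a"
  assumes u: "\<And>n. u n \<in> dom"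
  obtains w r where "strict_mono r" "continuous_on {0..T} w"
    "uniform_limit {0..T} (\<lambda>n. u (r n)) w sequentially"
proof (rule equi_lipschitz_convergent_subseq[of T u R0 a])
  show "norm (u n t) \<le> R0" if "t \<in> {0..T}" for n t
    by (rule dom_bound[OF u that])
  show "norm (u n t - u n s) \<le> a * \<bar>t - s\<bar>" if "s \<in> {0..T}" "t \<in> {0..T}" for n s t
  proof -
    obtain g where "is_primitive T a (u n) g" using domE[OF u] .
    then show ?thesis by (rule is_primitive_lipschitz[OF _ that])
  qed
qed (use a_pos that in auto)

lemma PS_condition_energy: "PS_condition T a \<Phi> j F gradF"
  unfolding PS_condition_def
proof (intro allI impI)
  fix u :: "nat \<Rightarrow> real \<Rightarrow> 'a"
  assume "PS_sequence T a \<Phi> j F gradF u"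
  then have u: "u n \<in> dom" for n by (simp add: PS_sequence_def)
  obtain w r where "strict_mono r" "continuous_on {0..T} w"
    "uniform_limit {0..T} (\<lambda>n. u (r n)) w sequentially"
    using dom_convergent_subseq[of u, OF u] .
  then show "\<exists>r w. strict_mono r \<and> w \<in> C_space T \<and> (\<lambda>n. sup_norm T (\<lambda>t. u (r n) t - w t)) \<longlonglongrightarrow> 0"
    using sup_norm_tendsto_0[OF T_nonneg] by (auto simp: C_space_def)
qed

section \<open>The direct method\<close>

lemma F_bound:
  obtains B where "0 \<le> B" "\<And>t x. t \<in> {0..T} \<Longrightarrow> norm x \<le> R \<Longrightarrow> \<bar>F t x\<bar> \<le> B"
proof -
  have c: "compact ({0..T} \<times> cball (0::'a) R)" by (intro compact_Times compact_Icc compact_cball)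
  have "continuous_on ({0..T} \<times> cball 0 R) (\<lambda>(t, x). F t x)"
    by (rule continuous_on_subset[OF F_cont]) auto
  then obtain B where "0 \<le> B" "\<And>p. p \<in> {0..T} \<times> cball 0 R \<Longrightarrow> norm (case p of (t, x) \<Rightarrow> F t x) \<le> B"
    using compact_continuous_bounded[OF c] by blast
  then show ?thesis by (intro that[of B]) force+
qed

lemma gradF_bound:
  obtains B where "0 \<le> B" "\<And>t x. t \<in> {0..T} \<Longrightarrow> norm x \<le> R \<Longrightarrow> norm (gradF t x) \<le> B"
proof -
  have c: "compact ({0..T} \<times> cball (0::'a) R)" by (intro compact_Times compact_Icc compact_cball)
  have "continuous_on ({0..T} \<times> cball 0 R) (\<lambda>(t, x). gradF t x)"
    by (rule continuous_on_subset[OF gradF_cont]) auto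
  then obtain B where "0 \<le> B" "\<And>p. p \<in> {0..T} \<times> cball 0 R \<Longrightarrow> norm (case p of (t, x) \<Rightarrow> gradF t x) \<le> B"
    using compact_continuous_bounded[OF c] by blast
  then show ?thesis by (intro that[of B]) force+
qed

lemma F_comp_cont: "continuous_on {0..T} v \<Longrightarrow> continuous_on {0..T} (\<lambda>t. F t (v t))"
  by (rule continuous_on_case_prod_compose[OF F_cont])

lemma gradF_comp_cont: "continuous_on {0..T} v \<Longrightarrow> continuous_on {0..T} (\<lambda>t. gradF t (v t))"
  by (rule continuous_on_case_prod_compose[OF gradF_cont])

text \<open>The first two terms are nonnegative, since 0 minimises both \<Phi> and \<open>j\<close>,
  and the a priori bound confines the arguments of \<open>F\<close> to a compact set.\<close>

lemma energy_bounded_below: "\<exists>m::real. \<forall>v. ereal m \<le> energy T a \<Phi> j F v"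
proof -
  obtain B where B: "0 \<le> B" "\<And>t x. t \<in> {0..T} \<Longrightarrow> norm x \<le> R0 \<Longrightarrow> \<bar>F t x\<bar> \<le> B"
    using F_bound by blast
  have "ereal (- (T * B)) \<le> energy T a \<Phi> j F v" for v
  proof (cases "v \<in> dom")
    case True
    obtain g where g: "is_primitive T a v g" using domE[OF True] .
    have "T * \<Phi> 0 = (LINT t|leb T. \<Phi> 0)" by (subst LINT_leb_const[OF T_nonneg]) simp
    also have "\<dots> \<le> PhiI g"
      unfolding PhiI_def
      by (intro Bochner_Integration.integral_mono Phi_integrable is_primitiveD(1)[OF g] integrable_leb_continuous)
         (auto intro!: Phi_ge_Phi_0 bdd_measD(2)[OF is_primitiveD(1)[OF g]])
    finally have "T * \<Phi> 0 \<le> PhiI g" .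
    moreover have "(LINT t|leb T. F t (v t)) \<le> (LINT t|leb T. B)"
    proof (intro Bochner_Integration.integral_mono integrable_leb_continuous F_comp_cont
        is_primitive_continuous[OF g] continuous_on_const)
      show "F t (v t) \<le> B" if "t \<in> space (leb T)" for t
        using B(2)[of t "v t"] dom_bound[OF True, of t] that by auto
    qed
    moreover have "(LINT t|leb T. B) = T * B" by (subst LINT_leb_const[OF T_nonneg]) simp
    ultimately show ?thesis
      using jr_nonneg[of v] unfolding energy_dom[OF True g] Ffun_def ereal_less_eq by linarith
  qed (simp add: energy_not_dom)
  then show ?thesis by blast
qed

lemma Ffun_tendsto:
  assumes v: "\<And>n. continuous_on {0..T} (v n)" and w: "continuous_on {0..T} w"
    and b: "\<And>n t. t \<in> {0..T} \<Longrightarrow> norm (v n t) \<le> R"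
    and lim: "\<And>t. t \<in> {0..T} \<Longrightarrow> (\<lambda>n. v n t) \<longlonglongrightarrow> w t"
  shows "(\<lambda>n. Ffun T F (v n)) \<longlonglongrightarrow> Ffun T F w"
proof -
  obtain B where B: "0 \<le> B" "\<And>t x. t \<in> {0..T} \<Longrightarrow> norm x \<le> R \<Longrightarrow> \<bar>F t x\<bar> \<le> B"
    using F_bound by blast
  show ?thesis
    unfolding Ffun_def
  proof (rule tendsto_minus, rule integral_dominated_convergence)
  show "integrable (leb T) (\<lambda>_. B)" by (intro integrable_leb_continuous continuous_on_const)
  show "AE t in leb T. norm (F t (v n t)) \<le> B" for n
    using B(2) b by (intro AE_I2) auto
  show "AE t in leb T. (\<lambda>n. F t (v n t)) \<longlonglongrightarrow> F t (w t)"
  proof (rule AE_I2)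
    fix t assume t: "t \<in> space (leb T)"
    have "(\<lambda>n. (t, v n t)) \<longlonglongrightarrow> (t, w t)" using lim t by (auto intro!: tendsto_intros)
    then show "(\<lambda>n. F t (v n t)) \<longlonglongrightarrow> F t (w t)"
      using continuous_on_tendsto_compose[OF F_cont, of "\<lambda>n. (t, v n t)" "(t, w t)"] t by auto
  qed
  qed (intro measurable_leb_continuous F_comp_cont v w)+
qed

text \<open>A one-sided derivative along a sequence, as used by the variational inequality. The mean
  value theorem provides the dominating constant.\<close>

lemma Ffun_directional:
  assumes u: "continuous_on {0..T} u" and w: "continuous_on {0..T} w"
    and s: "s \<longlonglongrightarrow> 0" "\<And>n. 0 < s n" "\<And>n. s n \<le> 1"
  shows "(\<lambda>n. (Ffun T F (\<lambda>t. u t + s n *\<^sub>R w t) - Ffun T F u) / s n) \<longlonglongrightarrow> Ffun_deriv T gradF u w"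
proof -
  obtain Ru where Ru: "\<And>t. t \<in> {0..T} \<Longrightarrow> norm (u t) \<le> Ru"
    using compact_continuous_bounded[OF compact_Icc u] by blast
  obtain Rw where Rw: "0 \<le> Rw" "\<And>t. t \<in> {0..T} \<Longrightarrow> norm (w t) \<le> Rw"
    using compact_continuous_bounded[OF compact_Icc w] by blast
  \<comment> \<open>The radius covers every intermediate point of the mean value theorem, as the
    steps are at most 1.\<close>
  obtain B where B: "0 \<le> B" "\<And>t x. t \<in> {0..T} \<Longrightarrow> norm x \<le> Ru + Rw \<Longrightarrow> norm (gradF t x) \<le> B"
    using gradF_bound by blast
  have cs: "continuous_on {0..T} (\<lambda>t. F t (u t + c *\<^sub>R w t))" for c
    by (intro F_comp_cont continuous_intros u w)
  have cu: "continuous_on {0..T} (\<lambda>t. F t (u t))" by (rule F_comp_cont[OF u])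
  have lim: "(\<lambda>n. LINT t|leb T. (F t (u t + s n *\<^sub>R w t) - F t (u t)) / s n)
    \<longlonglongrightarrow> (LINT t|leb T. gradF t (u t) \<bullet> w t)"
  proof (rule integral_dominated_convergence)
    show "integrable (leb T) (\<lambda>_. Rw * B)" by (intro integrable_leb_continuous continuous_on_const)
    show "AE t in leb T. (\<lambda>n. (F t (u t + s n *\<^sub>R w t) - F t (u t)) / s n) \<longlonglongrightarrow> gradF t (u t) \<bullet> w t"
    proof (rule AE_I2)
      fix t assume "t \<in> space (leb T)"
      then have t: "t \<in> {0..T}" by simp
      have "((\<lambda>x. F t (u t + x *\<^sub>R w t)) has_real_derivative (w t \<bullet> gradF t (u t))) (at 0)"
        by (rule GDERIV_directional) (use F_deriv[OF t] in simp)
      then have "((\<lambda>x. (F t (u t + x *\<^sub>R w t) - F t (u t)) / x) \<longlongrightarrow> w t \<bullet> gradF t (u t)) (at 0)"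
        by (simp add: DERIV_def)
      moreover have "filterlim s (at 0) sequentially"
        unfolding filterlim_at using s(1) s(2)[THEN less_imp_neq] by (auto intro!: always_eventually)
      ultimately show "(\<lambda>n. (F t (u t + s n *\<^sub>R w t) - F t (u t)) / s n) \<longlonglongrightarrow> gradF t (u t) \<bullet> w t"
        unfolding inner_commute[of "gradF t (u t)"] by (rule filterlim_compose)
    qed
    show "AE t in leb T. norm ((F t (u t + s n *\<^sub>R w t) - F t (u t)) / s n) \<le> Rw * B" for n
    proof (rule AE_I2)
      fix t assume "t \<in> space (leb T)"
      then have t: "t \<in> {0..T}" by simp
      have "\<exists>z>0. z < s n \<and> F t (u t + s n *\<^sub>R w t) - F t (u t + 0 *\<^sub>R w t)
        = (s n - 0) * (w t \<bullet> gradF t (u t + z *\<^sub>R w t))"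
        by (rule MVT2[OF s(2)]) (intro GDERIV_directional F_deriv[OF t])
      then obtain z where z: "0 < z" "z < s n"
        "F t (u t + s n *\<^sub>R w t) - F t (u t) = s n * (w t \<bullet> gradF t (u t + z *\<^sub>R w t))"
        by auto
      have "norm (u t + z *\<^sub>R w t) \<le> norm (u t) + z * norm (w t)"
        using norm_triangle_ineq[of "u t" "z *\<^sub>R w t"] z(1) by simp
      also have "\<dots> \<le> Ru + 1 * Rw"
        using Ru[OF t] Rw(2)[OF t] z s(3)[of n] by (intro add_mono mult_mono) auto
      finally have "norm (gradF t (u t + z *\<^sub>R w t)) \<le> B" using B(2)[OF t] by simp
      then have "norm (w t) * norm (gradF t (u t + z *\<^sub>R w t)) \<le> Rw * B"
        using Rw B(1) t by (intro mult_mono) auto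
      then have "\<bar>w t \<bullet> gradF t (u t + z *\<^sub>R w t)\<bar> \<le> Rw * B"
        using Cauchy_Schwarz_ineq2 order_trans by blast
      then show "norm ((F t (u t + s n *\<^sub>R w t) - F t (u t)) / s n) \<le> Rw * B"
        unfolding z(3) using s(2)[of n] by simp
    qed
    show "(\<lambda>t. gradF t (u t) \<bullet> w t) \<in> borel_measurable (leb T)"
      by (intro measurable_leb_continuous continuous_on_inner gradF_comp_cont u w)
    show "(\<lambda>t. (F t (u t + s n *\<^sub>R w t) - F t (u t)) / s n) \<in> borel_measurable (leb T)" for n
      using s(2)[of n] by (intro measurable_leb_continuous continuous_on_divide continuous_on_diff cs cu continuous_on_const) auto
  qed
  have "(Ffun T F (\<lambda>t. u t + s n *\<^sub>R w t) - Ffun T F u) / s n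
    = - (LINT t|leb T. (F t (u t + s n *\<^sub>R w t) - F t (u t)) / s n)" for n
  proof -
    have "(LINT t|leb T. F t (u t + s n *\<^sub>R w t) - F t (u t))
      = (LINT t|leb T. F t (u t + s n *\<^sub>R w t)) - (LINT t|leb T. F t (u t))"
      by (rule Bochner_Integration.integral_diff) (intro integrable_leb_continuous cs cu)+
    then show ?thesis by (simp add: Ffun_def minus_divide_left)
  qed
  then show ?thesis using tendsto_minus[OF lim] by (simp add: Ffun_deriv_def)
qed

lemma is_primitive_0: "is_primitive T a (\<lambda>_. 0) (\<lambda>_. 0)"
  using a_pos by (auto simp: is_primitive_def bdd_meas_def primitive_def)

lemma zero_dom: "(\<lambda>_. 0) \<in> dom"
  using is_primitive_0 j_0 by (auto simp: dom_iff zero_prod_def)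

lemma dom_C_space: "v \<in> dom \<Longrightarrow> v \<in> C_space T"
  by (erule domE) (simp add: C_space_def is_primitive_continuous)

text \<open>Along a subsequence the energies, the integrals of \<Phi> and the force terms all
  converge, so the boundary terms converge as well. In the limit the integral of \<Phi> and the
  value of \<open>j\<close> can only drop, which is the favourable direction.\<close>

lemma ex_minimizer:
  "\<exists>u\<in>dom. energy T a \<Phi> j F u = (INF v\<in>C_space T. energy T a \<Phi> j F v)"
proof -
  let ?E = "energy T a \<Phi> j F"
  obtain m where m: "\<And>v. ereal m \<le> ?E v" using energy_bounded_below by blast
  have up: "(INF v\<in>C_space T. ?E v) \<le> ?E (\<lambda>_. 0)"
    by (intro INF_lower dom_C_space zero_dom)
  have lo: "ereal m \<le> (INF v\<in>C_space T. ?E v)" by (intro INF_greatest m)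
  \<comment> \<open>The infimum is finite: it is bounded below, and the zero function has finite
    energy.\<close>
  obtain \<mu> where \<mu>: "(INF v\<in>C_space T. ?E v) = ereal \<mu>"
    using lo up unfolding energy_dom[OF zero_dom is_primitive_0]
    by (cases "INF v\<in>C_space T. ?E v") auto
  have "\<exists>v\<in>C_space T. ?E v < ereal (\<mu> + 1 / real (Suc n))" for n
  proof -
    have "(INF v\<in>C_space T. ?E v) < ereal (\<mu> + 1 / real (Suc n))" by (simp add: \<mu>)
    then show ?thesis by (simp add: INF_less_iff)
  qed
  then obtain v where vC: "\<And>n. v n \<in> C_space T" and vE: "\<And>n. ?E (v n) < ereal (\<mu> + 1 / real (Suc n))"
    by metis
  have vd: "v n \<in> dom" for n
    using vE[of n] energy_not_dom[of "v n"] by (cases "v n \<in> dom") auto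
  have "\<exists>g. is_primitive T a (v n) g" for n using vd dom_iff by blast
  then obtain g where g: "\<And>n. is_primitive T a (v n) (g n)" by metis
  have gB: "g n \<in> bdd_meas T a" for n by (rule is_primitiveD(1)[OF g])
  obtain w r1 where r1: "strict_mono r1" and wc: "continuous_on {0..T} w"
    and unif: "uniform_limit {0..T} (\<lambda>n. v (r1 n)) w sequentially"
    using dom_convergent_subseq[of v, OF vd] .
  obtain B where B: "0 \<le> B" "\<And>x. x \<in> cball 0 a \<Longrightarrow> norm (\<Phi> x) \<le> B"
    using compact_continuous_bounded[OF compact_cball Phi_cont] by blast
  have Phib: "PhiI (g n) \<in> cball 0 (T * B)" for n
  proof -
    have "norm (PhiI (g n)) \<le> (LINT t|leb T. B)"
      unfolding PhiI_def
      by (intro Bochner_Integration.integral_norm_bound_integral Phi_integrable gB integrable_leb_continuous continuous_on_const B(2))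
         (use bdd_measD(2)[OF gB] in auto)
    also have "\<dots> = T * B" by (subst LINT_leb_const[OF T_nonneg]) simp
    finally show ?thesis by simp
  qed
  \<comment> \<open>The integrals of \<Phi> are bounded, so a second extraction makes them converge;
    \<open>convex_integral_lsc\<close> compares with their limit.\<close>
  have "seq_compact (cball (0::real) (T * B))" by (intro compact_imp_seq_compact compact_cball)
  moreover have "\<forall>n. PhiI (g (r1 n)) \<in> cball 0 (T * B)" using Phib by blast
  ultimately have "\<exists>l\<in>cball 0 (T * B). \<exists>r. strict_mono r \<and> ((\<lambda>n. PhiI (g (r1 n))) \<circ> r) \<longlonglongrightarrow> l"
    unfolding seq_compact_def by (elim allE[of _ "\<lambda>n. PhiI (g (r1 n))"] impE)
  then obtain L r2 where r2: "strict_mono r2" and "((\<lambda>n. PhiI (g (r1 n))) \<circ> r2) \<longlonglongrightarrow> L"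
    by blast
  then have L: "(\<lambda>n. PhiI (g (r1 (r2 n)))) \<longlonglongrightarrow> L" by (simp add: comp_def)
  define r where "r n = r1 (r2 n)" for n
  have r: "strict_mono r" using r1 r2 by (auto simp: strict_mono_def r_def)
  have unif_r: "uniform_limit {0..T} (\<lambda>n. v (r n)) w sequentially"
    unfolding r_def by (rule filterlim_compose[OF unif filterlim_subseq[OF r2]])
  have pt: "(\<lambda>n. v (r n) t) \<longlonglongrightarrow> w t" if "t \<in> {0..T}" for t
    by (rule tendsto_uniform_limitI[OF unif_r that])
  have L: "(\<lambda>n. LINT t|leb T. \<Phi> (g (r n) t)) \<longlonglongrightarrow> L"
    using L by (simp add: PhiI_def r_def)
  have "\<exists>h. is_primitive T a w h \<and> (LINT t|leb T. \<Phi> (h t)) \<le> L"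
  proof (rule convex_integral_lsc[OF T_nonneg Phi_cont Phi_convex gB is_primitiveD(2)[OF g] unif_r L])
    fix h
    assume "h \<in> bdd_meas T a" "\<And>t. t \<in> {0..T} \<Longrightarrow> w t = w 0 + primitive T h t"
      "(LINT t|leb T. \<Phi> (h t)) \<le> L"
    then show ?thesis unfolding is_primitive_def by blast
  qed
  then obtain h where wprim: "is_primitive T a w h" and hL: "(LINT t|leb T. \<Phi> (h t)) \<le> L" by blast
  have Flim: "(\<lambda>n. Ffun T F (v (r n))) \<longlonglongrightarrow> Ffun T F w"
    by (rule Ffun_tendsto[OF is_primitive_continuous[OF g] wc dom_bound[OF vd] pt])
  define e where "e n = PhiI (g n) - T * \<Phi> 0 + jr (v n) + Ffun T F (v n)" for n
  have e: "?E (v n) = ereal (e n)" for n unfolding e_def by (rule energy_dom[OF vd g])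
  have "e \<longlonglongrightarrow> \<mu>"
  proof (rule tendsto_sandwich)
    show "\<forall>\<^sub>F n in sequentially. \<mu> \<le> e n"
    proof (rule always_eventually, rule allI)
      fix n
      have "ereal \<mu> \<le> ?E (v n)" unfolding \<mu>[symmetric] by (rule INF_lower[OF vC])
      then show "\<mu> \<le> e n" by (simp add: e)
    qed
    show "\<forall>\<^sub>F n in sequentially. e n \<le> \<mu> + 1 / real (Suc n)"
    proof (rule always_eventually, rule allI)
      fix n show "e n \<le> \<mu> + 1 / real (Suc n)" using vE[of n] unfolding e by (simp add: less_imp_le)
    qed
    have "(\<lambda>n. \<mu> + 1 / real (Suc n)) \<longlonglongrightarrow> \<mu> + 0"
      using LIMSEQ_inverse_real_of_nat by (intro tendsto_intros) (simp add: inverse_eq_divide)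
    then show "(\<lambda>n. \<mu> + 1 / real (Suc n)) \<longlonglongrightarrow> \<mu>" by simp
  qed simp
  then have er: "(\<lambda>n. e (r n)) \<longlonglongrightarrow> \<mu>" using LIMSEQ_subseq_LIMSEQ[OF _ r] by (simp add: comp_def)
  \<comment> \<open>Convergence of the boundary terms is recovered as that of a difference; lower
    semicontinuity of \<open>j\<close> then bounds its value at the limit.\<close>
  have "(\<lambda>n. e (r n) - PhiI (g (r n)) + T * \<Phi> 0 - Ffun T F (v (r n))) \<longlonglongrightarrow> \<mu> - L + T * \<Phi> 0 - Ffun T F w"
    using L by (intro tendsto_intros er Flim) (simp add: PhiI_def)
  then have "(\<lambda>n. jr (v (r n))) \<longlonglongrightarrow> \<mu> - L + T * \<Phi> 0 - Ffun T F w"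
    by (simp add: e_def)
  then have "(\<lambda>n. j (v (r n) 0, v (r n) T)) \<longlonglongrightarrow> ereal (\<mu> - L + T * \<Phi> 0 - Ffun T F w)"
    using j_dom[OF vd] by simp
  moreover have "(\<lambda>n. (v (r n) 0, v (r n) T)) \<longlonglongrightarrow> (w 0, w T)"
    using T_pos by (intro tendsto_intros pt) auto
  ultimately have jw: "j (w 0, w T) \<le> ereal (\<mu> - L + T * \<Phi> 0 - Ffun T F w)"
    by (intro lsc_fun_tendsto_le[OF j_lsc]) auto
  then have wd: "w \<in> dom" using wprim by (auto simp: dom_iff intro: le_less_trans)
  have "?E w \<le> ereal \<mu>"
    unfolding energy_dom[OF wd wprim]
    using jw hL unfolding j_dom[OF wd] by (simp add: PhiI_def)
  moreover have "ereal \<mu> \<le> ?E w" unfolding \<mu>[symmetric] by (rule INF_lower[OF dom_C_space[OF wd]])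
  ultimately show ?thesis using wd \<mu> by (auto intro!: bexI[of _ w])
qed

section \<open>The variational inequality at a minimiser\<close>

lemma j_convex_real:
  assumes "j z < \<infinity>" "j z' < \<infinity>" and s: "0 < s" "s < 1"
  shows "j ((1 - s) *\<^sub>R z + s *\<^sub>R z') < \<infinity>"
    "real_of_ereal (j ((1 - s) *\<^sub>R z + s *\<^sub>R z')) \<le> (1 - s) * real_of_ereal (j z) + s * real_of_ereal (j z')"
proof -
  have "j ((1 - s) *\<^sub>R z + s *\<^sub>R z') \<le> ereal (1 - s) * j z + ereal s * j z'"
    using j_convex s unfolding convex_fun_def by blast
  also have "\<dots> = ereal ((1 - s) * real_of_ereal (j z) + s * real_of_ereal (j z'))"
    by (subst j_real[OF assms(1)], subst j_real[OF assms(2)]) simp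
  finally have le: "j ((1 - s) *\<^sub>R z + s *\<^sub>R z') \<le> ereal ((1 - s) * real_of_ereal (j z) + s * real_of_ereal (j z'))" .
  then show fin: "j ((1 - s) *\<^sub>R z + s *\<^sub>R z') < \<infinity>" by (auto intro: le_less_trans)
  show "real_of_ereal (j ((1 - s) *\<^sub>R z + s *\<^sub>R z')) \<le> (1 - s) * real_of_ereal (j z) + s * real_of_ereal (j z')"
    using le by (subst (asm) j_real[OF fin]) simp
qed

lemma dom_convex_comb:
  assumes v: "v \<in> dom" and w: "w \<in> dom" and s: "0 < s" "s < 1"
  shows "(\<lambda>t. (1 - s) *\<^sub>R v t + s *\<^sub>R w t) \<in> dom"
    "jr (\<lambda>t. (1 - s) *\<^sub>R v t + s *\<^sub>R w t) \<le> (1 - s) * jr v + s * jr w"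
proof -
  obtain g h where "is_primitive T a v g" "is_primitive T a w h" using domE[OF v] domE[OF w] by metis
  then have "is_primitive T a (\<lambda>t. (1 - s) *\<^sub>R v t + s *\<^sub>R w t) (\<lambda>t. (1 - s) *\<^sub>R g t + s *\<^sub>R h t)"
    using s by (intro is_primitive_convex_comb) auto
  then show "(\<lambda>t. (1 - s) *\<^sub>R v t + s *\<^sub>R w t) \<in> dom"
    "jr (\<lambda>t. (1 - s) *\<^sub>R v t + s *\<^sub>R w t) \<le> (1 - s) * jr v + s * jr w"
    using j_convex_real[of "(v 0, v T)" "(w 0, w T)" s] v w s
    by (auto simp: dom_iff jr_def)
qed

text \<open>The minimiser is compared with points of the segment towards \<open>v\<close>. Convexity
  handles the nonsmooth terms before division by the step, so only the force term is
  differentiated.\<close>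

lemma minimizer_variational:
  assumes u: "u \<in> dom" and min: "\<And>v. v \<in> dom \<Longrightarrow> energy T a \<Phi> j F u \<le> energy T a \<Phi> j F v"
    and v: "v \<in> dom" and gu: "is_primitive T a u gu" and gv: "is_primitive T a v gv"
  shows "PhiI gu + jr u \<le> PhiI gv + jr v + Ffun_deriv T gradF u (\<lambda>t. v t - u t)"
proof -
  \<comment> \<open>The double successor keeps the weights strictly between 0 and 1.\<close>
  define s where "s n = 1 / real (Suc (Suc n))" for n
  have s: "s \<longlonglongrightarrow> 0" "0 < s n" "s n < 1" for n
    unfolding s_def using LIMSEQ_Suc[OF LIMSEQ_inverse_real_of_nat] by (auto simp: inverse_eq_divide)
  have cu: "continuous_on {0..T} u" and cv: "continuous_on {0..T} v"
    by (rule is_primitive_continuous[OF gu], rule is_primitive_continuous[OF gv])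
  have lim: "(\<lambda>n. (Ffun T F (\<lambda>t. u t + s n *\<^sub>R (v t - u t)) - Ffun T F u) / s n)
    \<longlonglongrightarrow> Ffun_deriv T gradF u (\<lambda>t. v t - u t)"
    by (rule Ffun_directional[OF cu _ s(1,2)]) (use s(3) less_imp_le cu cv in \<open>auto intro!: continuous_intros\<close>)
  have "(PhiI gu + jr u) - (PhiI gv + jr v) \<le> (Ffun T F (\<lambda>t. u t + s n *\<^sub>R (v t - u t)) - Ffun T F u) / s n" for n
  proof -
    let ?x = "\<lambda>t. (1 - s n) *\<^sub>R u t + s n *\<^sub>R v t" and ?g = "\<lambda>t. (1 - s n) *\<^sub>R gu t + s n *\<^sub>R gv t"
    have x: "?x = (\<lambda>t. u t + s n *\<^sub>R (v t - u t))" by (auto simp: algebra_simps)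
    have xd: "?x \<in> dom" and jx: "jr ?x \<le> (1 - s n) * jr u + s n * jr v"
      using dom_convex_comb[OF u v s(2,3)] by auto
    have xp: "is_primitive T a ?x ?g"
      by (rule is_primitive_convex_comb[OF gu gv]) (use s(2,3)[of n] in auto)
    have "PhiI ?g \<le> (1 - s n) * PhiI gu + s n * PhiI gv"
      unfolding PhiI_def
      by (rule LINT_convex_comb_le[OF Phi_cont Phi_convex is_primitiveD(1)[OF gu] is_primitiveD(1)[OF gv]])
         (use s(2,3)[of n] in auto)
    moreover have "PhiI gu + jr u + Ffun T F u \<le> PhiI ?g + jr ?x + Ffun T F ?x"
      using min[OF xd] unfolding energy_dom[OF u gu] energy_dom[OF xd xp] by simp
    ultimately have "s n * ((PhiI gu + jr u) - (PhiI gv + jr v)) \<le> Ffun T F ?x - Ffun T F u"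
      using jx by (simp add: algebra_simps)
    then show ?thesis unfolding x using s(2)[of n] by (simp add: pos_le_divide_eq mult.commute)
  qed
  then have "(PhiI gu + jr u) - (PhiI gv + jr v) \<le> Ffun_deriv T gradF u (\<lambda>t. v t - u t)"
    by (intro LIMSEQ_le_const[OF lim]) auto
  then show ?thesis by simp
qed

end

section \<open>Minimisers solve the boundary value problem\<close>

text \<open>Since \<open>bdd_meas\<close> bounds a function on the whole line, one that is
  controlled on the interval is cut off outside.\<close>

lemma bdd_meas_clip:
  assumes g: "g \<in> borel_measurable (leb T)" and b: "\<And>t. t \<in> {0..T} \<Longrightarrow> norm (g t) \<le> b" and "0 \<le> b"
  shows "(\<lambda>t. if t \<in> {0..T} then g t else 0) \<in> bdd_meas T b"
proof -
  have "(\<lambda>t. if t \<in> {0..T} then g t else 0) \<in> borel_measurable (leb T) \<longleftrightarrow> g \<in> borel_measurable (leb T)"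
    by (rule measurable_cong) simp
  then show ?thesis using assms by (auto simp: bdd_meas_def)
qed

lemma LINT_leb_cong:
  "(\<And>t. t \<in> {0..T} \<Longrightarrow> f t = g t) \<Longrightarrow> (LINT t|leb T. f t) = (LINT t|leb T. g t)"
  by (rule Bochner_Integration.integral_cong) auto

lemma primitive_cong:
  "(\<And>s. s \<in> {0..T} \<Longrightarrow> g s = h s) \<Longrightarrow> primitive T g t = primitive T h t"
  unfolding primitive_def by (rule LINT_leb_cong) simp

lemma primitive_continuous_integrand:
  assumes h: "continuous_on {0..T} h" and t: "t \<in> {0..T}"
  shows "primitive T h t = integral {0..t} h"
proof -
  have "primitive T h t = integral {0..t} h - integral {0..0} h"
    unfolding primitive_def
    by (rule LINT_leb_FTC[OF h]) (use t in \<open>auto intro!: integral_has_vector_derivative[OF h]\<close>)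
  then show ?thesis by simp
qed

lemma primitive_const:
  assumes "t \<in> {0..T}"
  shows "primitive T (\<lambda>_. k) t = t *\<^sub>R k"
  using primitive_continuous_integrand[of T "\<lambda>_. k" t] assms by simp

context phi_bvp
begin

text \<open>The critical point inequality with the derivative of \<open>u\<close> made explicit, so
  that \<open>g\<close> can later be exchanged for an equal almost everywhere but regular
  representative.\<close>

definition variational :: "(real \<Rightarrow> 'a) \<Rightarrow> (real \<Rightarrow> 'a) \<Rightarrow> bool" where
  "variational u g \<longleftrightarrow> u \<in> dom \<and> is_primitive T a u g \<and>
     (\<forall>v h. v \<in> dom \<longrightarrow> is_primitive T a v h \<longrightarrow>
        PhiI g + jr u + (LINT t|leb T. gradF t (u t) \<bullet> (v t - u t)) \<le> PhiI h + jr v)"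

lemma variationalD:
  assumes "variational u g"
  shows "u \<in> dom" "is_primitive T a u g"
    "v \<in> dom \<Longrightarrow> is_primitive T a v h \<Longrightarrow>
       PhiI g + jr u + (LINT t|leb T. gradF t (u t) \<bullet> (v t - u t)) \<le> PhiI h + jr v"
  using assms unfolding variational_def by blast+

text \<open>The equality case of the bound a T for the increment. In the direction \<open>w\<close>
  of the increment the nonnegative function \<open>a - g t \<bullet> w\<close> has zero integral,
  and a vector of norm at most a whose component along \<open>w\<close> equals a is
  \<open>a *\<^sub>R w\<close>.\<close>

lemma constant_derivative_of_extremal_increment:
  assumes u: "is_primitive T a u g" and eq: "a * T \<le> norm (u T - u 0)"
  shows "\<exists>w. norm w = 1 \<and> (AE t in leb T. g t = a *\<^sub>R w)"
proof -
  define c where "c = u T - u 0"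
  have gB: "g \<in> bdd_meas T a" by (rule is_primitiveD(1)[OF u])
  have c: "c = (LINT t|leb T. g t)"
    using is_primitiveD(2)[OF u, of T] T_nonneg by (simp add: c_def primitive_T)
  have "0 < a * T" using a_pos T_pos by simp
  then have cpos: "0 < norm c" using eq unfolding c_def by (rule less_le_trans)
  define w where "w = c /\<^sub>R norm c"
  have w: "norm w = 1" using cpos by (simp add: w_def)
  have cw: "c \<bullet> w = norm c" using cpos by (simp add: w_def dot_square_norm power2_eq_square)
  have i1: "integrable (leb T) (\<lambda>t. a)" by (intro integrable_leb_continuous continuous_on_const)
  have i2: "integrable (leb T) (\<lambda>t. g t \<bullet> w)"
    using bdd_measD(3)[OF gB] by (rule integrable_bounded_linear[OF bounded_linear_inner_left])
  have le: "g t \<bullet> w \<le> a" for t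
    using norm_cauchy_schwarz[of "g t" w] w bdd_measD(2)[OF gB, of t] by simp
  have "(LINT t|leb T. a - g t \<bullet> w) = (LINT t|leb T. a) - (LINT t|leb T. g t \<bullet> w)"
    by (rule Bochner_Integration.integral_diff[OF i1 i2])
  also have "(LINT t|leb T. g t \<bullet> w) = c \<bullet> w"
    unfolding c by (rule integral_bounded_linear[OF bounded_linear_inner_left bdd_measD(3)[OF gB]])
  also have "(LINT t|leb T. a) = T * a" by (subst LINT_leb_const[OF T_nonneg]) simp
  finally have "(LINT t|leb T. a - g t \<bullet> w) \<le> 0" using eq cw by (simp add: c_def mult.commute)
  moreover have "0 \<le> (LINT t|leb T. a - g t \<bullet> w)"
    by (rule Bochner_Integration.integral_nonneg) (use le in simp)
  ultimately have "(LINT t|leb T. a - g t \<bullet> w) = 0" by simp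
  then have "AE t in leb T. a - g t \<bullet> w = 0"
    using integral_nonneg_eq_0_iff_AE[of "leb T" "\<lambda>t. a - g t \<bullet> w"] i1 i2 le by simp
  then have "AE t in leb T. g t = a *\<^sub>R w"
  proof eventually_elim
    case (elim t)
    have "(norm (g t - a *\<^sub>R w))\<^sup>2 = (norm (g t))\<^sup>2 - 2 * a * (g t \<bullet> w) + a\<^sup>2 * (norm w)\<^sup>2"
      unfolding power2_norm_eq_inner
      by (simp add: inner_diff_left inner_diff_right inner_commute power2_eq_square algebra_simps)
    also have "\<dots> = (norm (g t))\<^sup>2 - a\<^sup>2" using elim w by (simp add: power2_eq_square)
    also have "\<dots> \<le> 0" using power_mono[OF bdd_measD(2)[OF gB, of t], of 2] by simp
    finally show ?case by simp
  qed
  with w show ?thesis by blast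
qed

text \<open>Extremal increments are excluded by comparing \<open>u\<close> with \<open>(1 - s) u\<close>, since \<open>\<Phi>\<close> is steep at the
  boundary of the ball.\<close>

lemma increment_less:
  assumes var: "variational u g"
  shows "norm (u T - u 0) < a * T"
proof (rule ccontr)
  note u = variationalD(1,2)[OF var]
  assume "\<not> ?thesis"
  then obtain w where w: "norm w = 1" and ae: "AE t in leb T. g t = a *\<^sub>R w"
    using constant_derivative_of_extremal_increment[OF u(2)] by (auto simp: not_less)
  have gB: "g \<in> bdd_meas T a" by (rule is_primitiveD(1)[OF u(2)])
  have gm: "g \<in> borel_measurable (leb T)" by (rule bdd_measD(1)[OF gB])
  have cu: "continuous_on {0..T} u" by (rule is_primitive_continuous[OF u(2)])
  define A where "A = (LINT t|leb T. gradF t (u t) \<bullet> u t)"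
  \<comment> \<open>The threshold balances two effects of passing to (1 - s) u: the integral of
    \<Phi> drops by at least T s a times the radial part of \<phi>, while the force term changes by
    s A.\<close>
  obtain s where s: "0 < s" "s < 1" and steep: "A / (T * a) < \<phi> (((1 - s) * a) *\<^sub>R w) \<bullet> w"
    using phi_steep[OF w, of "A / (T * a)"] by blast
  let ?v = "\<lambda>t. (1 - s) *\<^sub>R u t + s *\<^sub>R 0" and ?g = "\<lambda>t. (1 - s) *\<^sub>R g t + s *\<^sub>R 0"
  have vd: "?v \<in> dom" and jv: "jr ?v \<le> (1 - s) * jr u + s * jr (\<lambda>_. 0)"
    using dom_convex_comb[OF u(1) zero_dom s] by auto
  have vp: "is_primitive T a ?v ?g"
    by (rule is_primitive_convex_comb[OF u(2) is_primitive_0]) (use s in auto)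
  have "jr (\<lambda>_. 0) = 0" using j_0 by (simp add: jr_def zero_prod_def)
  \<comment> \<open>Shrinking towards 0 does not raise the boundary term: \<open>j\<close> is
    convex, nonnegative, and zero at 0.\<close>
  then have jv': "jr ?v \<le> jr u" using jv s jr_nonneg[of u] mult_right_mono[of "1 - s" 1 "jr u"] by simp
  have "PhiI g + jr u + (LINT t|leb T. gradF t (u t) \<bullet> (?v t - u t)) \<le> PhiI ?g + jr ?v"
    by (rule variationalD(3)[OF var vd vp])
  moreover have "(LINT t|leb T. gradF t (u t) \<bullet> (?v t - u t)) = - s * A"
  proof -
    have "(LINT t|leb T. gradF t (u t) \<bullet> (?v t - u t)) = (LINT t|leb T. (- s) * (gradF t (u t) \<bullet> u t))"
      by (rule LINT_leb_cong) (simp add: inner_diff_right inner_add_right algebra_simps)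
    then show ?thesis by (simp add: A_def)
  qed
  moreover have "PhiI g = T * \<Phi> (a *\<^sub>R w)"
  proof -
    have "PhiI g = (LINT t|leb T. \<Phi> (a *\<^sub>R w))"
      unfolding PhiI_def using ae Phi_integrable[OF gB]
      by (intro integral_cong_AE) (auto elim: eventually_mono)
    also have "\<dots> = T * \<Phi> (a *\<^sub>R w)" by (subst LINT_leb_const[OF T_nonneg]) simp
    finally show ?thesis .
  qed
  moreover have "PhiI ?g = T * \<Phi> (((1 - s) * a) *\<^sub>R w)"
  proof -
    have "PhiI ?g = (LINT t|leb T. \<Phi> (((1 - s) * a) *\<^sub>R w))"
      unfolding PhiI_def using ae Phi_integrable[OF is_primitiveD(1)[OF vp]]
      by (intro integral_cong_AE) (auto elim: eventually_mono)
    also have "\<dots> = T * \<Phi> (((1 - s) * a) *\<^sub>R w)" by (subst LINT_leb_const[OF T_nonneg]) simp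
    finally show ?thesis .
  qed
  ultimately have "T * \<Phi> (a *\<^sub>R w) - s * A \<le> T * \<Phi> (((1 - s) * a) *\<^sub>R w)" using jv' by linarith
  \<comment> \<open>The tangent is taken at the interior point, where \<phi> is available, and
    evaluated at the boundary point.\<close>
  moreover have "\<Phi> (((1 - s) * a) *\<^sub>R w) + \<phi> (((1 - s) * a) *\<^sub>R w) \<bullet> (a *\<^sub>R w - ((1 - s) * a) *\<^sub>R w) \<le> \<Phi> (a *\<^sub>R w)"
    by (rule Phi_tangent) (use s w a_pos in \<open>auto simp: abs_mult\<close>)
  moreover have "a *\<^sub>R w - ((1 - s) * a) *\<^sub>R w = (s * a) *\<^sub>R w" by (simp add: algebra_simps)
  ultimately have "T * (\<Phi> (((1 - s) * a) *\<^sub>R w) + s * a * (\<phi> (((1 - s) * a) *\<^sub>R w) \<bullet> w)) - s * A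
    \<le> T * \<Phi> (((1 - s) * a) *\<^sub>R w)"
    using T_pos by (smt (verit) inner_scaleR_right mult_left_mono)
  then have "s * (T * a * (\<phi> (((1 - s) * a) *\<^sub>R w) \<bullet> w)) \<le> s * A" by (simp add: algebra_simps)
  then have "T * a * (\<phi> (((1 - s) * a) *\<^sub>R w) \<bullet> w) \<le> A" using s by simp
  moreover have "A < T * a * (\<phi> (((1 - s) * a) *\<^sub>R w) \<bullet> w)"
    using steep a_pos T_pos by (simp add: pos_divide_less_eq mult.commute)
  ultimately show False by simp
qed

section \<open>Regularity and the boundary condition\<close>

lemma ex_force_primitive:
  assumes u: "continuous_on {0..T} u"
  obtains P where "P 0 = 0" "continuous_on {0..T} P"
    "\<And>t. t \<in> {0..T} \<Longrightarrow> (P has_vector_derivative gradF t (u t)) (at t within {0..T})"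
proof -
  define P where "P t = integral {0..t} (\<lambda>t. gradF t (u t))" for t
  have P: "(P has_vector_derivative gradF t (u t)) (at t within {0..T})" if "t \<in> {0..T}" for t
    unfolding P_def[abs_def] by (rule integral_has_vector_derivative[OF gradF_comp_cont[OF u] that])
  moreover have "continuous_on {0..T} P"
    unfolding continuous_on_eq_continuous_within using P has_vector_derivative_continuous by blast
  moreover have "P 0 = 0" by (simp add: P_def)
  ultimately show ?thesis using that by blast
qed

lemma LINT_force_primitive:
  assumes u: "continuous_on {0..T} u"
    and P: "\<And>t. t \<in> {0..T} \<Longrightarrow> (P has_vector_derivative gradF t (u t)) (at t within {0..T})"
    and g: "g \<in> bdd_meas T b"
  shows "(LINT t|leb T. gradF t (u t) \<bullet> primitive T g t)
    = P T \<bullet> primitive T g T - (LINT t|leb T. P t \<bullet> g t)"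
  by (rule integration_by_parts_primitive[OF bounded_bilinear_inner g gradF_comp_cont[OF u] P])

text \<open>With the endpoints of \<open>u\<close> fixed, the variational inequality is the minimisation of
  \<open>\<integral> \<Phi>(h) + P \<bullet> h\<close> under the constraint \<open>\<integral> h = u T - u 0\<close>; its unique solution is
  \<open>\<psi> (l - P)\<close> for a multiplier \<open>l\<close>.\<close>

lemma derivative_representation:
  assumes var: "variational u g"
    and P: "continuous_on {0..T} P"
      "\<And>t. t \<in> {0..T} \<Longrightarrow> (P has_vector_derivative gradF t (u t)) (at t within {0..T})"
  shows "\<exists>l. variational u (\<lambda>t. if t \<in> {0..T} then \<psi> (l - P t) else 0)"
proof -
  note u = variationalD(1,2)[OF var]
  have gB: "g \<in> bdd_meas T a" by (rule is_primitiveD(1)[OF u(2)])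
  have cu: "continuous_on {0..T} u" by (rule is_primitive_continuous[OF u(2)])
  obtain l where l: "(LINT t|leb T. \<psi> (l - P t)) = u T - u 0"
    using ex_multiplier[OF T_pos P(1) increment_less[OF var]] by blast
  define h where "h t = (if t \<in> {0..T} then \<psi> (l - P t) else 0)" for t
  have cpsi: "continuous_on {0..T} (\<lambda>t. \<psi> (l - P t))"
    by (rule continuous_on_compose2[OF psi_cont[of UNIV]]) (auto intro!: continuous_intros P(1))
  have hB: "h \<in> bdd_meas T a"
    unfolding h_def using a_pos by (intro bdd_meas_clip measurable_leb_continuous cpsi) auto
  \<comment> \<open>A competitor with the expected derivative. The multiplier gives it the same
    endpoints as \<open>u\<close>, so the boundary terms cancel.\<close>
  define u0 where "u0 t = u 0 + primitive T h t" for t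
  have u0p: "is_primitive T a u0 h" using hB by (simp add: is_primitive_def u0_def)
  have hT: "primitive T h T = u T - u 0"
    unfolding primitive_T l[symmetric] by (rule LINT_leb_cong) (simp add: h_def)
  have gT: "primitive T g T = u T - u 0"
    using is_primitiveD(2)[OF u(2), of T] T_nonneg by (metis add_diff_cancel_left' atLeastAtMost_iff order_refl)
  have ends: "u0 0 = u 0" "u0 T = u T" using hT by (simp_all add: u0_def)
  have u0d: "u0 \<in> dom" using u0p u(1) ends by (auto simp: dom_iff)
  have "jr u0 = jr u" by (simp add: jr_def ends)
  then have v1: "PhiI g + (LINT t|leb T. gradF t (u t) \<bullet> (u0 t - u t)) \<le> PhiI h"
    using variationalD(3)[OF var u0d u0p] by simp
  have iPh: "integrable (leb T) (\<lambda>t. P t \<bullet> h t)" and iPg: "integrable (leb T) (\<lambda>t. P t \<bullet> g t)"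
  proof -
    obtain C where C: "0 \<le> C" "\<And>t. t \<in> {0..T} \<Longrightarrow> norm (P t) \<le> C"
      using compact_continuous_bounded[OF compact_Icc P(1)] by blast
    have "integrable (leb T) (\<lambda>t. P t \<bullet> k t)" if k: "k \<in> bdd_meas T a" for k
    proof (rule integrable_leb_bounded[where B = "C * a"])
      show "(\<lambda>t. P t \<bullet> k t) \<in> borel_measurable (leb T)"
        using measurable_leb_continuous[OF P(1)] bdd_measD(1)[OF k] by measurable
      fix t assume "t \<in> {0..T}"
      then have "norm (P t) * norm (k t) \<le> C * a"
        using C bdd_measD(2)[OF k] by (intro mult_mono) auto
      then show "norm (P t \<bullet> k t) \<le> C * a"
        using Cauchy_Schwarz_ineq2[of "P t" "k t"] by simp
    qed
    then show "integrable (leb T) (\<lambda>t. P t \<bullet> h t)" "integrable (leb T) (\<lambda>t. P t \<bullet> g t)"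
      using hB gB by blast+
  qed
  have "(LINT t|leb T. gradF t (u t) \<bullet> (u0 t - u t))
    = (LINT t|leb T. gradF t (u t) \<bullet> primitive T h t - gradF t (u t) \<bullet> primitive T g t)"
  proof (rule LINT_leb_cong)
    fix t assume "t \<in> {0..T}"
    then have "u0 t - u t = primitive T h t - primitive T g t"
      unfolding u0_def by (subst (2) is_primitiveD(2)[OF u(2)]) auto
    then show "gradF t (u t) \<bullet> (u0 t - u t) = gradF t (u t) \<bullet> primitive T h t - gradF t (u t) \<bullet> primitive T g t"
      by (simp add: inner_diff_right)
  qed
  also have "\<dots> = (LINT t|leb T. gradF t (u t) \<bullet> primitive T h t) - (LINT t|leb T. gradF t (u t) \<bullet> primitive T g t)"
    by (rule Bochner_Integration.integral_diff)
       (intro integrable_leb_continuous continuous_on_inner gradF_comp_cont[OF cu] continuous_primitive[OF hB] continuous_primitive[OF gB])+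
  \<comment> \<open>Integration by parts moves the force onto the derivatives; the terms at T cancel
    because both primitives have the same increment.\<close>
  also have "\<dots> = (LINT t|leb T. P t \<bullet> g t) - (LINT t|leb T. P t \<bullet> h t)"
    using LINT_force_primitive[OF cu P(2) hB] LINT_force_primitive[OF cu P(2) gB] by (simp add: hT gT)
  finally have v2: "PhiI g + (LINT t|leb T. P t \<bullet> g t) \<le> PhiI h + (LINT t|leb T. P t \<bullet> h t)"
    using v1 by simp
  \<comment> \<open>\<open>D t\<close> is the gap in the tangent inequality of \<Phi> at
    \<open>h t\<close>, where the gradient is \<open>l - P t\<close>, so it is nonnegative on
    {0..T}. The part with \<open>l\<close> integrates to zero by equality of the increments, and
    what remains is nonpositive by minimality. Hence the gap vanishes almost everywhere, and strict
    convexity gives g = h there.\<close>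
  define D where "D t = \<Phi> (g t) - \<Phi> (h t) - (l - P t) \<bullet> (g t - h t)" for t
  have Dexp: "D t = (\<Phi> (g t) - \<Phi> (h t)) + (P t \<bullet> g t - P t \<bullet> h t) - (l \<bullet> g t - l \<bullet> h t)" for t
    by (simp add: D_def inner_diff_left inner_diff_right)
  note ig = Phi_integrable[OF gB] and ih = Phi_integrable[OF hB]
  have il: "integrable (leb T) (\<lambda>t. l \<bullet> g t)" "integrable (leb T) (\<lambda>t. l \<bullet> h t)"
    using bdd_measD(3)[OF gB] bdd_measD(3)[OF hB] integrable_bounded_linear[OF bounded_linear_inner_right] by blast+
  have iD: "integrable (leb T) D"
    unfolding Dexp[abs_def] using ig ih iPg iPh il by (intro Bochner_Integration.integrable_diff Bochner_Integration.integrable_add)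
  have "(LINT t|leb T. l \<bullet> g t) = l \<bullet> (u T - u 0)" "(LINT t|leb T. l \<bullet> h t) = l \<bullet> (u T - u 0)"
    using integral_bounded_linear[OF bounded_linear_inner_right bdd_measD(3)[OF gB], of l]
      integral_bounded_linear[OF bounded_linear_inner_right bdd_measD(3)[OF hB], of l] gT hT
    by (simp_all add: primitive_T)
  then have "(LINT t|leb T. D t) = (PhiI g - PhiI h) + ((LINT t|leb T. P t \<bullet> g t) - (LINT t|leb T. P t \<bullet> h t))"
    unfolding Dexp PhiI_def using ig ih iPg iPh il by simp
  then have D0: "(LINT t|leb T. D t) \<le> 0" using v2 by simp
  have Dnn: "0 \<le> D t" if "t \<in> {0..T}" for t
    using Phi_tangent[of "h t" "g t"] bdd_measD(2)[OF gB, of t] that by (simp add: D_def h_def)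
  have "0 \<le> (LINT t|leb T. D t)"
    by (rule Bochner_Integration.integral_nonneg) (use Dnn in simp)
  with D0 have "(LINT t|leb T. D t) = 0" by simp
  then have "AE t in leb T. D t = 0"
    using integral_nonneg_eq_0_iff_AE[OF iD AE_I2] Dnn by simp
  then have ae: "AE t in leb T. h t = g t"
    using AE_space
  proof eventually_elim
    case (elim t)
    show ?case
    proof (rule ccontr)
      assume "h t \<noteq> g t"
      then show False
        using Phi_tangent_strict[of "h t" "g t"] bdd_measD(2)[OF gB, of t] elim by (simp add: D_def h_def)
    qed
  qed
  have prim_eq: "primitive T h t = primitive T g t" for t
    unfolding primitive_def
    using ae measurable_indicator_leb[OF bdd_measD(1)[OF gB]] measurable_indicator_leb[OF bdd_measD(1)[OF hB]]
    by (intro integral_cong_AE) (auto elim: eventually_mono)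
  have up: "is_primitive T a u h"
    unfolding is_primitive_def prim_eq using hB is_primitiveD(2)[OF u(2)] by blast
  have "PhiI h = PhiI g"
    unfolding PhiI_def using ae ig ih by (intro integral_cong_AE) (auto elim: eventually_mono)
  then have "variational u h"
    unfolding variational_def using u(1) up variationalD(3)[OF var] by simp
  then show ?thesis unfolding h_def by blast
qed

text \<open>The derivative \<open>h\<close> is continuous with values in the open ball, hence stays
  away from the sphere, and \<open>u\<close> can be moved a little along the affine function from x
  - u 0 to y - u T. This moves the endpoints along the segment towards (x, y), where convexity of
  \<open>j\<close> applies. As P 0 = 0, the vector (l, P T - l) is the pair of boundary
  fluxes.\<close>

lemma boundary_condition:
  assumes var: "variational u h" and h: "\<And>t. t \<in> {0..T} \<Longrightarrow> h t = \<psi> (l - P t)"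
    and P: "continuous_on {0..T} P"
      "\<And>t. t \<in> {0..T} \<Longrightarrow> (P has_vector_derivative gradF t (u t)) (at t within {0..T})"
    and P0: "P 0 = 0" and fin: "j (x, y) < \<infinity>"
  shows "jr u + l \<bullet> (x - u 0) + (P T - l) \<bullet> (y - u T) \<le> real_of_ereal (j (x, y))"
proof -
  note u = variationalD(1,2)[OF var]
  have hB: "h \<in> bdd_meas T a" by (rule is_primitiveD(1)[OF u(2)])
  have cu: "continuous_on {0..T} u" by (rule is_primitive_continuous[OF u(2)])
  have cpsi: "continuous_on {0..T} (\<lambda>t. \<psi> (l - P t))"
    by (rule continuous_on_compose2[OF psi_cont[of UNIV]]) (auto intro!: continuous_intros P(1))
  have ch: "continuous_on {0..T} h"
    by (rule continuous_on_eq[OF cpsi]) (simp add: h)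
  define k where "k = ((y - u T) - (x - u 0)) /\<^sub>R T"
  have Tk: "T *\<^sub>R k = (y - u T) - (x - u 0)" using T_pos by (simp add: k_def)
  define w where "w t = (x - u 0) + t *\<^sub>R k" for t
  have cw: "continuous_on {0..T} w" unfolding w_def by (intro continuous_intros)
  obtain t1 where t1: "t1 \<in> {0..T}" and max: "\<And>t. t \<in> {0..T} \<Longrightarrow> norm (h t) \<le> norm (h t1)"
    using continuous_attains_sup[OF compact_Icc _ continuous_on_norm[OF ch]] T_nonneg by auto
  \<comment> \<open>A radius strictly between the maximum of |h| and a; \<open>\<sigma>\<close> is
    the largest step considered that keeps the perturbed derivative inside it, with 1 added to the
    denominator in case the slope \<open>k\<close> is zero.\<close>
  define \<rho> where "\<rho> = (norm (h t1) + a) / 2"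
  have \<rho>: "norm (h t1) < \<rho>" "\<rho> < a" using h[OF t1] psi_less[of "l - P t1"] by (auto simp: \<rho>_def)
  have \<rho>0: "0 \<le> \<rho>" using \<rho>(1) norm_ge_zero[of "h t1"] by linarith
  define \<sigma> where "\<sigma> = (\<rho> - norm (h t1)) / (norm k + 1)"
  have \<sigma>: "0 < \<sigma>" using \<rho>(1) norm_ge_zero[of k] by (simp add: \<sigma>_def add_nonneg_pos)
  have \<sigma>k: "s * norm k \<le> \<rho> - norm (h t1)" if "0 \<le> s" "s \<le> \<sigma>" for s
  proof -
    have "s * norm k \<le> \<sigma> * (norm k + 1)" using that by (intro mult_mono) auto
    also have "\<dots> = \<rho> - norm (h t1)" using norm_ge_zero[of k] unfolding \<sigma>_def by (simp add: add_nonneg_eq_0_iff)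
    finally show ?thesis .
  qed
  \<comment> \<open>The minimum with 1/2 keeps the step below 1, as convexity of \<open>j\<close>
    requires.\<close>
  define s where "s n = min \<sigma> (1/2) * (1 / real (Suc n))" for n
  have s_pos: "0 < s n" for n using \<sigma> by (simp add: s_def)
  have s_le: "s n \<le> min \<sigma> (1/2)" for n
    using mult_left_mono[of "1 / real (Suc n)" 1 "min \<sigma> (1/2)"] \<sigma> by (simp add: s_def)
  have s_le1: "s n \<le> \<sigma>" "s n < 1" for n using s_le[of n] by auto
  have "(\<lambda>n. min \<sigma> (1/2) * (1 / real (Suc n))) \<longlonglongrightarrow> min \<sigma> (1/2) * 0"
    using LIMSEQ_inverse_real_of_nat by (intro tendsto_intros) (simp add: inverse_eq_divide)
  then have s0: "s \<longlonglongrightarrow> 0" unfolding s_def[abs_def] by simp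
  have hs: "norm (h t + s n *\<^sub>R k) \<le> \<rho>" if "t \<in> {0..T}" for t n
    using norm_triangle_ineq[of "h t" "s n *\<^sub>R k"] max[OF that] \<sigma>k[of "s n"] s_pos[of n] s_le1(1)[of n] by simp
  have hs_ball: "h t + s n *\<^sub>R k \<in> ball 0 a" if "t \<in> {0..T}" for t n
    using hs[OF that, of n] \<rho>(2) by simp
  have chs: "continuous_on {0..T} (\<lambda>t. h t + s n *\<^sub>R k)" for n by (intro continuous_intros ch)
  have cphi: "continuous_on {0..T} (\<lambda>t. \<phi> (h t + s n *\<^sub>R k))" for n
    by (rule continuous_on_compose2[OF phi_cont chs]) (use hs_ball in blast)
  define Q where "Q n = (LINT t|leb T. \<phi> (h t + s n *\<^sub>R k) \<bullet> k)" for n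
  define W where "W = (LINT t|leb T. gradF t (u t) \<bullet> w t)"
  let ?J = "real_of_ereal (j (x, y))"
  have step: "jr u + W \<le> Q n + ?J" for n
  proof -
    let ?s = "s n"
    define v where "v t = u t + ?s *\<^sub>R w t" for t
    define g where "g t = (if t \<in> {0..T} then h t + ?s *\<^sub>R k else 0)" for t
    have gB: "g \<in> bdd_meas T a"
      unfolding g_def
      by (intro bdd_meas_clip measurable_leb_continuous chs order_trans[OF hs less_imp_le[OF \<rho>(2)]] a_nonneg)
    have prim_g: "primitive T g t = primitive T h t + (?s * t) *\<^sub>R k" if "t \<in> {0..T}" for t
    proof -
      have "primitive T g t = primitive T (\<lambda>t. 1 *\<^sub>R h t + ?s *\<^sub>R k) t"
        by (rule primitive_cong) (simp add: g_def)
      also have "\<dots> = 1 *\<^sub>R primitive T h t + ?s *\<^sub>R primitive T (\<lambda>_. k) t"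
        by (rule primitive_add_scaleR[OF bdd_measD(3)[OF hB]]) (intro integrable_leb_continuous continuous_on_const)
      finally show ?thesis by (simp add: primitive_const[OF that])
    qed
    have vp: "is_primitive T a v g"
      unfolding is_primitive_def
    proof (intro conjI ballI gB)
      fix t assume t: "t \<in> {0..T}"
      have "u t = u 0 + primitive T h t" by (rule is_primitiveD(2)[OF u(2) t])
      then show "v t = v 0 + primitive T g t"
        unfolding prim_g[OF t] v_def w_def by (simp add: algebra_simps)
    qed
    have v0: "v 0 = (1 - ?s) *\<^sub>R u 0 + ?s *\<^sub>R x" by (simp add: v_def w_def algebra_simps)
    have wT: "w T = y - u T" unfolding w_def Tk by simp
    have vT: "v T = (1 - ?s) *\<^sub>R u T + ?s *\<^sub>R y" unfolding v_def wT by (simp add: algebra_simps)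
    have jv: "j (v 0, v T) < \<infinity>" "jr v \<le> (1 - ?s) * jr u + ?s * ?J"
      using j_convex_real[OF _ fin s_pos[of n] s_le1(2)[of n], of "(u 0, u T)"] u(1)
      by (simp_all add: jr_def v0 vT dom_iff)
    have vd: "v \<in> dom" using vp jv(1) by (auto simp: dom_iff)
    have "PhiI h + jr u + (LINT t|leb T. gradF t (u t) \<bullet> (v t - u t)) \<le> PhiI g + jr v"
      by (rule variationalD(3)[OF var vd vp])
    moreover have "(LINT t|leb T. gradF t (u t) \<bullet> (v t - u t)) = ?s * W"
      unfolding v_def W_def by simp
    moreover have "PhiI g \<le> PhiI h + ?s * Q n"
    proof -
      have iq: "integrable (leb T) (\<lambda>t. ?s * (\<phi> (h t + ?s *\<^sub>R k) \<bullet> k))"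
        by (intro integrable_leb_continuous continuous_on_mult continuous_on_inner continuous_on_const cphi)
      have "PhiI g \<le> (LINT t|leb T. \<Phi> (h t) + ?s * (\<phi> (h t + ?s *\<^sub>R k) \<bullet> k))"
        unfolding PhiI_def
      proof (rule Bochner_Integration.integral_mono)
        fix t assume "t \<in> space (leb T)"
        then have t: "t \<in> {0..T}" by simp
        have "h t \<in> cball 0 a" using bdd_measD(2)[OF hB] by simp
        \<comment> \<open>The tangent at the perturbed point gives an upper bound for \<Phi> there.
          Its gradient returns to \<open>l - P t\<close> as the step tends to 0.\<close>
        from Phi_tangent[OF hs_ball[OF t] this, of n]
        show "\<Phi> (g t) \<le> \<Phi> (h t) + ?s * (\<phi> (h t + ?s *\<^sub>R k) \<bullet> k)"
          using t by (simp add: g_def)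
      qed (use Phi_integrable[OF gB] Phi_integrable[OF hB] iq in auto)
      also have "\<dots> = PhiI h + ?s * Q n"
        unfolding PhiI_def Q_def using Phi_integrable[OF hB] iq by (subst Bochner_Integration.integral_add) auto
      finally show ?thesis .
    qed
    ultimately have "?s * (jr u + W) \<le> ?s * (Q n + ?J)"
      using jv(2) by (simp add: algebra_simps)
    then show ?thesis using s_pos[of n] by simp
  qed
  have Qlim: "Q \<longlonglongrightarrow> (LINT t|leb T. (l - P t) \<bullet> k)"
    unfolding Q_def[abs_def]
  proof (rule integral_dominated_convergence)
    \<comment> \<open>On this smaller closed ball \<phi> is bounded, which dominates the integrands
      uniformly in n.\<close>
    have "cball (0::'a) \<rho> \<subseteq> ball 0 a" using \<rho>(2) by auto
    then have "continuous_on (cball 0 \<rho>) \<phi>" by (rule continuous_on_subset[OF phi_cont])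
    then have "\<exists>B. \<forall>x\<in>cball 0 \<rho>. norm (\<phi> x) \<le> B"
      using compact_continuous_bounded[OF compact_cball] by metis
    then have "\<forall>x\<in>cball 0 \<rho>. norm (\<phi> x) \<le> (SOME B. \<forall>x\<in>cball 0 \<rho>. norm (\<phi> x) \<le> B)"
      by (rule someI_ex)
    then have B: "norm (\<phi> x) \<le> (SOME B. \<forall>x\<in>cball 0 \<rho>. norm (\<phi> x) \<le> B)" if "norm x \<le> \<rho>" for x
      using that by simp
    show "integrable (leb T) (\<lambda>_. (SOME B. \<forall>x\<in>cball 0 \<rho>. norm (\<phi> x) \<le> B) * norm k)"
      by (intro integrable_leb_continuous continuous_on_const)
    show "AE t in leb T. norm (\<phi> (h t + s n *\<^sub>R k) \<bullet> k) \<le> (SOME B. \<forall>x\<in>cball 0 \<rho>. norm (\<phi> x) \<le> B) * norm k" for n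
    proof (rule AE_I2)
      fix t assume "t \<in> space (leb T)"
      then have "norm (\<phi> (h t + s n *\<^sub>R k)) * norm k \<le> (SOME B. \<forall>x\<in>cball 0 \<rho>. norm (\<phi> x) \<le> B) * norm k"
        by (intro mult_right_mono B hs) auto
      then show "norm (\<phi> (h t + s n *\<^sub>R k) \<bullet> k) \<le> (SOME B. \<forall>x\<in>cball 0 \<rho>. norm (\<phi> x) \<le> B) * norm k"
        using Cauchy_Schwarz_ineq2[of "\<phi> (h t + s n *\<^sub>R k)" k] by simp
    qed
    show "AE t in leb T. (\<lambda>n. \<phi> (h t + s n *\<^sub>R k) \<bullet> k) \<longlonglongrightarrow> (l - P t) \<bullet> k"
    proof (rule AE_I2)
      fix t assume "t \<in> space (leb T)"
      then have t: "t \<in> {0..T}" by simp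
      have "(\<lambda>n. h t + s n *\<^sub>R k) \<longlonglongrightarrow> h t + 0 *\<^sub>R k" by (intro tendsto_intros s0)
      then have "(\<lambda>n. \<phi> (h t + s n *\<^sub>R k)) \<longlonglongrightarrow> \<phi> (h t)"
        using hs_ball[OF t] by (intro continuous_on_tendsto_compose[OF phi_cont]) (auto simp: h[OF t])
      then show "(\<lambda>n. \<phi> (h t + s n *\<^sub>R k) \<bullet> k) \<longlonglongrightarrow> (l - P t) \<bullet> k"
        by (intro tendsto_intros) (simp add: h[OF t])
    qed
  qed (intro measurable_leb_continuous continuous_on_inner continuous_on_diff continuous_on_const P(1) cphi)+
  have ineq: "jr u + W \<le> (LINT t|leb T. (l - P t) \<bullet> k) + ?J"
    by (rule LIMSEQ_le_const[OF tendsto_add[OF Qlim tendsto_const]]) (use step in auto)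
  have iPk: "integrable (leb T) (\<lambda>t. P t \<bullet> k)"
    by (intro integrable_leb_continuous continuous_on_inner continuous_on_const P(1))
  have ilk: "integrable (leb T) (\<lambda>t. l \<bullet> k)"
    by (intro integrable_leb_continuous continuous_on_const)
  have "(LINT t|leb T. (l - P t) \<bullet> k) = (LINT t|leb T. l \<bullet> k) - (LINT t|leb T. P t \<bullet> k)"
    unfolding inner_diff_left by (rule Bochner_Integration.integral_diff[OF ilk iPk])
  also have "(LINT t|leb T. l \<bullet> k) = l \<bullet> (T *\<^sub>R k)" by (subst LINT_leb_const[OF T_nonneg]) simp
  finally have e1: "(LINT t|leb T. (l - P t) \<bullet> k) = l \<bullet> (T *\<^sub>R k) - (LINT t|leb T. P t \<bullet> k)" .
  have kB: "(\<lambda>_. k) \<in> bdd_meas T (norm k)" by (simp add: bdd_meas_def)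
  have "W = (LINT t|leb T. gradF t (u t) \<bullet> (x - u 0) + gradF t (u t) \<bullet> primitive T (\<lambda>_. k) t)"
    unfolding W_def by (rule LINT_leb_cong) (simp add: w_def primitive_const inner_add_right)
  also have "\<dots> = (LINT t|leb T. gradF t (u t) \<bullet> (x - u 0)) + (LINT t|leb T. gradF t (u t) \<bullet> primitive T (\<lambda>_. k) t)"
    by (rule Bochner_Integration.integral_add)
       (intro integrable_leb_continuous continuous_on_inner continuous_on_const gradF_comp_cont[OF cu] continuous_primitive[OF kB])+
  also have "(LINT t|leb T. gradF t (u t) \<bullet> (x - u 0)) = (LINT t|leb T. gradF t (u t)) \<bullet> (x - u 0)"
    by (rule integral_bounded_linear[OF bounded_linear_inner_left integrable_leb_continuous[OF gradF_comp_cont[OF cu]]])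
  also have "(LINT t|leb T. gradF t (u t)) = P T"
  proof -
    have "(LINT t|leb T. gradF t (u t)) = (LINT t|leb T. indicator {0..T} t *\<^sub>R gradF t (u t))"
      by (rule LINT_leb_cong) simp
    also have "\<dots> = P T - P 0"
      by (rule LINT_leb_FTC[OF gradF_comp_cont[OF cu] P(2)]) (use T_nonneg in auto)
    finally show ?thesis by (simp add: P0)
  qed
  also have "(LINT t|leb T. gradF t (u t) \<bullet> primitive T (\<lambda>_. k) t)
    = P T \<bullet> (T *\<^sub>R k) - (LINT t|leb T. P t \<bullet> k)"
    using LINT_force_primitive[OF cu P(2) kB] T_nonneg primitive_const[of T T k] by simp
  finally have e2: "W = P T \<bullet> (x - u 0) + (P T \<bullet> (T *\<^sub>R k) - (LINT t|leb T. P t \<bullet> k))" .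
  \<comment> \<open>The integrals of \<open>P t \<bullet> k\<close> from the force term and from the
    derivative of \<Phi> cancel; only endpoint data remain.\<close>
  have "jr u + (P T \<bullet> (x - u 0) + P T \<bullet> (T *\<^sub>R k)) \<le> l \<bullet> (T *\<^sub>R k) + ?J"
    using ineq unfolding e1 e2 by linarith
  then show ?thesis
    unfolding Tk by (simp add: inner_diff_left inner_diff_right algebra_simps)
qed

lemma variational_imp_bvp_solution:
  assumes var: "variational u g"
  shows "bvp_solution T a \<phi> j gradF u"
proof -
  have cu: "continuous_on {0..T} u" by (rule is_primitive_continuous[OF variationalD(2)[OF var]])
  obtain P where P0: "P 0 = 0" and P: "continuous_on {0..T} P"
    and P': "\<And>t. t \<in> {0..T} \<Longrightarrow> (P has_vector_derivative gradF t (u t)) (at t within {0..T})"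
    using ex_force_primitive[OF cu] by blast
  obtain l where var': "variational u (\<lambda>t. if t \<in> {0..T} then \<psi> (l - P t) else 0)"
    using derivative_representation[OF var P P'] by blast
  \<comment> \<open>This agrees on {0..T} with the clipped representative, so \<open>u\<close> is
    its primitive; continuity upgrades the weak derivative to a classical one, and applying \<phi>
    leaves \<open>l - P t\<close>.\<close>
  define u' where "u' t = \<psi> (l - P t)" for t
  have cu': "continuous_on {0..T} u'"
    unfolding u'_def by (rule continuous_on_compose2[OF psi_cont[of UNIV]]) (auto intro!: continuous_intros P)
  have up: "u t = u 0 + integral {0..t} u'" if t: "t \<in> {0..T}" for t
  proof -
    have "u t = u 0 + primitive T (\<lambda>t. if t \<in> {0..T} then \<psi> (l - P t) else 0) t"
      by (rule is_primitiveD(2)[OF variationalD(2)[OF var'] t])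
    also have "primitive T (\<lambda>t. if t \<in> {0..T} then \<psi> (l - P t) else 0) t = primitive T u' t"
      by (rule primitive_cong) (simp add: u'_def)
    finally show ?thesis by (simp only: primitive_continuous_integrand[OF cu' t])
  qed
  have "C1_with_deriv T u u'"
    unfolding C1_with_deriv_def
  proof (intro conjI ballI cu')
    fix t assume t: "t \<in> {0..T}"
    have "((\<lambda>t. u 0 + integral {0..t} u') has_vector_derivative (0 + u' t)) (at t within {0..T})"
      by (intro has_vector_derivative_add has_vector_derivative_const integral_has_vector_derivative[OF cu' t])
    from has_vector_derivative_transform[OF t up this]
    show "(u has_vector_derivative u' t) (at t within {0..T})" by simp
  qed
  moreover have "norm (u' t) < a" for t by (simp add: u'_def)
  moreover have "C1_with_deriv T (\<lambda>t. \<phi> (u' t)) (\<lambda>t. - gradF t (u t))"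
    unfolding C1_with_deriv_def
  proof (intro conjI ballI continuous_on_minus gradF_comp_cont[OF cu])
    fix t assume t: "t \<in> {0..T}"
    have "((\<lambda>t. l - P t) has_vector_derivative (0 - gradF t (u t))) (at t within {0..T})"
      by (intro has_vector_derivative_diff has_vector_derivative_const P'[OF t])
    then show "((\<lambda>t. \<phi> (u' t)) has_vector_derivative - gradF t (u t)) (at t within {0..T})"
      by (simp add: u'_def)
  qed
  moreover have sub: "(\<phi> (u' 0), - \<phi> (u' T)) \<in> subdiff j (u 0, u T)"
    unfolding subdiff_def
  proof (intro CollectI allI)
    fix z :: "'a \<times> 'a"
    obtain x y where z: "z = (x, y)" by (cases z)
    show "j (u 0, u T) + ereal ((\<phi> (u' 0), - \<phi> (u' T)) \<bullet> (z - (u 0, u T))) \<le> j z"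
    proof (cases "j (x, y) < \<infinity>")
      case True
      have "jr u + l \<bullet> (x - u 0) + (P T - l) \<bullet> (y - u T) \<le> real_of_ereal (j (x, y))"
        by (rule boundary_condition[OF var' _ P P' P0 True]) simp
      then have "ereal (jr u + l \<bullet> (x - u 0) + (P T - l) \<bullet> (y - u T)) \<le> j (x, y)"
        by (subst j_real[OF True]) simp
      then show ?thesis
        unfolding z j_dom[OF variationalD(1)[OF var]] by (simp add: u'_def P0 add.assoc)
    next
      case False
      then show ?thesis by (simp add: z)
    qed
  qed
  moreover have "(u 0, u T) \<in> dom_subdiff j" using sub by (auto simp: dom_subdiff_def)
  ultimately show ?thesis unfolding bvp_solution_def by (intro exI[of _ u'] exI[of _ "\<lambda>t. - gradF t (u t)"]) auto
qed

lemma minimizer_critical: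
  assumes u: "u \<in> dom" and min: "\<And>v. v \<in> dom \<Longrightarrow> energy T a \<Phi> j F u \<le> energy T a \<Phi> j F v"
  shows "critical_point T a \<Phi> j gradF u" "bvp_solution T a \<phi> j gradF u"
proof -
  obtain g where g: "is_primitive T a u g" using domE[OF u] .
  show "critical_point T a \<Phi> j gradF u"
    unfolding critical_point_def
  proof (intro conjI ballI u)
    fix v assume v: "v \<in> dom"
    obtain h where h: "is_primitive T a v h" using domE[OF v] .
    show "0 \<le> Psi T a \<Phi> v + Jfun T j v - (Psi T a \<Phi> u + Jfun T j u)
      + ereal (Ffun_deriv T gradF u (\<lambda>t. v t - u t))"
      using minimizer_variational[OF u min v g h]
      unfolding Psi_eq[OF g] Psi_eq[OF h] Jfun_def j_dom[OF u] j_dom[OF v] by simp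
  qed
  have "variational u g"
    unfolding variational_def
  proof (intro conjI allI impI u g)
    fix v h assume "v \<in> dom" "is_primitive T a v h"
    then show "PhiI g + jr u + (LINT t|leb T. gradF t (u t) \<bullet> (v t - u t)) \<le> PhiI h + jr v"
      using minimizer_variational[OF u min _ g] by (force simp: Ffun_deriv_def)
  qed
  then show "bvp_solution T a \<phi> j gradF u" by (rule variational_imp_bvp_solution)
qed

end

theorem theorem4p1:
  fixes T a :: real
    and \<phi> :: "real ^ 'n \<Rightarrow> real ^ 'n"
    and \<Phi> :: "real ^ 'n \<Rightarrow> real"
    and F :: "real \<Rightarrow> real ^ 'n \<Rightarrow> real"
    and gradF :: "real \<Rightarrow> real ^ 'n \<Rightarrow> real ^ 'n"
    and j :: "(real ^ 'n) \<times> (real ^ 'n) \<Rightarrow> ereal"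
  assumes "0 < T" and "0 < a"
    and "\<exists>\<psi>. homeomorphism (ball 0 a) UNIV \<phi> \<psi>"
    and "\<phi> 0 = 0"
    and "\<And>x. x \<in> ball 0 a \<Longrightarrow> GDERIV \<Phi> x :> \<phi> x"
    and "continuous_on (cball 0 a) \<Phi>"
    and "strictly_convex_on (cball 0 a) \<Phi>"
    and "\<And>x. x \<in> cball 0 a \<Longrightarrow> \<Phi> x \<le> 0"
    and "continuous_on ({0..T} \<times> UNIV) (\<lambda>(t, x). F t x)"
    and "\<And>t x. t \<in> {0..T} \<Longrightarrow> GDERIV (F t) x :> gradF t x"
    and "continuous_on ({0..T} \<times> UNIV) (\<lambda>(t, x). gradF t x)"
    and "\<And>t. t \<in> {0..T} \<Longrightarrow> F t 0 = 0"
    and "proper_fun j" and "convex_fun j" and "lsc_fun j"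
    and "j 0 = 0"
    and "0 \<in> subdiff j 0"
    and "lambda1 T a j > 0"
  shows "(\<forall>v \<in> dom_PsiJ T a j. \<forall>t\<in>{0..T}. norm (v t) \<le> a * (1 / sqrt (lambda1 T a j) + T))
    \<and> PS_condition T a \<Phi> j F gradF
    \<and> (\<exists>m::real. \<forall>v \<in> C_space T. ereal m \<le> energy T a \<Phi> j F v)
    \<and> (\<exists>u \<in> dom_PsiJ T a j.
          energy T a \<Phi> j F u = (INF v \<in> C_space T. energy T a \<Phi> j F v)
        \<and> critical_point T a \<Phi> j gradF u
        \<and> bvp_solution T a \<phi> j gradF u)"
proof -
  obtain \<psi> where "homeomorphism (ball 0 a) UNIV \<phi> \<psi>" using assms(3) ..
  then interpret phi_bvp a \<phi> \<psi> \<Phi> T F gradF j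
    using assms by unfold_locales auto
  obtain u where u: "u \<in> dom" and inf: "energy T a \<Phi> j F u = (INF v\<in>C_space T. energy T a \<Phi> j F v)"
    using ex_minimizer by blast
  have min: "energy T a \<Phi> j F u \<le> energy T a \<Phi> j F v" if "v \<in> dom" for v
    unfolding inf by (rule INF_lower[OF dom_C_space[OF that]])
  have "\<forall>v\<in>dom. \<forall>t\<in>{0..T}. norm (v t) \<le> a * (1 / sqrt (lambda1 T a j) + T)"
    using dom_bound unfolding R0_def by blast
  moreover have "\<exists>m::real. \<forall>v\<in>C_space T. ereal m \<le> energy T a \<Phi> j F v"
    using energy_bounded_below by blast
  ultimately show ?thesis
    using PS_condition_energy u inf minimizer_critical[OF u min] by blast
qed

end
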